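(* Let $C$ be the commutant of $W=\langle e^\alpha\rangle$ in $V_{A_1}$, let $R_C=C/C(-2)C$ be Zhu's Poisson algebra of $C$, and $\phi_n=e^\varpi(-n-3/2)e^\varpi(-n-1)\mathbf1$ for $n\ge0$. Then (i) the vectors $[\mathbf1],[\phi_0],[\phi_1],[\phi_2],\ldots$ form a basis of $R_C$; (ii) $[\mathbf1]$ is the identity element, $[\phi_n]\cdot[\phi_m]=0$ for all $n,m\ge0$, and the Poisson bracket on $R_C$ is trivial.
   Context: $A_1=\mathbb{Z}\alpha$ with $(\alpha,\alpha)=2$, $\varpi=\alpha/2$. $V_{A_1}=\bigoplus_nM(1,n\alpha)$ is the lattice vertex operator algebra contained in the lattice generalized vertex algebra $V_{A_1^\circ}=\bigoplus_nM(1,n\varpi)$, built on Heisenberg Fock modules with vacuum $\mathbf1$ and vertex operators $e^\beta(z)=\sum_{n\in\frac12\mathbb{Z}}e^\beta(n)z^{-n-1}$ given by the standard lattice formula. $Y(v,z)=\sum_nv(n)z^{-n-1}$. $W$ is the vertex subalgebra of $V_{A_1}$ generated by $e^\alpha$ and $C=\{v\in V_{A_1}\mid [u(n),v(m)]=0\ \forall u\in W,\ n,m\in\mathbb{Z}\}$. For a vertex algebra $V$, $V(-2)V=\mathrm{span}\{u(-2)v\mid u,v\in V\}$, $R_V=V/V(-2)V$ with $[u]=u+V(-2)V$, product $[u][v]=[u(-1)v]$ and Poisson bracket $\{[u],[v]\}=[u(0)v]$. *)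

theory Defs
  imports Complex_Main "HOL-Library.Multiset"
begin

text \<open>
Concrete model of the lattice generalized vertex algebra V_{A_1 dual}.
A basis vector is indexed by a key (m, lam): it stands for the monomial
alpha(-l_1) ... alpha(-l_k) e^{m varpi}, where lam = {#l_1,...,l_k#} is a
multiset of positive integers (alpha = 2 varpi, (alpha,alpha)=2, (varpi,varpi)=1/2).
Vectors are complex-valued functions on keys (finitely supported on the space).
\<close>

type_synonym key = "int \<times> nat multiset"
type_synonym vec = "key \<Rightarrow> complex"

definition vzero :: vec where "vzero = (\<lambda>k. 0)"
definition vadd :: "vec \<Rightarrow> vec \<Rightarrow> vec" where "vadd u v = (\<lambda>k. u k + v k)"
definition vdiff :: "vec \<Rightarrow> vec \<Rightarrow> vec" where "vdiff u v = (\<lambda>k. u k - v k)"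
definition vscale :: "complex \<Rightarrow> vec \<Rightarrow> vec" where "vscale a v = (\<lambda>k. a * v k)"
definition bas :: "key \<Rightarrow> vec" where "bas k0 = (\<lambda>k. if k = k0 then 1 else 0)"

definition vsum :: "('i \<Rightarrow> vec) \<Rightarrow> vec" where
  "vsum g = (\<lambda>k. sum (\<lambda>x. g x k) {x. g x k \<noteq> 0})"

definition lin :: "(key \<Rightarrow> vec) \<Rightarrow> vec \<Rightarrow> vec" where
  "lin T f = vsum (\<lambda>k. vscale (f k) (T k))"

text \<open>Heisenberg modes alpha(n), with [alpha(m),alpha(n)] = 2 m delta_{m+n,0} and
  alpha(0) e^{m varpi} = (alpha, m varpi) e^{m varpi} = m e^{m varpi}.\<close>
definition amode_b :: "int \<Rightarrow> key \<Rightarrow> vec" where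
  "amode_b n k = (case k of (m, lam) \<Rightarrow>
     if n < 0 then bas (m, lam + {# nat (- n) #})
     else if n = 0 then vscale (of_int m) (bas (m, lam))
     else vscale (of_int (2 * n) * of_nat (count lam (nat n))) (bas (m, lam - {# nat n #})))"

definition amode :: "int \<Rightarrow> vec \<Rightarrow> vec" where "amode n = lin (amode_b n)"

fun aprod :: "int list \<Rightarrow> vec \<Rightarrow> vec" where
  "aprod [] v = v"
| "aprod (n # ns) v = amode n (aprod ns v)"

text \<open>The operator e^{b varpi} (trivial cocycle in rank one).\<close>
definition eshift :: "int \<Rightarrow> vec \<Rightarrow> vec" where
  "eshift b = lin (\<lambda>k. case k of (m, lam) \<Rightarrow> bas (m + b, lam))"

text \<open>Coefficient of prod_n x_n^{k_n} in exp(sum_n x t^n / n) style expansions: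
  for a multiset pi of positive integers, prod_n (x/n)^{k_n} / k_n!.\<close>
definition ecoef :: "complex \<Rightarrow> nat multiset \<Rightarrow> complex" where
  "ecoef x p = (\<Prod>n\<in>set_mset p. (x / of_nat n) ^ (count p n) / of_nat (fact (count p n)))"

text \<open>Standard lattice vertex operator on basis vectors:
  Y(alpha(-l_1)...alpha(-l_k) e^beta, z) =
    : prod_i (1/(l_i-1)!) d^{l_i-1} alpha(z) . E^-(-beta,z) E^+(-beta,z) e^beta z^beta :
  with beta = b varpi, so beta(n) = (b/2) alpha(n) and z^beta e^{c varpi} = z^{bc/2} e^{c varpi}.
  Each derivative field contributes a mode alpha(n) with coefficient binom(-n-1, l-1) and
  power z^{-n-l}; creation modes (n<0) are put to the left, annihilation modes (n >= 0)
  to the right of e^beta z^beta.  Ybas kv r kw is the coefficient of z^{-r-1}, i.e. the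
  mode v(r) applied to w.\<close>
definition Ybas :: "key \<Rightarrow> rat \<Rightarrow> key \<Rightarrow> vec" where
  "Ybas kv r kw = (case kv of (b, lam) \<Rightarrow> case kw of (c, mu) \<Rightarrow>
     (let ls = sorted_list_of_multiset lam in
      vsum (\<lambda>(ns :: int list, p :: nat multiset, q :: nat multiset).
        if length ns = length ls \<and> 0 \<notin># p \<and> 0 \<notin># q \<and>
           of_int (sum_list (map2 (\<lambda>n l. - n - int l) ns ls) - int (sum_mset p) + int (sum_mset q))
             + of_int (b * c) / 2 = - r - 1
        then vscale (prod_list (map2 (\<lambda>n l. (of_int (- n - 1) :: complex) gchoose (l - 1)) ns ls)
                     * ecoef (- of_int b / 2) p * ecoef (of_int b / 2) q)
               (aprod (filter (\<lambda>n. n < 0) ns)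
                 (aprod (map (\<lambda>n. - int n) (sorted_list_of_multiset q))
                   (eshift b
                     (aprod (filter (\<lambda>n. 0 \<le> n) ns)
                       (aprod (map int (sorted_list_of_multiset p)) (bas (c, mu)))))))
        else vzero)))"

text \<open>The mode v(r) w, bilinear extension (r in (1/2)Z for the generalized VA).\<close>
definition mode :: "vec \<Rightarrow> rat \<Rightarrow> vec \<Rightarrow> vec" where
  "mode v r w = vsum (\<lambda>(kv, kw). vscale (v kv * w kw) (Ybas kv r kw))"

definition imode :: "vec \<Rightarrow> int \<Rightarrow> vec \<Rightarrow> vec" where
  "imode v n w = mode v (of_int n) w"

definition VA1dual :: "vec set" where
  "VA1dual = {v. finite {k. v k \<noteq> 0} \<and> (\<forall>k. v k \<noteq> 0 \<longrightarrow> 0 \<notin># snd k)}"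

definition VA1 :: "vec set" where
  "VA1 = {v \<in> VA1dual. \<forall>k. v k \<noteq> 0 \<longrightarrow> even (fst k)}"

definition vac :: vec where "vac = bas (0, {#})"
definition ealpha :: vec where "ealpha = bas (2, {#})"
definition evarpi :: vec where "evarpi = bas (1, {#})"

inductive_set gen_sub :: "vec set \<Rightarrow> vec set" for S :: "vec set" where
  gvac: "vac \<in> gen_sub S"
| ggen: "s \<in> S \<Longrightarrow> s \<in> gen_sub S"
| gadd: "u \<in> gen_sub S \<Longrightarrow> v \<in> gen_sub S \<Longrightarrow> vadd u v \<in> gen_sub S"
| gscale: "u \<in> gen_sub S \<Longrightarrow> vscale a u \<in> gen_sub S"
| gmode: "u \<in> gen_sub S \<Longrightarrow> v \<in> gen_sub S \<Longrightarrow> imode u n v \<in> gen_sub S"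

definition W :: "vec set" where "W = gen_sub {ealpha}"

definition Cmt :: "vec set" where
  "Cmt = {v \<in> VA1. \<forall>u\<in>W. \<forall>n m :: int. \<forall>x\<in>VA1.
            imode u n (imode v m x) = imode v m (imode u n x)}"

inductive_set lspan :: "vec set \<Rightarrow> vec set" for S :: "vec set" where
  lzero: "vzero \<in> lspan S"
| lstep: "x \<in> S \<Longrightarrow> y \<in> lspan S \<Longrightarrow> vadd (vscale a x) y \<in> lspan S"

definition C2 :: "vec set" where
  "C2 = lspan {imode u (-2) v | u v. u \<in> Cmt \<and> v \<in> Cmt}"

definition phi :: "nat \<Rightarrow> vec" where
  "phi n = mode evarpi (- of_nat n - 3/2) (mode evarpi (- of_nat n - 1) vac)"

fun bvec :: "nat \<Rightarrow> vec" where
  "bvec 0 = vac"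
| "bvec (Suc n) = phi n"

definition lcomb :: "(nat \<Rightarrow> complex) \<Rightarrow> nat \<Rightarrow> vec" where
  "lcomb c N = (\<lambda>k. \<Sum>i<N. c i * bvec i k)"

end

theory Submission
  imports Defs "HOL-Computational_Algebra.Formal_Power_Series"
begin

text \<open>
  In each charge, the Fock space consists of polynomials in \<open>x\<^sub>l = \<alpha>(-l)\<close>. Let \<open>h\<^sub>k\<close> be the coefficients of
  \<open>h(\<omega>) = exp (\<Sum>\<^sub>n x\<^sub>n \<omega>\<^sup>n / (2n))\<close>, so that \<open>h\<^sub>0 = 1\<close>. Up to a shift of indices, \<open>e\<^sup>\<alpha>(z)\<close> is multiplication by
  \<open>h(z)\<^sup>2\<close> after the ring homomorphism \<open>h\<^sub>k \<mapsto> h\<^sub>k - z\<^bsup>-1\<^esup> h\<^bsub>k-1\<^esub>\<close>. Comparing leading terms, \<open>v\<close> of charge \<open>c\<close> is killed by all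
  \<open>e\<^sup>\<alpha>(n)\<close> with \<open>n \<ge> 0\<close> exactly if it is a polynomial of degree at most \<open>c\<close> in the \<open>h\<^sub>k\<close>; in even charge
  these are the elements of \<open>C\<close>. In charge at least 4 the (-2)-products of \<open>h\<^sub>a h\<^sub>b\<close> with lower charge
  already span: for \<open>X\<close> of charge \<open>2g\<close> they yield the relations \<open>(s - a) f\<^sub>a + (a + 1) f\<^bsub>a+1\<^esub> = 0\<close>
  modulo terms with \<open>X\<close> of lower weight, where \<open>f\<^sub>i = h\<^bsub>i-g\<^esub> h\<^bsub>s-i-g\<^esub> X\<close>, and \<open>f\<^sub>0 = 0\<close> if \<open>g > 0\<close>. For \<open>g = 0\<close>
  the same relations leave one dimension in each even weight \<open>s\<close> and none in odd weight, because \<open>f\<^sub>i = f\<^bsub>s-i\<^esub>\<close>.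
  This dimension is detected by \<open>\<Sum>\<^sub>i (-1)\<^sup>i (s choose i) \<alpha>(i) \<alpha>(s - i)\<close> and spanned by \<open>\<phi>\<^sub>n\<close> with \<open>s = 2n\<close>.
  Products and brackets of elements of positive charge have charge at least 4, so they vanish.
\<close>

section \<open>Power series in the creation operators\<close>

text \<open>Multiplying e^varpi by \<open>h 1 k\<close> gives its \<open>k\<close>-th divided
  derivative. A product of \<open>n\<close> such factors in charge \<open>n\<close> is therefore
  built from \<open>n\<close> copies of e^varpi, and its vertex operator can be peeled off one
  factor at a time (\<open>vop_h\<close>). Peeling lowers the charge by one, so intermediate vectors
  may have odd charge and leave V_{A_1}; this is why \<open>vop\<close> accepts arbitrary complex
  charges. Commutation and associativity with e^alpha then come from explicit two-term formulas by
  induction on the number of factors, not from a general Borcherds identity. The role of the degree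
  bound: e^alpha(z) on charge \<open>c\<close> carries a factor z^c, which absorbs the at most
  \<open>c\<close> factors z^-1 that the substitution \<open>h_k -> h_k - z^-1 h_{k-1}\<close>
  produces in degree \<open>c\<close>. The obstacle is that the given modes are infinite sums over
  mode lists and pairs of partitions. Exponentials are therefore characterised by first-order
  recursions, and infinite sums are compared with finite ones up to a given weight.\<close>

text \<open>
  The multiset exponent \<open>m\<close> stands for \<open>\<Prod>\<^sub>l x\<^sub>l\<close> over \<open>l
  \<in># m\<close>, where \<open>x\<^sub>l\<close> is the action of \<open>\<alpha>(-l)\<close>. The variable
  \<open>x\<^sub>0\<close> has no meaning and is excluded by side conditions \<open>0 \<notin># m\<close>.
\<close>
typedef mser = "UNIV :: (nat multiset \<Rightarrow> complex) set" morphisms cf Mser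
  by auto

lemma cf_Mser [simp]: "cf (Mser f) = f"
  by (simp add: Mser_inverse)

lemma mser_eqI: "(\<And>m. cf f m = cf g m) \<Longrightarrow> f = g"
  by (metis cf_inject ext)

lemma finite_submsets [simp]: "finite {p. p \<subseteq># m}"
proof (rule finite_subset)
  show "{p. p \<subseteq># m} \<subseteq> (\<lambda>xs. mset xs) ` {xs. set xs \<subseteq> set_mset m \<and> length xs \<le> size m}"
  proof
    fix p assume "p \<in> {p. p \<subseteq># m}"
    moreover obtain xs where "mset xs = p"
      using ex_mset by blast
    ultimately show "p \<in> (\<lambda>xs. mset xs) ` {xs. set xs \<subseteq> set_mset m \<and> length xs \<le> size m}"
      by (intro image_eqI[of _ _ xs]) (auto dest: size_mset_mono mset_subset_eqD)
  qed
qed (simp add: finite_lists_length_le)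

instantiation mser :: comm_ring_1
begin
definition zero_mser where "0 = Mser (\<lambda>_. 0)"
definition one_mser where "1 = Mser (\<lambda>m. if m = {#} then 1 else 0)"
definition plus_mser where "f + g = Mser (\<lambda>m. cf f m + cf g m)"
definition minus_mser where "f - g = Mser (\<lambda>m. cf f m - cf g m)"
definition uminus_mser where "- f = Mser (\<lambda>m. - cf f m)"
definition times_mser where "f * g = Mser (\<lambda>m. \<Sum>p\<in>{p. p \<subseteq># m}. cf f p * cf g (m - p))"
instance
proof
  fix f g k :: mser
  show comm: "f * g = g * f"
  proof (rule mser_eqI)
    fix m
    have "(\<Sum>p\<in>{p. p \<subseteq># m}. cf f p * cf g (m - p)) = (\<Sum>p\<in>{p. p \<subseteq># m}. cf g p * cf f (m - p))"
      by (rule sum.reindex_bij_witness[of _ "\<lambda>p. m - p" "\<lambda>p. m - p"])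
        (auto simp: subset_mset.diff_diff_right)
    thus "cf (f * g) m = cf (g * f) m"
      by (simp add: times_mser_def)
  qed
  show "f * g * k = f * (g * k)"
  proof (rule mser_eqI)
    fix m
    have "(\<Sum>p\<in>{p. p \<subseteq># m}. (\<Sum>q\<in>{q. q \<subseteq># p}. cf f q * cf g (p - q)) * cf k (m - p))
        = (\<Sum>(p,q)\<in>(SIGMA p:{p. p \<subseteq># m}. {q. q \<subseteq># p}). cf f q * cf g (p - q) * cf k (m - p))"
      by (simp add: sum.Sigma sum_distrib_right)
    also have "\<dots> = (\<Sum>(q,r)\<in>(SIGMA q:{q. q \<subseteq># m}. {r. r \<subseteq># m - q}). cf f q * (cf g r * cf k (m - q - r)))"
    proof (rule sum.reindex_bij_witness[of _ "\<lambda>(q,r). (q + r, q)" "\<lambda>(p,q). (q, p - q)"])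
      fix a assume "a \<in> (SIGMA p:{p. p \<subseteq># m}. {q. q \<subseteq># p})"
      then show "(case case a of (p, q) \<Rightarrow> (q, p - q) of (q, r) \<Rightarrow> (q + r, q)) = a"
        and "(case a of (p, q) \<Rightarrow> (q, p - q)) \<in> (SIGMA q:{q. q \<subseteq># m}. {r. r \<subseteq># m - q})"
        and "(case case a of (p, q) \<Rightarrow> (q, p - q) of (q, r) \<Rightarrow> cf f q * (cf g r * cf k (m - q - r))) =
           (case a of (p, q) \<Rightarrow> cf f q * cf g (p - q) * cf k (m - p))"
        by (auto simp: subset_mset.add_diff_inverse mult.assoc intro: subset_mset.order_trans
            dest: subset_mset.diff_add_assoc2 simp flip: diff_diff_add_mset)
          (auto simp: subseteq_mset_def diff_le_mono)
    next
      fix b assume "b \<in> (SIGMA q:{q. q \<subseteq># m}. {r. r \<subseteq># m - q})"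
      then show "(case case b of (q, r) \<Rightarrow> (q + r, q) of (p, q) \<Rightarrow> (q, p - q)) = b"
        and "(case b of (q, r) \<Rightarrow> (q + r, q)) \<in> (SIGMA p:{p. p \<subseteq># m}. {q. q \<subseteq># p})"
        by (auto simp: subset_mset.le_diff_conv2 add.commute)
    qed
    also have "\<dots> = (\<Sum>q\<in>{q. q \<subseteq># m}. cf f q * (\<Sum>r\<in>{r. r \<subseteq># m - q}. cf g r * cf k (m - q - r)))"
      by (simp add: sum.Sigma sum_distrib_left)
    finally show "cf (f * g * k) m = cf (f * (g * k)) m"
      by (simp add: times_mser_def)
  qed
  have "(\<Sum>p\<in>{p. p \<subseteq># m}. (if p = {#} then 1 else 0) * cf f (m - p)) = cf f m" for m
    by (subst sum.mono_neutral_right[of _ "{{#}}"]) auto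
  then show "1 * f = f"
    by (intro mser_eqI) (simp add: times_mser_def one_mser_def)
  show "(f + g) * k = f * k + g * k"
    by (intro mser_eqI) (simp add: times_mser_def plus_mser_def distrib_right sum.distrib)
  show "0 \<noteq> (1::mser)"
  proof
    assume "0 = (1::mser)"
    then have "cf 0 {#} = cf 1 {#}" by simp
    then show False by (simp add: zero_mser_def one_mser_def)
  qed
qed (auto simp: zero_mser_def plus_mser_def minus_mser_def uminus_mser_def cf_inverse intro!: mser_eqI)
end

lemma cf_ring [simp]:
  "cf 0 m = 0" "cf (f + g) m = cf f m + cf g m" "cf (f - g) m = cf f m - cf g m" "cf (- f) m = - cf f m"
  by (simp_all add: zero_mser_def plus_mser_def minus_mser_def uminus_mser_def)

lemma cf_one: "cf 1 m = (if m = {#} then 1 else 0)"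
  by (simp add: one_mser_def)

lemma cf_times: "cf (f * g) m = (\<Sum>p\<in>{p. p \<subseteq># m}. cf f p * cf g (m - p))"
  by (simp add: times_mser_def)

lemma cf_sum [simp]: "cf (sum f I) m = (\<Sum>x\<in>I. cf (f x) m)"
  by (induction I rule: infinite_finite_induct) auto

definition xmon :: "nat multiset \<Rightarrow> mser" where
  "xmon q = Mser (\<lambda>m. if m = q then 1 else 0)"

lemma cf_xmon: "cf (xmon q) m = (if m = q then 1 else 0)"
  by (simp add: xmon_def)

lemma xmon_empty [simp]: "xmon {#} = 1"
  by (intro mser_eqI) (simp add: xmon_def cf_one)

lemma cf_xmon_times: "cf (xmon q * f) m = (if q \<subseteq># m then cf f (m - q) else 0)"
proof (cases "q \<subseteq># m")
  case True
  then show ?thesis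
    by (simp add: cf_times cf_xmon, subst sum.mono_neutral_right[of _ "{q}"]) auto
next
  case False
  then show ?thesis
    by (auto simp: cf_times cf_xmon intro!: sum.neutral)
qed

lemma xmon_add: "xmon (p + q) = xmon p * xmon q"
  by (intro mser_eqI) (auto simp: cf_xmon_times cf_xmon)

definition cst :: "complex \<Rightarrow> mser" where
  "cst z = Mser (\<lambda>m. if m = {#} then z else 0)"

lemma cf_cst_times [simp]: "cf (cst z * f) m = z * cf f m"
  by (simp add: cf_times cst_def, subst sum.mono_neutral_right[of _ "{{#}}"]) auto

lemma cf_cst: "cf (cst z) m = (if m = {#} then z else 0)"
  by (simp add: cst_def)

lemma cst_simps: "cst 0 = 0" "cst 1 = 1" "cst (a + b) = cst a + cst b" "cst (a - b) = cst a - cst b"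
  "cst (- a) = - cst a" "cst (a * b) = cst a * cst b"
  by (auto intro!: mser_eqI simp: cf_cst cf_one)

lemma cst_0 [simp]: "cst 0 = 0" and cst_1 [simp]: "cst 1 = 1"
  by (simp_all add: cst_simps)

lemma cst_sum: "cst (sum f I) = (\<Sum>x\<in>I. cst (f x))"
  by (induction I rule: infinite_finite_induct) (auto simp: cst_simps)

lemma cst_cancel: "z \<noteq> 0 \<Longrightarrow> cst z * f = cst z * g \<Longrightarrow> f = g"
  by (metis cf_cst_times mser_eqI mult_left_cancel)

lemma cst_cst: "cst a * (cst b * f) = cst (a * b) * f"
  by (simp add: cst_simps mult.assoc)

section \<open>Annihilation operators and the coefficients of exponential series\<close>

definition wt :: "nat multiset \<Rightarrow> int" where "wt m = (\<Sum>n\<in>#m. int n)"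

lemma wt_simps [simp]: "wt {#} = 0" "wt (add_mset n m) = int n + wt m" "wt (p + q) = wt p + wt q"
  by (simp_all add: wt_def)

lemma wt_nonneg [simp]: "0 \<le> wt m"
  by (induction m) auto

lemma wt_not_neg [simp]: "wt m < 0 \<longleftrightarrow> False"
  by (simp add: not_less)

lemma wt_sum_mset: "wt m = int (\<Sum>\<^sub># m)"
  by (induction m) auto

lemma ecoef_superset:
  assumes "finite I" "set_mset p \<subseteq> I"
  shows "ecoef x p = (\<Prod>n\<in>I. (x / of_nat n) ^ count p n / of_nat (fact (count p n)))"
  unfolding ecoef_def
  by (rule prod.mono_neutral_left) (use assms in \<open>auto simp: not_in_iff\<close>)

lemma ecoef_empty [simp]: "ecoef x {#} = 1"
  by (simp add: ecoef_def)

text \<open>Coefficientwise form of the differential equation n dE/dx_n = x E for the exponential E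
  whose coefficients are \<open>ecoef x\<close>.\<close>

lemma ecoef_add_mset:
  assumes "n \<noteq> 0"
  shows "of_nat (n * (count p n + 1)) * ecoef x (add_mset n p) = x * ecoef x p"
proof -
  let ?I = "set_mset p - {n}"
  define F where "F q k = (x / of_nat k) ^ count q k / of_nat (fact (count q k))" for q k
  have *: "ecoef x q = F q n * (\<Prod>k\<in>?I. F q k)" if "set_mset q \<subseteq> insert n (set_mset p)" for q
    unfolding F_def using that
    by (subst ecoef_superset[of "insert n (set_mset p)"]) (auto simp: prod.insert_remove)
  have "(\<Prod>k\<in>?I. F (add_mset n p) k) = (\<Prod>k\<in>?I. F p k)"
    by (rule prod.cong) (auto simp: F_def)
  moreover have "of_nat (n * (count p n + 1)) * F (add_mset n p) n = x * F p n"
    using assms by (simp add: F_def field_simps del: of_nat_mult of_nat_add of_nat_Suc)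
      (simp add: algebra_simps)
  ultimately show ?thesis
    by (subst (1 2) *) (auto simp: mult.assoc[symmetric])
qed

lemma ecoef_remove:
  assumes "0 \<notin># m" "n \<in># m"
  shows "x * ecoef x (m - {#n#}) = of_nat (n * count m n) * ecoef x m"
proof -
  from assms have "n \<noteq> 0" by metis
  then show ?thesis
    using ecoef_add_mset[of n "m - {#n#}" x] assms by simp
qed

text \<open>
  This is \<open>\<alpha>(j) = 2 j \<partial>/\<partial>x\<^sub>j\<close> for \<open>j > 0\<close>.
\<close>
definition alpha :: "nat \<Rightarrow> mser \<Rightarrow> mser" where
  "alpha j f = Mser (\<lambda>m. of_nat (2 * j * (count m j + 1)) * cf f (add_mset j m))"

lemma cf_alpha: "cf (alpha j f) m = of_nat (2 * j * (count m j + 1)) * cf f (add_mset j m)"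
  by (simp add: alpha_def)

lemma alpha_add [simp]: "alpha j (f + g) = alpha j f + alpha j g"
  and alpha_cst [simp]: "alpha j (cst z * f) = cst z * alpha j f"
  and alpha_zero [simp]: "alpha j 0 = 0"
  and alpha_const [simp]: "alpha j (cst z) = 0"
  by (auto intro!: mser_eqI simp: cf_alpha cf_cst distrib_left mult.left_commute)

lemma alpha_sum [simp]: "alpha j (sum f I) = (\<Sum>x\<in>I. alpha j (f x))"
  by (induction I rule: infinite_finite_induct) auto

lemma alpha_commute: "alpha i (alpha j f) = alpha j (alpha i f)"
  by (intro mser_eqI) (auto simp: cf_alpha add_mset_commute)

text \<open>Leibniz rule: the multiplicity of \<open>j\<close> in \<open>add_mset j m\<close> splits
  between a submultiset \<open>p\<close> and its complement, and the two shares give the two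
  summands.\<close>

lemma alpha_mult: "alpha j (f * g) = alpha j f * g + f * alpha j g"
proof -
  define c where "c p = (of_nat (count p j) :: complex)" for p
  have half: "(\<Sum>p\<in>{p. p \<subseteq># add_mset j m}. c p * (cf f p * cf g (add_mset j m - p)))
     = (\<Sum>p\<in>{p. p \<subseteq># m}. of_nat (count p j + 1) * cf f (add_mset j p) * cf g (m - p))" for f g m
  proof -
    have "(\<Sum>p\<in>{p. p \<subseteq># add_mset j m}. c p * (cf f p * cf g (add_mset j m - p)))
        = (\<Sum>p\<in>add_mset j ` {p. p \<subseteq># m}. c p * (cf f p * cf g (add_mset j m - p)))"
    proof (rule sum.mono_neutral_right, goal_cases)
      case 3
      show ?case
      proof
        fix p assume p: "p \<in> {p. p \<subseteq># add_mset j m} - add_mset j ` {p. p \<subseteq># m}"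
        have "j \<notin># p"
        proof
          assume "j \<in># p"
          then have "p = add_mset j (p - {#j#})" by simp
          with p show False by (metis Diff_iff image_eqI mem_Collect_eq mset_subset_eq_add_mset_cancel)
        qed
        then show "c p * (cf f p * cf g (add_mset j m - p)) = 0"
          by (simp add: c_def not_in_iff)
      qed
    qed auto
    also have "\<dots> = (\<Sum>p\<in>{p. p \<subseteq># m}. of_nat (count p j + 1) * cf f (add_mset j p) * cf g (m - p))"
      by (subst sum.reindex) (auto simp: inj_on_def c_def mult.assoc)
    finally show ?thesis .
  qed
  show ?thesis
  proof (rule mser_eqI)
    fix m
    let ?S = "{p. p \<subseteq># add_mset j m}"
    have cnt: "of_nat (count m j + 1) = c p + c (add_mset j m - p)" if "p \<in> ?S" for p
      using that mset_subset_eq_count[of p "add_mset j m" j]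
      by (simp add: c_def flip: of_nat_add)
    have flip: "(\<Sum>p\<in>?S. c (add_mset j m - p) * (cf f p * cf g (add_mset j m - p)))
       = (\<Sum>p\<in>?S. c p * (cf g p * cf f (add_mset j m - p)))"
      by (rule sum.reindex_bij_witness[of _ "\<lambda>p. add_mset j m - p" "\<lambda>p. add_mset j m - p"])
        (auto simp: subset_mset.diff_diff_right)
    have "of_nat (count m j + 1) * cf (f * g) (add_mset j m)
       = (\<Sum>p\<in>?S. (c p + c (add_mset j m - p)) * (cf f p * cf g (add_mset j m - p)))"
      unfolding cf_times sum_distrib_left by (rule sum.cong) (simp_all only: cnt)
    also have "\<dots> = (\<Sum>p\<in>{p. p \<subseteq># m}. of_nat (count p j + 1) * cf f (add_mset j p) * cf g (m - p))
        + (\<Sum>p\<in>{p. p \<subseteq># m}. of_nat (count p j + 1) * cf g (add_mset j p) * cf f (m - p))"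
      by (simp add: distrib_right sum.distrib half flip)
    finally have 1: "of_nat (count m j + 1) * cf (f * g) (add_mset j m) = \<dots>" .
    have 2: "of_nat (2 * j) * (\<Sum>p\<in>{p. p \<subseteq># m}. of_nat (count p j + 1) * cf f (add_mset j p) * cf g (m - p))
       = cf (alpha j f * g) m" for f g
      by (simp only: cf_times cf_alpha sum_distrib_left of_nat_mult mult.assoc)
    have "cf (alpha j (f * g)) m = of_nat (2 * j) * (of_nat (count m j + 1) * cf (f * g) (add_mset j m))"
      by (simp only: cf_alpha of_nat_mult mult.assoc)
    also have "\<dots> = cf (alpha j f * g) m + cf (alpha j g * f) m"
      by (simp only: 1 distrib_left 2)
    finally show "cf (alpha j (f * g)) m = cf (alpha j f * g + f * alpha j g) m"
      by (simp only: cf_ring mult.commute[of f "alpha j g"])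
  qed
qed

text \<open>
  The coefficient of \<open>\<omega>\<^sup>k\<close> in \<open>exp (a/2 \<Sum>\<^sub>n x\<^sub>n
  \<omega>\<^sup>n / n)\<close>. The \<open>h\<^sub>k\<close> above are \<open>h 1 k\<close>.
\<close>
definition h :: "complex \<Rightarrow> int \<Rightarrow> mser" where
  "h a k = Mser (\<lambda>m. if 0 \<notin># m \<and> wt m = k then ecoef (a / 2) m else 0)"

lemma cf_h: "cf (h a k) m = (if 0 \<notin># m \<and> wt m = k then ecoef (a / 2) m else 0)"
  by (simp add: h_def)

lemma pos_wt_0: "0 \<notin># m \<Longrightarrow> wt m = 0 \<Longrightarrow> m = {#}"
  by (metis multiset_nonemptyE sum_mset_0_iff wt_sum_mset of_nat_eq_0_iff)

lemma h_neg [simp]: "k < 0 \<Longrightarrow> h a k = 0"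
  by (intro mser_eqI) (auto simp: cf_h)

lemma h_0 [simp]: "h a 0 = 1"
  by (intro mser_eqI) (auto simp: cf_h cf_one dest: pos_wt_0)

lemma alpha_h:
  assumes "j \<noteq> 0"
  shows "alpha j (h a k) = cst a * h a (k - int j)"
proof (rule mser_eqI)
  fix m
  show "cf (alpha j (h a k)) m = cf (cst a * h a (k - int j)) m"
  proof (cases "0 \<notin># m \<and> wt m = k - int j")
    case True
    have "of_nat (2 * j * (count m j + 1)) * ecoef (a / 2) (add_mset j m)
        = 2 * (of_nat (j * (count m j + 1)) * ecoef (a / 2) (add_mset j m))"
      by (simp add: algebra_simps)
    also have "\<dots> = a * ecoef (a / 2) m"
      unfolding ecoef_add_mset[OF assms] by simp
    finally show ?thesis using True assms by (auto simp: cf_alpha cf_h)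
  next
    case False
    then show ?thesis using assms by (auto simp: cf_alpha cf_h)
  qed
qed

section \<open>Homogeneous series\<close>

definition hom :: "int \<Rightarrow> mser \<Rightarrow> bool" where
  "hom d f \<longleftrightarrow> (\<forall>m. cf f m \<noteq> 0 \<longrightarrow> 0 \<notin># m \<and> wt m = d)"

lemma hom_0 [simp, intro]: "hom d 0"
  and hom_add [intro]: "hom d f \<Longrightarrow> hom d g \<Longrightarrow> hom d (f + g)"
  and hom_cst [intro]: "hom d f \<Longrightarrow> hom d (cst z * f)"
  and hom_const [intro]: "hom 0 (cst z)"
proof -
  show "hom d f \<Longrightarrow> hom d g \<Longrightarrow> hom d (f + g)"
    unfolding hom_def cf_ring by (metis add_0)
qed (auto simp: hom_def cf_cst)

lemma hom_h [intro]: "hom k (h a k)"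
  by (auto simp: hom_def cf_h split: if_splits)

lemma hom_1 [intro]: "hom 0 1"
  using hom_const[of 1] by simp

lemma hom_sum [intro]: "(\<And>x. x \<in> I \<Longrightarrow> hom d (f x)) \<Longrightarrow> hom d (sum f I)"
  by (induction I rule: infinite_finite_induct) auto

lemma hom_neg: "hom d f \<Longrightarrow> d < 0 \<Longrightarrow> f = 0"
  by (intro mser_eqI) (metis cf_ring(1) hom_def wt_not_neg)

lemma hom_mult [intro]:
  assumes "hom d f" "hom e g"
  shows "hom (d + e) (f * g)"
  unfolding hom_def
proof (intro allI impI)
  fix m assume "cf (f * g) m \<noteq> 0"
  then obtain p where p: "p \<subseteq># m" "cf f p \<noteq> 0" "cf g (m - p) \<noteq> 0"
    by (auto simp: cf_times elim: sum.not_neutral_contains_not_neutral)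
  then obtain q where q: "m = p + q" by (auto simp: mset_subset_eq_exists_conv)
  show "0 \<notin># m \<and> wt m = d + e"
    using p assms by (auto simp: q hom_def)
qed

lemma hom_alpha [intro]: "hom d f \<Longrightarrow> hom (d - int j) (alpha j f)"
  by (fastforce simp: hom_def cf_alpha)

lemma hom_xmon: "0 \<notin># m \<Longrightarrow> hom (wt m) (xmon m)"
  by (simp add: hom_def cf_xmon)

lemma sum_triangle:
  fixes G :: "nat \<Rightarrow> nat \<Rightarrow> nat \<Rightarrow> 'a::comm_monoid_add"
  shows "(\<Sum>p\<le>m. \<Sum>n\<in>{1..p}. G n (p - n) (m - p)) = (\<Sum>n\<in>{1..m}. \<Sum>q\<le>m - n. G n q (m - n - q))"
proof -
  have "(\<Sum>p\<le>m. \<Sum>n\<in>{1..p}. G n (p - n) (m - p))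
      = (\<Sum>(p,n)\<in>(SIGMA p:{..m}. {1..p}). G n (p - n) (m - p))"
    by (simp add: sum.Sigma)
  also have "\<dots> = (\<Sum>(n,q)\<in>(SIGMA n:{1..m}. {..m - n}). G n q (m - n - q))"
    by (rule sum.reindex_bij_witness[of _ "\<lambda>(n,q). (n + q, n)" "\<lambda>(p,n). (n, p - n)"]) auto
  also have "\<dots> = (\<Sum>n\<in>{1..m}. \<Sum>q\<le>m - n. G n q (m - n - q))"
    by (simp add: sum.Sigma)
  finally show ?thesis .
qed

lemma sum_antidiagonal_flip:
  fixes G :: "nat \<Rightarrow> nat \<Rightarrow> 'a::comm_monoid_add"
  shows "(\<Sum>q\<le>m. G q (m - q)) = (\<Sum>q\<le>m. G (m - q) q)"
  by (rule sum.reindex_bij_witness[of _ "\<lambda>q. m - q" "\<lambda>q. m - q"]) auto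

text \<open>
  The coefficients of \<open>exp (- a/2 \<Sum>\<^sub>n \<alpha>(n) z\<^bsup>-n\<^esup> / n)\<close>, defined
  by the recursion that its logarithmic derivative gives.
\<close>
fun Ep :: "complex \<Rightarrow> nat \<Rightarrow> mser \<Rightarrow> mser" where
  "Ep a p f = (if p = 0 then f else cst (- a / (2 * of_nat p)) * (\<Sum>n\<in>{1..p}. alpha n (Ep a (p - n) f)))"

declare Ep.simps [simp del]

lemma Ep_0 [simp]: "Ep a 0 f = f"
  by (simp add: Ep.simps)

lemma Ep_rec: "cst (of_nat p) * Ep a p f = cst (- a / 2) * (\<Sum>n\<in>{1..p}. alpha n (Ep a (p - n) f))"
  by (subst Ep.simps) (auto simp: cst_cst)

text \<open>Stands in for calculations with exponentials: the recursion and the value at 0 determine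
  the family, because \<open>p\<close> can be divided out when it is nonzero. Identities for
  \<open>Ep\<close> reduce to checking that both sides obey the recursion.\<close>

lemma Ep_unique:
  assumes rec: "\<And>p. cst (of_nat p) * T p = cst (- a / 2) * (\<Sum>n\<in>{1..p}. alpha n (T (p - n)))"
  shows "T p = Ep a p (T 0)"
proof (induction p rule: less_induct)
  case (less p)
  show ?case
  proof (cases "p = 0")
    case False
    have "(\<Sum>n\<in>{1..p}. alpha n (T (p - n))) = (\<Sum>n\<in>{1..p}. alpha n (Ep a (p - n) (T 0)))"
      by (intro sum.cong refl arg_cong[of _ _ "alpha _"] less.IH) auto
    then have "cst (of_nat p) * T p = cst (of_nat p) * Ep a p (T 0)"
      by (simp only: rec[of p] Ep_rec[of p a "T 0"])
    then show ?thesis using cst_cancel False by (metis of_nat_eq_0_iff)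
  qed simp
qed

lemma Ep_add_right [simp]: "Ep a p (f + g) = Ep a p f + Ep a p g"
  using Ep_unique[of "\<lambda>p. Ep a p f + Ep a p g" a p]
  by (simp add: distrib_left Ep_rec sum.distrib)

lemma Ep_cst [simp]: "Ep a p (cst z * f) = cst z * Ep a p f"
proof -
  have "cst (of_nat p) * (cst z * Ep a p f) = cst z * (cst (of_nat p) * Ep a p f)" for p
    by (simp add: ac_simps)
  then show ?thesis
    using Ep_unique[of "\<lambda>p. cst z * Ep a p f" a p]
    by (simp add: Ep_rec sum_distrib_left mult.left_commute)
qed

lemma Ep_zero [simp]: "Ep a p 0 = 0"
  using Ep_cst[of a p 0 0] by simp

lemma Ep_sum [simp]: "Ep a p (sum f I) = (\<Sum>x\<in>I. Ep a p (f x))"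
  by (induction I rule: infinite_finite_induct) auto

lemma Ep_alpha: "Ep a p (alpha j f) = alpha j (Ep a p f)"
proof -
  have rec: "cst (of_nat p) * alpha j (Ep a p f) = cst (- a / 2) * (\<Sum>n\<in>{1..p}. alpha n (alpha j (Ep a (p - n) f)))" for p
  proof -
    have "cst (of_nat p) * alpha j (Ep a p f) = alpha j (cst (of_nat p) * Ep a p f)"
      by (simp only: alpha_cst)
    then show ?thesis
      by (simp only: Ep_rec alpha_cst alpha_sum alpha_commute[of j])
  qed
  show ?thesis
    using Ep_unique[of "\<lambda>p. alpha j (Ep a p f)" a p, OF rec] by simp
qed

lemma Ep_commute: "Ep a p (Ep b q f) = Ep b q (Ep a p f)"
proof -
  have rec: "cst (of_nat p) * Ep b q (Ep a p f) = cst (- a / 2) * (\<Sum>n\<in>{1..p}. alpha n (Ep b q (Ep a (p - n) f)))" for p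
  proof -
    have "cst (of_nat p) * Ep b q (Ep a p f) = Ep b q (cst (of_nat p) * Ep a p f)"
      by (simp only: Ep_cst)
    then show ?thesis
      by (simp only: Ep_rec Ep_cst Ep_sum Ep_alpha)
  qed
  show ?thesis
    using Ep_unique[of "\<lambda>p. Ep b q (Ep a p f)" a p, OF rec] by simp
qed

lemma hom_Ep [intro]: "hom d f \<Longrightarrow> hom (d - int p) (Ep a p f)"
proof (induction p rule: less_induct)
  case (less p)
  show ?case
  proof (cases "p = 0")
    case False
    have "hom (d - int p) (alpha n (Ep a (p - n) f))" if "n \<in> {1..p}" for n
      using hom_alpha[OF less.IH[of "p - n"], of n] less.prems that by (simp add: of_nat_diff)
    then have "hom (d - int p) (cst (- a / (2 * of_nat p)) * (\<Sum>n\<in>{1..p}. alpha n (Ep a (p - n) f)))"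
      by (intro hom_cst hom_sum)
    then show ?thesis
      using False by (subst Ep.simps) (simp only: if_False)
  qed (use less in simp)
qed

lemma Ep_high: "hom d f \<Longrightarrow> d < int p \<Longrightarrow> Ep a p f = 0"
  using hom_neg[OF hom_Ep[of d f p a]] by simp

lemma Ep_const: "Ep a p (cst z) = (if p = 0 then cst z else 0)"
  using Ep_high[OF hom_const, of p a z] by simp

text \<open>The law exp(A + B) = exp(A) exp(B) for commuting operators. In the recursion the factor
  \<open>m\<close> splits as \<open>p + (m - p)\<close>, one share for each exponential.\<close>

lemma Ep_plus: "Ep (a + b) m f = (\<Sum>p\<le>m. Ep a p (Ep b (m - p) f))"
proof -
  define T where "T m = (\<Sum>p\<le>m. Ep a p (Ep b (m - p) f))" for m
  have "cst (of_nat m) * T m = cst (- (a + b) / 2) * (\<Sum>n\<in>{1..m}. alpha n (T (m - n)))" for m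
  proof -
    have "cst (of_nat m) * T m = (\<Sum>p\<le>m. cst (of_nat p) * Ep a p (Ep b (m - p) f))
         + (\<Sum>p\<le>m. cst (of_nat (m - p)) * Ep a p (Ep b (m - p) f))"
      unfolding T_def sum_distrib_left sum.distrib[symmetric]
      by (rule sum.cong) (auto simp: of_nat_diff cst_simps algebra_simps)
    also have "(\<Sum>p\<le>m. cst (of_nat p) * Ep a p (Ep b (m - p) f))
       = cst (- a / 2) * (\<Sum>p\<le>m. \<Sum>n\<in>{1..p}. alpha n (Ep a (p - n) (Ep b (m - p) f)))"
      by (simp add: Ep_rec sum_distrib_left)
    also have "\<dots> = cst (- a / 2) * (\<Sum>n\<in>{1..m}. alpha n (T (m - n)))"
      by (subst sum_triangle[of "\<lambda>n q r. alpha n (Ep a q (Ep b r f))" m]) (simp add: T_def)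
    also have "(\<Sum>p\<le>m. cst (of_nat (m - p)) * Ep a p (Ep b (m - p) f))
       = (\<Sum>p\<le>m. cst (of_nat p) * Ep a (m - p) (Ep b p f))"
      by (rule sum.reindex_bij_witness[of _ "\<lambda>p. m - p" "\<lambda>p. m - p"]) auto
    also have "\<dots> = (\<Sum>p\<le>m. Ep a (m - p) (cst (of_nat p) * Ep b p f))"
      by simp
    also have "\<dots> = cst (- b / 2) * (\<Sum>p\<le>m. \<Sum>n\<in>{1..p}. alpha n (Ep a (m - p) (Ep b (p - n) f)))"
      by (simp only: Ep_rec Ep_cst Ep_sum Ep_alpha sum_distrib_left)
    also have "\<dots> = cst (- b / 2) * (\<Sum>n\<in>{1..m}. \<Sum>q\<le>m-n. alpha n (Ep a (m-n-q) (Ep b q f)))"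
      by (subst sum_triangle[of "\<lambda>n q r. alpha n (Ep a r (Ep b q f))" m]) simp
    also have "(\<Sum>n\<in>{1..m}. \<Sum>q\<le>m-n. alpha n (Ep a (m-n-q) (Ep b q f))) = (\<Sum>n\<in>{1..m}. alpha n (T (m - n)))"
      unfolding T_def alpha_sum
      by (intro sum.cong refl sum_antidiagonal_flip[symmetric, where G = "\<lambda>q r. alpha _ (Ep a q (Ep b r f))"])
    finally show ?thesis
      by (simp add: cst_simps diff_divide_distrib left_diff_distrib)
  qed
  from Ep_unique[OF this, of m] show ?thesis
    by (simp add: T_def)
qed

text \<open>The coefficient of t^j in (1 - t)^s.\<close>

definition binc :: "complex \<Rightarrow> nat \<Rightarrow> complex" where
  "binc s j = (-1) ^ j * (s gchoose j)"

lemma binc_0 [simp]: "binc s 0 = 1"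
  by (simp add: binc_def)

text \<open>Says that (1 - t)^s has logarithmic derivative -s / (1 - t).\<close>

lemma binc_rec: "of_nat m * binc s m = - s * (\<Sum>n\<in>{1..m}. binc s (m - n))"
proof (cases m)
  case (Suc k)
  have "(\<Sum>n\<in>{1..m}. binc s (m - n)) = (\<Sum>j\<le>k. binc s j)"
    by (rule sum.reindex_bij_witness[of _ "\<lambda>j. m - j" "\<lambda>j. m - j"]) (auto simp: Suc)
  also have "\<dots> = (-1) ^ k * (s - 1 gchoose k)"
    using gbinomial_sum_lower_neg[of s k] by (simp add: binc_def mult.commute)
  finally show ?thesis
    using gbinomial_absorption[of k s] by (simp add: binc_def Suc del: of_nat_Suc)
qed simp

text \<open>The exponential of a derivation is multiplicative. On a family that the derivations only
  shift, it acts as (1 - T)^(a a'/2) with T the shift by one, weighted by powers of z^-1. The family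
  is left abstract so that the coefficients \<open>h\<close> and the derivatives \<open>hbin\<close>
  are both covered.\<close>

lemma Ep_mult_family:
  assumes G: "\<And>n j. n \<noteq> 0 \<Longrightarrow> alpha n (G j) = cst a' * G (j + n)"
  shows "Ep a p (G 0 * f) = (\<Sum>j\<le>p. cst (binc (a * a' / 2) j) * (G j * Ep a (p - j) f))"
proof -
  obtain e where e: "a = 2 * e"
    by (metis mult.commute nonzero_mult_div_cancel_left times_divide_eq_left zero_neq_numeral)
  define s where "s = e * a'"
  define T where "T p = (\<Sum>j\<le>p. cst (binc s j) * (G j * Ep a (p - j) f))" for p
  have "cst (of_nat m) * T m = cst (- a / 2) * (\<Sum>n\<in>{1..m}. alpha n (T (m - n)))" for m
  proof -
    let ?B = "\<Sum>j\<le>m. cst (binc s j) * (G j * (cst (of_nat (m - j)) * Ep a (m - j) f))"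
    have "cst (of_nat m) * T m = (\<Sum>j\<le>m. cst (of_nat j * binc s j) * (G j * Ep a (m - j) f)) + ?B"
      unfolding T_def sum_distrib_left sum.distrib[symmetric]
      by (rule sum.cong) (auto simp: of_nat_diff cst_simps algebra_simps)
    also have "(\<Sum>j\<le>m. cst (of_nat j * binc s j) * (G j * Ep a (m - j) f))
      = cst (- s) * (\<Sum>j\<le>m. \<Sum>n\<in>{1..j}. cst (binc s (j - n)) * (G (j - n + n) * Ep a (m - j) f))"
      by (auto simp: binc_rec sum_distrib_left sum_distrib_right cst_sum cst_simps mult.assoc intro!: sum.cong)
    also have "\<dots> = cst (- s) * (\<Sum>n\<in>{1..m}. \<Sum>q\<le>m-n. cst (binc s q) * (G (q + n) * Ep a (m - n - q) f))"
      by (subst sum_triangle[of "\<lambda>n q r. cst (binc s q) * (G (q + n) * Ep a r f)"]) simp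
    also have "?B = (\<Sum>j\<le>m. cst (binc s (m - j)) * (G (m - j) * (cst (of_nat j) * Ep a j f)))"
      by (rule sum.reindex_bij_witness[of _ "\<lambda>p. m - p" "\<lambda>p. m - p"]) auto
    also have "\<dots> = cst (- a / 2) * (\<Sum>p\<le>m. \<Sum>n\<in>{1..p}. cst (binc s (m - p)) * (G (m - p) * alpha n (Ep a (p - n) f)))"
      by (simp add: Ep_rec sum_distrib_left mult.left_commute)
    also have "\<dots> = cst (- a / 2) * (\<Sum>n\<in>{1..m}. \<Sum>q\<le>m-n. cst (binc s (m-n-q)) * (G (m-n-q) * alpha n (Ep a q f)))"
      by (subst sum_triangle[of "\<lambda>n q r. cst (binc s r) * (G r * alpha n (Ep a q f))"]) simp
    also have "(\<Sum>n\<in>{1..m}. \<Sum>q\<le>m-n. cst (binc s (m-n-q)) * (G (m-n-q) * alpha n (Ep a q f)))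
       = (\<Sum>n\<in>{1..m}. \<Sum>q\<le>m-n. cst (binc s q) * (G q * alpha n (Ep a (m-n-q) f)))"
      by (intro sum.cong refl sum_antidiagonal_flip[symmetric,
            where G = "\<lambda>q r. cst (binc s q) * (G q * alpha _ (Ep a r f))"])
    finally show ?thesis
      by (auto simp: T_def alpha_mult G e s_def sum_distrib_left sum.distrib[symmetric] cst_simps distrib_left
          add.commute mult.assoc mult.left_commute intro!: sum.cong)
  qed
  from Ep_unique[OF this, of p] show ?thesis
    by (simp add: T_def s_def e)
qed

lemma Ep_h:
  "Ep a p (h a' k * f) = (\<Sum>j\<le>p. cst (binc (a * a' / 2) j) * (h a' (k - int j) * Ep a (p - j) f))"
  using Ep_mult_family[of "\<lambda>j. h a' (k - int j)" a' a p f] by (simp add: alpha_h diff_diff_eq)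

section \<open>Vertex operators at z = 1\<close>

lemma Vandermonde_shift:
  fixes x y :: complex
  assumes "k \<noteq> 0"
  shows "(\<Sum>l\<in>{1..k}. (x gchoose (l - 1)) * (y gchoose (k - l))) = (x + y) gchoose (k - 1)"
proof -
  have "(\<Sum>l\<in>{1..k}. (x gchoose (l - 1)) * (y gchoose (k - l))) = (\<Sum>i\<in>{0..k-1}. (x gchoose i) * (y gchoose (k - 1 - i)))"
    by (rule sum.reindex_bij_witness[of _ Suc "\<lambda>l. l - 1"]) (use assms in auto)
  then show ?thesis using gbinomial_Vandermonde[of x y "k - 1"] by simp
qed

text \<open>
  The \<open>k\<close>-th divided derivative of \<open>z\<^sup>e \<Sum>\<^sub>n h a n z\<^sup>n\<close> at
  \<open>z = 1\<close>.
\<close>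
definition hbin :: "complex \<Rightarrow> complex \<Rightarrow> nat \<Rightarrow> mser" where
  "hbin a e k = Mser (\<lambda>m. if 0 \<notin># m then ((e + of_int (wt m)) gchoose k) * ecoef (a / 2) m else 0)"

lemma cf_hbin: "cf (hbin a e k) m = (if 0 \<notin># m then ((e + of_int (wt m)) gchoose k) * ecoef (a / 2) m else 0)"
  by (simp add: hbin_def)

abbreviation hsum :: "complex \<Rightarrow> mser" where "hsum a \<equiv> hbin a 0 0"

lemma hbin_0: "hbin a e 0 = hsum a"
  by (intro mser_eqI) (simp add: cf_hbin)

lemma alpha_hsum: "j \<noteq> 0 \<Longrightarrow> alpha j (hsum a) = cst a * hsum a"
proof (rule mser_eqI)
  fix m assume j: "j \<noteq> 0"
  have "of_nat (2 * j * (count m j + 1)) * ecoef (a / 2) (add_mset j m)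
        = 2 * (of_nat (j * (count m j + 1)) * ecoef (a / 2) (add_mset j m))"
    by (simp add: algebra_simps)
  also have "\<dots> = a * ecoef (a / 2) m"
    unfolding ecoef_add_mset[OF j] by simp
  finally show "cf (alpha j (hsum a)) m = cf (cst a * hsum a) m"
    using j by (auto simp: cf_alpha cf_hbin)
qed

lemma cf_mult_pos:
  assumes "\<And>m. 0 \<in># m \<Longrightarrow> cf f m = 0" "\<And>m. 0 \<in># m \<Longrightarrow> cf g m = 0" "0 \<in># m"
  shows "cf (f * g) m = 0"
  unfolding cf_times
proof (intro sum.neutral ballI)
  fix p assume "p \<in> {p. p \<subseteq># m}"
  then have "m = p + (m - p)" by simp
  with assms(3) have "0 \<in># p \<or> 0 \<in># m - p" by (metis union_iff)
  with assms show "cf f p * cf g (m - p) = 0" by auto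
qed

text \<open>Both sides solve \<open>alpha j f = cst (a + b) * f\<close> for every
  \<open>j > 0\<close> and have the same constant term; the equations fix the other coefficients one
  multiset element at a time.\<close>

lemma hsum_add: "hsum (a + b) = hsum a * hsum b"
proof (rule mser_eqI)
  fix m
  let ?f = "hsum a * hsum b"
  show "cf (hsum (a + b)) m = cf ?f m"
  proof (cases "0 \<in># m")
    case True
    then show ?thesis
      by (subst cf_mult_pos) (auto simp: cf_hbin)
  next
    case False
    then show ?thesis
    proof (induction m)
      case empty
      then show ?case by (simp add: cf_hbin cf_times)
    next
      case (add j m)
      then have j: "j \<noteq> 0" by auto
      have "alpha j ?f = cst (a + b) * ?f"
        using j by (simp add: alpha_mult alpha_hsum cst_simps algebra_simps)
      then have "cf (alpha j ?f) m = cf (alpha j (hsum (a + b))) m"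
        using j add by (simp add: alpha_hsum)
      then have "of_nat (2 * j * (count m j + 1)) * cf ?f (add_mset j m)
          = of_nat (2 * j * (count m j + 1)) * cf (hsum (a + b)) (add_mset j m)"
        by (simp only: cf_alpha)
      moreover have "of_nat (2 * j * (count m j + 1)) \<noteq> (0 :: complex)"
        using j by (simp only: of_nat_eq_0_iff) simp
      ultimately show ?case by (metis mult_left_cancel)
    qed
  qed
qed

text \<open>
  The two halves \<open>amin\<close> (creation) and \<open>aplus\<close> (annihilation) of the
  \<open>(l-1)\<close>-st divided derivative of \<open>\<alpha>(z)\<close> at \<open>z = 1\<close>. Fields may
  be evaluated at \<open>z = 1\<close> because the weight of a term recovers its power of \<open>z\<close>.
  The number \<open>D\<close> truncates sums of annihilation operators; it is harmless once it bounds the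
  weights of the arguments.
\<close>
definition amin :: "nat \<Rightarrow> mser" where
  "amin l = Mser (\<lambda>m. if 0 \<notin># m \<and> size m = 1 then (of_int (wt m) - 1) gchoose (l - 1) else 0)"

lemma cf_amin_times:
  "cf (amin l * F) m = (\<Sum>j\<in>set_mset m - {0}. ((of_nat j - 1) gchoose (l - 1)) * cf F (m - {#j#}))"
proof -
  let ?S = "(\<lambda>j. {#j#}) ` (set_mset m - {0})"
  have "cf (amin l * F) m = (\<Sum>p\<in>?S. cf (amin l) p * cf F (m - p))"
    unfolding cf_times
  proof (rule sum.mono_neutral_right)
    show "\<forall>i\<in>{p. p \<subseteq># m} - ?S. cf (amin l) i * cf F (m - i) = 0"
    proof
      fix i assume i: "i \<in> {p. p \<subseteq># m} - ?S"
      have "\<not> (0 \<notin># i \<and> size i = 1)"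
      proof
        assume *: "0 \<notin># i \<and> size i = 1"
        then obtain j where "i = {#j#}" using size_1_singleton_mset by blast
        with i * show False by auto
      qed
      then show "cf (amin l) i * cf F (m - i) = 0" by (simp only: amin_def cf_Mser if_False mult_zero_left)
    qed
  qed auto
  also have "\<dots> = (\<Sum>j\<in>set_mset m - {0}. ((of_nat j - 1) gchoose (l - 1)) * cf F (m - {#j#}))"
    by (subst sum.reindex) (auto simp: inj_on_def amin_def intro!: sum.cong)
  finally show ?thesis .
qed

lemma wt_eq_sum: "wt m = (\<Sum>j\<in>set_mset m. int (j * count m j))"
proof (induction m)
  case (add x m)
  have *: "(\<Sum>j\<in>insert x (set_mset m). int (j * count m j)) = (\<Sum>j\<in>set_mset m. int (j * count m j))"
    by (rule sum.mono_neutral_right) (auto simp: not_in_iff)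
  have "(\<Sum>j\<in>set_mset (add_mset x m). int (j * count (add_mset x m) j))
     = (\<Sum>j\<in>insert x (set_mset m). int (j * count m j) + (if j = x then int x else 0))"
    by (rule sum.cong) (auto simp: algebra_simps)
  also have "\<dots> = wt m + int x"
    by (simp only: sum.distrib * add.IH[symmetric]) simp
  finally show ?case by simp
qed simp

text \<open>Grading operator on the exponential: multiplying each coefficient by its weight amounts
  to multiplying the series by the sum of all x * x_j. This is the coefficient of that identity at
  \<open>m\<close>.\<close>

lemma ecoef_degree:
  assumes "0 \<notin># m"
  shows "(\<Sum>j\<in>set_mset m. x * ecoef x (m - {#j#})) = of_int (wt m) * ecoef x m"
proof -
  have "(\<Sum>j\<in>set_mset m. x * ecoef x (m - {#j#})) = (\<Sum>j\<in>set_mset m. of_nat (j * count m j) * ecoef x m)"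
    by (intro sum.cong refl ecoef_remove assms)
  also have "\<dots> = of_int (wt m) * ecoef x m"
    by (simp add: wt_eq_sum sum_distrib_right)
  finally show ?thesis .
qed

lemma pos_diff: "0 \<in># m \<Longrightarrow> j \<noteq> 0 \<Longrightarrow> 0 \<in># m - {#j#}"
  by (simp add: in_diff_count)

lemma wt_remove: "j \<in># m \<Longrightarrow> wt (m - {#j#}) = wt m - int j"
  by (metis add_diff_cancel_left' insert_DiffM wt_simps(2))

text \<open>Logarithmic derivative of the generating series of \<open>h a\<close>. For
  \<open>a = 1\<close> it is Newton's identity between complete symmetric functions and the power
  sums x_l / 2.\<close>

lemma h_rec: "cst (of_nat k) * h a (int k) = cst (a / 2) * (\<Sum>l\<in>{1..k}. xmon {#l#} * h a (int k - int l))"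
proof (rule mser_eqI)
  fix m
  show "cf (cst (of_nat k) * h a (int k)) m = cf (cst (a / 2) * (\<Sum>l\<in>{1..k}. xmon {#l#} * h a (int k - int l))) m"
  proof (cases "0 \<notin># m \<and> wt m = int k")
    case True
    have sub: "j \<le> k" if "j \<in># m" for j
      using that True wt_remove[OF that] wt_nonneg[of "m - {#j#}"] by linarith
    have "cf (cst (a / 2) * (\<Sum>l\<in>{1..k}. xmon {#l#} * h a (int k - int l))) m
       = (\<Sum>l\<in>{1..k}. if l \<in># m then a / 2 * ecoef (a / 2) (m - {#l#}) else 0)"
      unfolding cf_cst_times cf_sum sum_distrib_left
    proof (intro sum.cong refl)
      fix l assume "l \<in> {1..k}"
      have "0 \<notin># m - {#l#}" using True by (auto dest: in_diffD)
      then show "a / 2 * cf (xmon {#l#} * h a (int k - int l)) m = (if l \<in># m then a / 2 * ecoef (a / 2) (m - {#l#}) else 0)"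
        using True by (auto simp: cf_xmon_times cf_h wt_remove)
    qed
    also have "\<dots> = (\<Sum>l\<in>set_mset m. a / 2 * ecoef (a / 2) (m - {#l#}))"
      by (rule sum.mono_neutral_cong_right) (use True sub in \<open>auto simp: Suc_le_eq intro!: gr0I\<close>)
    also have "\<dots> = cf (cst (of_nat k) * h a (int k)) m"
      using True by (subst ecoef_degree) (auto simp: cf_h)
    finally show ?thesis ..
  next
    case False
    then have "cf (xmon {#l#} * h a (int k - int l)) m = 0" if "l \<in> {1..k}" for l
    proof (cases "l \<in># m")
      case True
      show ?thesis
      proof (cases "0 \<in># m")
        case T0: True
        then have "0 \<in># m - {#l#}" using that pos_diff[of m l] by simp
        then show ?thesis by (simp add: cf_xmon_times cf_h)
      next
        case F0: False
        then show ?thesis using False True wt_remove[OF True] by (simp add: cf_xmon_times cf_h)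
      qed
    qed (simp add: cf_xmon_times)
    then show ?thesis using False by (auto simp: cf_h)
  qed
qed

text \<open>Take the divided derivative of order \<open>k - 1\<close> at z = 1 of d/dz (z^e H) = e
  z^(e-1) H + (a/2) A(z) z^e H, where H generates the \<open>h a n\<close> and A(z) is the sum of
  x_j z^(j-1). The divided derivative of A of order \<open>l - 1\<close> is
  \<open>amin l\<close>.\<close>

lemma hbin_rec:
  assumes "k \<noteq> 0"
  shows "cst (of_nat k) * hbin a e k = cst e * hbin a (e - 1) (k - 1) + cst (a / 2) * (\<Sum>l\<in>{1..k}. amin l * hbin a e (k - l))"
proof (rule mser_eqI)
  fix m
  show "cf (cst (of_nat k) * hbin a e k) m = cf (cst e * hbin a (e - 1) (k - 1) + cst (a / 2) * (\<Sum>l\<in>{1..k}. amin l * hbin a e (k - l))) m"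
  proof (cases "0 \<in># m")
    case True
    then show ?thesis by (auto simp: cf_hbin cf_amin_times pos_diff intro!: sum.neutral)
  next
    case False
    define y where "y = e + of_int (wt m)"
    have "cf (cst (a / 2) * (\<Sum>l\<in>{1..k}. amin l * hbin a e (k - l))) m
       = (\<Sum>l\<in>{1..k}. \<Sum>j\<in>set_mset m. ((of_nat j - 1) gchoose (l - 1)) * ((y - of_nat j) gchoose (k - l)) * (a / 2 * ecoef (a / 2) (m - {#j#})))"
      unfolding cf_cst_times cf_sum cf_amin_times sum_distrib_left
    proof (intro sum.cong refl, goal_cases)
      case (2 l j)
      then have "0 \<notin># m - {#j#}" using False by (auto dest: in_diffD)
      then show ?case using 2 by (simp add: cf_hbin wt_remove y_def algebra_simps)
    qed (use False in auto)
    also have "\<dots> = (\<Sum>j\<in>set_mset m. (\<Sum>l\<in>{1..k}. ((of_nat j - 1) gchoose (l - 1)) * ((y - of_nat j) gchoose (k - l))) * (a / 2 * ecoef (a / 2) (m - {#j#})))"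
      by (subst sum.swap) (simp only: sum_distrib_right)
    also have "\<dots> = ((y - 1) gchoose (k - 1)) * (\<Sum>j\<in>set_mset m. a / 2 * ecoef (a / 2) (m - {#j#}))"
      unfolding Vandermonde_shift[OF assms] sum_distrib_left by simp
    also have "\<dots> = of_int (wt m) * ((y - 1) gchoose (k - 1)) * ecoef (a / 2) m"
      using False by (subst ecoef_degree) auto
    finally have *: "cf (cst (a / 2) * (\<Sum>l\<in>{1..k}. amin l * hbin a e (k - l))) m
      = of_int (wt m) * ((y - 1) gchoose (k - 1)) * ecoef (a / 2) m" .
    have abs: "of_nat k * (y gchoose k) = y * ((y - 1) gchoose (k - 1))"
      using gbinomial_absorption[of "k - 1" y] assms by simp
    have shift: "e - 1 + of_int (wt m) = y - 1" by (simp add: y_def)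
    have "cf (cst (of_nat k) * hbin a e k) m = (of_nat k * (y gchoose k)) * ecoef (a / 2) m"
      using False by (simp add: cf_hbin y_def)
    also have "\<dots> = e * (((y - 1) gchoose (k - 1)) * ecoef (a / 2) m) + of_int (wt m) * ((y - 1) gchoose (k - 1)) * ecoef (a / 2) m"
      unfolding abs by (simp add: y_def distrib_right)
    finally show ?thesis
      unfolding cf_ring(2) * using False by (simp add: cf_hbin shift)
  qed
qed

text \<open>Leibniz rule for the divided derivative of order \<open>k - 1\<close> of z^x times z^e
  H.\<close>

lemma hbin_Vandermonde:
  assumes "k \<noteq> 0"
  shows "(\<Sum>l\<in>{1..k}. cst (x gchoose (l - 1)) * hbin a e (k - l)) = hbin a (e + x) (k - 1)"
proof (rule mser_eqI)
  fix m
  show "cf (\<Sum>l\<in>{1..k}. cst (x gchoose (l - 1)) * hbin a e (k - l)) m = cf (hbin a (e + x) (k - 1)) m"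
    using Vandermonde_shift[OF assms, of x "e + of_int (wt m)"]
    by (simp add: cf_hbin mult.assoc[symmetric] add_ac flip: sum_distrib_right)
qed

text \<open>Annihilation modes in charge \<open>c\<close>: here \<open>alpha(0)\<close> is a scalar.
  The charge is a complex number, in units of varpi.\<close>

definition alphac :: "complex \<Rightarrow> nat \<Rightarrow> mser \<Rightarrow> mser" where
  "alphac c j f = (if j = 0 then cst c * f else alpha j f)"

lemma alphac_linear [simp]:
  "alphac c j (f + g) = alphac c j f + alphac c j g" "alphac c j (cst z * f) = cst z * alphac c j f" "alphac c j 0 = 0"
  by (auto simp: alphac_def distrib_left mult.left_commute)

lemma alphac_sum [simp]: "alphac c j (sum f I) = (\<Sum>x\<in>I. alphac c j (f x))"
  by (simp add: alphac_def sum_distrib_left)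

lemma alphac_commute: "alphac c i (alphac c j f) = alphac c j (alphac c i f)"
  by (auto simp: alphac_def alpha_commute)

lemma Ep_alphac: "Ep a p (alphac c j f) = alphac c j (Ep a p f)"
  by (simp add: alphac_def Ep_alpha)

text \<open>Sums of \<open>Ep a p X\<close> over \<open>p\<close> mix weights, so homogeneity is
  lost; an upper bound on the weight survives, and it is what the truncation \<open>D\<close>
  requires.\<close>

definition bd :: "int \<Rightarrow> mser \<Rightarrow> bool" where
  "bd d f \<longleftrightarrow> (\<forall>m. cf f m \<noteq> 0 \<longrightarrow> 0 \<notin># m \<and> wt m \<le> d)"

lemma bd_0 [simp, intro]: "bd d 0"
  and bd_cst [intro]: "bd d f \<Longrightarrow> bd d (cst z * f)"
  and bd_mono: "bd d f \<Longrightarrow> d \<le> e \<Longrightarrow> bd e f"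
  and hom_bd: "hom d f \<Longrightarrow> bd d f"
  by (fastforce simp: bd_def hom_def)+

lemma bd_add [intro]: "bd d f \<Longrightarrow> bd d g \<Longrightarrow> bd d (f + g)"
  unfolding bd_def cf_ring by (metis add_0)

lemma bd_sum [intro]: "(\<And>x. x \<in> I \<Longrightarrow> bd d (f x)) \<Longrightarrow> bd d (sum f I)"
  by (induction I rule: infinite_finite_induct) auto

lemma bd_alpha: "bd d f \<Longrightarrow> bd (d - int j) (alpha j f)"
  by (fastforce simp: bd_def cf_alpha)

lemma bd_alphac: "bd d f \<Longrightarrow> bd (d - int j) (alphac c j f)"
  by (auto simp: alphac_def intro: bd_alpha)

lemma bd_mult:
  assumes "bd d f" "bd e g"
  shows "bd (d + e) (f * g)"
  unfolding bd_def
proof (intro allI impI)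
  fix m assume "cf (f * g) m \<noteq> 0"
  then obtain p where p: "p \<subseteq># m" "cf f p \<noteq> 0" "cf g (m - p) \<noteq> 0"
    by (auto simp: cf_times elim: sum.not_neutral_contains_not_neutral)
  then obtain q where q: "m = p + q" by (auto simp: mset_subset_eq_exists_conv)
  show "0 \<notin># m \<and> wt m \<le> d + e"
    using p assms by (auto simp: q bd_def) (meson add_mono)
qed

lemma bd_neg: "bd d f \<Longrightarrow> d < 0 \<Longrightarrow> f = 0"
  by (intro mser_eqI) (metis bd_def cf_ring(1) order.strict_trans1 wt_not_neg)

lemma bd_Ep: "bd d f \<Longrightarrow> bd (d - int p) (Ep a p f)"
proof (induction p rule: less_induct)
  case (less p)
  show ?case
  proof (cases "p = 0")
    case False
    have "bd (d - int p) (alpha n (Ep a (p - n) f))" if "n \<in> {1..p}" for n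
      using bd_alpha[OF less.IH[of "p - n"], of n] less.prems that by (simp add: of_nat_diff)
    then have "bd (d - int p) (cst (- a / (2 * of_nat p)) * (\<Sum>n\<in>{1..p}. alpha n (Ep a (p - n) f)))"
      by (intro bd_cst bd_sum)
    then show ?thesis
      using False by (subst Ep.simps) (simp only: if_False)
  qed (use less in simp)
qed

lemma Ep_high': "bd d f \<Longrightarrow> d < int p \<Longrightarrow> Ep a p f = 0"
  using bd_neg[OF bd_Ep[of d f p a]] by simp

section \<open>Normally ordered vertex operators and how they factor\<close>

definition aplus :: "nat \<Rightarrow> complex \<Rightarrow> nat \<Rightarrow> mser \<Rightarrow> mser" where
  "aplus D c l X = (\<Sum>j\<le>D. cst ((- of_nat j - 1) gchoose (l - 1)) * alphac c j X)"

lemma aplus_linear [simp]: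
  "aplus D c l (f + g) = aplus D c l f + aplus D c l g" "aplus D c l (cst z * f) = cst z * aplus D c l f" "aplus D c l 0 = 0"
  by (simp_all add: aplus_def distrib_left sum.distrib sum_distrib_left mult.left_commute)

lemma aplus_commute: "aplus D c l (aplus D c l' X) = aplus D c l' (aplus D c l X)"
proof -
  have *: "aplus D c l (aplus D c l' X) = (\<Sum>j\<le>D. \<Sum>i\<le>D. cst ((- of_nat j - 1) gchoose (l - 1)) *
       (cst ((- of_nat i - 1) gchoose (l' - 1)) * alphac c j (alphac c i X)))" for l l'
    by (simp add: aplus_def sum_distrib_left)
  show ?thesis
    unfolding *[of l l'] *[of l' l]
    by (subst sum.swap, intro sum.cong refl) (simp only: alphac_commute[of c] mult.left_commute)
qed

lemma Ep_aplus: "Ep a p (aplus D c l X) = aplus D c l (Ep a p X)"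
  by (simp add: aplus_def Ep_alphac)

lemma bd_aplus: "bd d X \<Longrightarrow> bd d (aplus D c l X)"
  unfolding aplus_def by (intro bd_sum bd_cst) (metis bd_alphac bd_mono diff_le_self of_nat_0_le_iff diff_left_mono diff_zero)

text \<open>Normal ordering by recursion: the annihilation half of each field acts on
  \<open>X\<close> before all else, the creation half multiplies from the left. \<open>b\<close> is
  the charge of the vector inserted, \<open>c\<close> that of \<open>X\<close>.\<close>

fun vopl :: "nat \<Rightarrow> complex \<Rightarrow> complex \<Rightarrow> nat list \<Rightarrow> mser \<Rightarrow> mser" where
  "vopl D b c [] X = hsum b * (\<Sum>p\<le>D. Ep b p X)"
| "vopl D b c (l # ls) X = amin l * vopl D b c ls X + vopl D b c ls (aplus D c l X)"

lemma vopl_linear [simp]: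
  "vopl D b c ls (f + g) = vopl D b c ls f + vopl D b c ls g"
  "vopl D b c ls (cst z * f) = cst z * vopl D b c ls f"
  by (induction ls arbitrary: f g) (simp_all add: sum.distrib distrib_left sum_distrib_left mult.left_commute)

lemma vopl_0 [simp]: "vopl D b c ls 0 = 0"
  using vopl_linear(2)[of D b c ls 0 0] by simp

lemma vopl_sum [simp]: "vopl D b c ls (sum f I) = (\<Sum>x\<in>I. vopl D b c ls (f x))"
  by (induction I rule: infinite_finite_induct) auto

lemma vopl_swap: "vopl D b c (l # l' # ls) X = vopl D b c (l' # l # ls) X"
  by (simp add: algebra_simps aplus_commute)

lemma vopl_move: "vopl D b c (xs @ l # ys) X = vopl D b c (l # xs @ ys) X"
proof (induction xs arbitrary: X)
  case (Cons a xs)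
  have "vopl D b c (a # xs @ l # ys) X = vopl D b c (a # l # xs @ ys) X"
    using Cons by simp
  then show ?case using vopl_swap by simp
qed simp

text \<open>Fields inside a normally ordered product may be permuted, so the sorted list in
  \<open>Ybas\<close> is just one representative of its multiset.\<close>

lemma vopl_mset: "mset xs = mset ys \<Longrightarrow> vopl D b c xs X = vopl D b c ys X"
proof (induction xs arbitrary: ys X)
  case (Cons a xs)
  then have "a \<in> set ys" by (metis list.set_intros(1) mset_eq_setD)
  then obtain y1 y2 where ys: "ys = y1 @ a # y2" by (meson split_list)
  have "vopl D b c xs X = vopl D b c (y1 @ y2) X" for X
    using Cons.prems ys by (intro Cons.IH) simp
  then show ?case unfolding ys vopl_move by simp
qed simp

text \<open>The creation exponential splits by \<open>hsum_add\<close>, the annihilation exponential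
  by \<open>Ep_plus\<close>, and the latter commutes with all annihilation modes. The bound on
  \<open>X\<close> makes the square of pairs \<open>p, q\<close> and the triangle
  \<open>p + q <= D\<close> give the same sum.\<close>

lemma vopl_charge:
  assumes "bd (int D) X"
  shows "vopl D (a + b) c ls X = hsum a * vopl D b c ls (\<Sum>p\<le>D. Ep a p X)"
  using assms
proof (induction ls arbitrary: X)
  case Nil
  have "(\<Sum>p\<le>D. Ep (a + b) p X) = (\<Sum>(m,p)\<in>(SIGMA m:{..D}. {..m}). Ep a p (Ep b (m - p) X))"
    by (simp add: Ep_plus sum.Sigma)
  also have "\<dots> = (\<Sum>(p,q)\<in>{(p,q). p + q \<le> D}. Ep a p (Ep b q X))"
    by (rule sum.reindex_bij_witness[of _ "\<lambda>(p,q). (p + q, p)" "\<lambda>(m,p). (p, m - p)"]) auto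
  also have "\<dots> = (\<Sum>(p,q)\<in>{..D}\<times>{..D}. Ep a p (Ep b q X))"
  proof (rule sum.mono_neutral_left)
    show "\<forall>i\<in>{..D} \<times> {..D} - {(p, q). p + q \<le> D}. (case i of (p, q) \<Rightarrow> Ep a p (Ep b q X)) = 0"
      using Nil by (auto intro!: Ep_high'[OF bd_Ep])
  qed auto
  also have "\<dots> = (\<Sum>q\<le>D. Ep b q (\<Sum>p\<le>D. Ep a p X))"
    by (simp add: sum.cartesian_product[symmetric] Ep_commute[of a]) (rule sum.swap)
  finally show ?case
    by (simp only: hsum_add mult.assoc vopl.simps)
next
  case (Cons l ls)
  then show ?case
    by (simp add: bd_aplus Ep_aplus distrib_left sum.distrib sum_distrib_left mult.left_commute)
qed

definition parts_le :: "nat \<Rightarrow> nat multiset set" where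
  "parts_le D = {m. 0 \<notin># m \<and> wt m \<le> int D}"

lemma size_le_wt: "0 \<notin># m \<Longrightarrow> int (size m) \<le> wt m"
  by (induction m) (auto simp: Suc_le_eq)

lemma elem_le_wt: "n \<in># m \<Longrightarrow> int n \<le> wt m"
  using wt_remove[of n m] wt_nonneg[of "m - {#n#}"] by linarith

lemma finite_parts_le [simp]: "finite (parts_le D)"
proof (rule finite_subset)
  show "parts_le D \<subseteq> mset ` {xs. set xs \<subseteq> {..D} \<and> length xs \<le> D}"
  proof
    fix m assume m: "m \<in> parts_le D"
    obtain xs where xs: "mset xs = m" using ex_mset by blast
    have "n \<le> D" if "n \<in># m" for n
      using elem_le_wt[OF that] m unfolding parts_le_def by simp
    then have "set xs \<subseteq> {..D}" by (auto simp flip: xs)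
    moreover have "length xs \<le> D"
      using size_le_wt[of m] m unfolding parts_le_def by (simp flip: xs)
    ultimately
    show "m \<in> mset ` {xs. set xs \<subseteq> {..D} \<and> length xs \<le> D}" using xs by blast
  qed
qed (simp add: finite_lists_length_le)

definition vop :: "nat \<Rightarrow> complex \<Rightarrow> complex \<Rightarrow> mser \<Rightarrow> mser \<Rightarrow> mser" where
  "vop D b c u X = (\<Sum>m\<in>parts_le D. cst (cf u m) * vopl D b c (sorted_list_of_multiset m) X)"

lemma vop_linear [simp]:
  "vop D b c u (f + g) = vop D b c u f + vop D b c u g"
  "vop D b c u (cst z * f) = cst z * vop D b c u f"
  "vop D b c (u + v) f = vop D b c u f + vop D b c v f"
  "vop D b c (cst z * u) f = cst z * vop D b c u f"
  "vop D b c 0 f = 0" "vop D b c u 0 = 0"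
  by (simp_all add: vop_def sum.distrib distrib_left distrib_right sum_distrib_left mult.left_commute
      cst_simps mult.assoc)

lemma vop_sum [simp]:
  "vop D b c u (sum f I) = (\<Sum>x\<in>I. vop D b c u (f x))"
  "vop D b c (sum f I) X = (\<Sum>x\<in>I. vop D b c (f x) X)"
  by (induction I rule: infinite_finite_induct) auto

text \<open>The bound on \<open>xmon {#l#} * u\<close> guarantees that the truncation in
  \<open>vop\<close> discards none of its monomials.\<close>

lemma vop_mult:
  assumes "bd (int D) (xmon {#l#} * u)" "l \<noteq> 0"
  shows "vop D b c (xmon {#l#} * u) X = amin l * vop D b c u X + vop D b c u (aplus D c l X)"
proof -
  let ?Y = "\<lambda>m. vopl D b c (sorted_list_of_multiset m) X"
  have "vop D b c (xmon {#l#} * u) X = (\<Sum>m\<in>parts_le D. if l \<in># m then cst (cf u (m - {#l#})) * ?Y m else 0)"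
    unfolding vop_def by (rule sum.cong) (auto simp: cf_xmon_times)
  also have "\<dots> = (\<Sum>m\<in>{m \<in> parts_le D. l \<in># m \<and> cf u (m - {#l#}) \<noteq> 0}. cst (cf u (m - {#l#})) * ?Y m)"
    by (rule sum.mono_neutral_cong_right) auto
  also have "\<dots> = (\<Sum>m\<in>{m \<in> parts_le D. cf u m \<noteq> 0}. cst (cf u m) * ?Y (add_mset l m))"
  proof (rule sum.reindex_bij_witness[of _ "add_mset l" "\<lambda>m. m - {#l#}"])
    fix m assume m: "m \<in> {m \<in> parts_le D. cf u m \<noteq> 0}"
    then have "cf (xmon {#l#} * u) (add_mset l m) \<noteq> 0" by (auto simp: cf_xmon_times)
    then have "0 \<notin># add_mset l m" "wt (add_mset l m) \<le> int D"
      using assms unfolding bd_def by blast+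
    then show "add_mset l m \<in> {m \<in> parts_le D. l \<in># m \<and> cf u (m - {#l#}) \<noteq> 0}"
      using m by (auto simp: parts_le_def)
  qed (auto simp: parts_le_def wt_remove dest: in_diffD)
  also have "\<dots> = (\<Sum>m\<in>parts_le D. cst (cf u m) * ?Y (add_mset l m))"
    by (rule sum.mono_neutral_left) auto
  also have "\<dots> = (\<Sum>m\<in>parts_le D. cst (cf u m) * vopl D b c (l # sorted_list_of_multiset m) X)"
    by (intro sum.cong refl arg_cong[of _ _ "\<lambda>x. _ * x"] vopl_mset) simp
  also have "\<dots> = amin l * vop D b c u X + vop D b c u (aplus D c l X)"
    by (simp add: vop_def distrib_left sum.distrib sum_distrib_left mult.left_commute)
  finally show ?thesis .
qed

lemma vop_charge:
  assumes "bd (int D) X"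
  shows "vop D (a + b) c v X = hsum a * vop D b c v (\<Sum>p\<le>D. Ep a p X)"
  unfolding vop_def vopl_charge[OF assms] by (simp only: sum_distrib_left mult.left_commute)

text \<open>\<open>h a k\<close> times e^(a varpi) is the \<open>k\<close>-th divided derivative of
  e^(a varpi). Hence its field is the derivative of a creation exponential, an annihilation
  exponential and z^(ac/2); the summand with \<open>Ep a p\<close> carries z^(ac/2 - p). The
  operator of \<open>v\<close>, in charge \<open>b\<close>, stays in the middle.\<close>

lemma vop_h:
  assumes v: "bd d v" and k: "d + int k \<le> int D" and X: "bd (int D) X"
  shows "vop D (a + b) c (h a (int k) * v) X = (\<Sum>p\<le>D. hbin a (a * c / 2 - of_nat p) k * vop D b c v (Ep a p X))"
  using k X
proof (induction k arbitrary: X rule: less_induct)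
  case (less k)
  show ?case
  proof (cases "k = 0")
    case True
    then show ?thesis
      using vop_charge[OF less.prems(2), of a b c v]
      by (simp add: hbin_0[of a "a * c / 2 - of_nat p" for p] sum_distrib_left)
  next
    case False
    define y where "y p = vop D b c v (Ep a p X)" for p
    define Z where "Z p j = vop D b c v (alphac c j (Ep a p X))" for p j
    define e where "e p = a * c / 2 - of_nat p" for p
    define g where "g j l = ((- of_nat j - 1) gchoose (l - 1) :: complex)" for j l
    define Q where "Q q = hbin a (a * c / 2 - of_nat q - 1) (k - 1)" for q
    have IH: "vop D (a + b) c (h a (int k - int l) * v) X' = (\<Sum>p\<le>D. hbin a (e p) (k - l) * vop D b c v (Ep a p X'))"
      if "l \<in> {1..k}" "bd (int D) X'" for l X'
    proof -
      show ?thesis using less.IH[of "k - l" X'] that less.prems(1) by (simp add: e_def of_nat_diff)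
    qed
    have bdm: "bd (int D) (xmon {#l#} * (h a (int k - int l) * v))" if "l \<in> {1..k}" for l
    proof -
      have "bd (int l) (xmon {#l#})" using that by (auto simp: bd_def cf_xmon)
      from bd_mult[OF this bd_mult[OF hom_bd[OF hom_h] v, of "int k - int l" a]]
      show ?thesis by (rule bd_mono) (use less.prems in simp)
    qed
    have d1: "z * (\<Sum>p\<in>I. S p * y p) = (\<Sum>p\<in>I. (z * S p) * y p)"
      and d2: "z * (\<Sum>p\<in>I. T p * S p) = (\<Sum>p\<in>I. T p * (z * S p))"
      for z and S T :: "nat \<Rightarrow> mser" and I
      by (simp_all only: sum_distrib_left mult.assoc mult.left_commute)
    have "cst (of_nat k) * vop D (a + b) c (h a (int k) * v) X
        = vop D (a + b) c ((cst (of_nat k) * h a (int k)) * v) X"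
      by (simp add: mult.assoc)
    also have "\<dots> = cst (a / 2) * (\<Sum>l\<in>{1..k}. vop D (a + b) c (xmon {#l#} * (h a (int k - int l) * v)) X)"
      unfolding h_rec by (simp add: mult.assoc sum_distrib_right)
    also have "(\<Sum>l\<in>{1..k}. vop D (a + b) c (xmon {#l#} * (h a (int k - int l) * v)) X)
       = (\<Sum>l\<in>{1..k}. amin l * (\<Sum>p\<le>D. hbin a (e p) (k - l) * y p)
          + (\<Sum>p\<le>D. hbin a (e p) (k - l) * (\<Sum>j\<le>D. cst (g j l) * Z p j)))"
    proof (intro sum.cong refl, goal_cases)
      case (1 l)
      have "vop D b c v (Ep a p (aplus D c l X)) = (\<Sum>j\<le>D. cst (g j l) * Z p j)" for p
        by (simp add: aplus_def Ep_alphac Z_def g_def)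
      then show ?case
        using 1 bdm[OF 1] less.prems(2) by (subst vop_mult) (simp_all add: IH bd_aplus y_def)
    qed
    also have "\<dots> = (\<Sum>p\<le>D. (\<Sum>l\<in>{1..k}. amin l * hbin a (e p) (k - l)) * y p)
        + (\<Sum>p\<le>D. \<Sum>j\<le>D. (\<Sum>l\<in>{1..k}. cst (g j l) * hbin a (e p) (k - l)) * Z p j)"
    proof -
      have 1: "(\<Sum>l\<in>{1..k}. amin l * (\<Sum>p\<le>D. hbin a (e p) (k - l) * y p)) = (\<Sum>p\<le>D. (\<Sum>l\<in>{1..k}. amin l * hbin a (e p) (k - l)) * y p)"
        by (simp only: sum_distrib_left sum_distrib_right mult.assoc) (rule sum.swap)
      have "(\<Sum>l\<in>{1..k}. \<Sum>p\<le>D. hbin a (e p) (k - l) * (\<Sum>j\<le>D. cst (g j l) * Z p j))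
         = (\<Sum>l\<in>{1..k}. \<Sum>p\<le>D. \<Sum>j\<le>D. cst (g j l) * (hbin a (e p) (k - l) * Z p j))"
        by (simp only: sum_distrib_left mult.left_commute)
      also have "\<dots> = (\<Sum>p\<le>D. \<Sum>l\<in>{1..k}. \<Sum>j\<le>D. cst (g j l) * (hbin a (e p) (k - l) * Z p j))"
        by (rule sum.swap)
      also have "\<dots> = (\<Sum>p\<le>D. \<Sum>j\<le>D. \<Sum>l\<in>{1..k}. cst (g j l) * (hbin a (e p) (k - l) * Z p j))"
        by (rule sum.cong[OF refl], rule sum.swap)
      finally show ?thesis
        by (simp only: sum.distrib 1 sum_distrib_right mult.assoc)
    qed
    also have "(\<Sum>p\<le>D. \<Sum>j\<le>D. (\<Sum>l\<in>{1..k}. cst (g j l) * hbin a (e p) (k - l)) * Z p j) = (\<Sum>p\<le>D. \<Sum>j\<le>D. Q (p + j) * Z p j)"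
      unfolding g_def hbin_Vandermonde[OF False]
      by (simp add: Q_def e_def algebra_simps)
    also have "\<dots> = (\<Sum>(p,j)\<in>{..D} \<times> {..D}. Q (p + j) * Z p j)"
      by (simp add: sum.cartesian_product)
    also have "\<dots> = (\<Sum>(p,j)\<in>{(p,j). p + j \<le> D}. Q (p + j) * Z p j)"
    proof (rule sum.mono_neutral_right)
      show "\<forall>i\<in>{..D} \<times> {..D} - {(p, j). p + j \<le> D}. (case i of (p, j) \<Rightarrow> Q (p + j) * Z p j) = 0"
      proof
        fix i assume i: "i \<in> {..D} \<times> {..D} - {(p, j). p + j \<le> D}"
        obtain p j where pj: "i = (p, j)" by (cases i)
        with i have "int D - int p - int j < 0" by auto
        then have "alphac c j (Ep a p X) = 0"
          by (rule bd_neg[OF bd_alphac[OF bd_Ep[OF less.prems(2)]]])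
        then show "(case i of (p, j) \<Rightarrow> Q (p + j) * Z p j) = 0" by (simp add: Z_def pj)
      qed
    qed auto
    also have "\<dots> = (\<Sum>(m,j)\<in>(SIGMA m:{..D}. {..m}). Q m * Z (m - j) j)"
      by (rule sum.reindex_bij_witness[of _ "\<lambda>(m,j). (m - j, j)" "\<lambda>(p,j). (p + j, j)"]) auto
    also have "\<dots> = (\<Sum>m\<le>D. Q m * (\<Sum>j\<le>m. Z (m - j) j))"
      by (simp add: sum.Sigma sum_distrib_left)
    finally have main: "cst (of_nat k) * vop D (a + b) c (h a (int k) * v) X
      = (\<Sum>p\<le>D. (cst (a / 2) * (\<Sum>l\<in>{1..k}. amin l * hbin a (e p) (k - l))) * y p)
        + (\<Sum>m\<le>D. Q m * (cst (a / 2) * (\<Sum>j\<le>m. Z (m - j) j)))"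
      by (simp only: distrib_left d1 d2)
    \<comment> \<open>The z-derivative of the annihilation exponential times z^(ac/2): each power of
      z yields its exponent, and on the other side the field \<open>alpha(z)\<close> with its zero
      mode appears.\<close>
    have Zsum: "cst (a / 2) * (\<Sum>j\<le>m. Z (m - j) j) = cst (e m) * y m" for m
    proof -
      have "{..m} = insert 0 {1..m}" by auto
      then have "(\<Sum>j\<le>m. alphac c j (Ep a (m - j) X)) = cst c * Ep a m X + (\<Sum>j\<in>{1..m}. alpha j (Ep a (m - j) X))"
        by (simp add: alphac_def)
      then have "cst (a / 2) * (\<Sum>j\<le>m. alphac c j (Ep a (m - j) X))
         = cst (a / 2) * (cst c * Ep a m X) - cst (- a / 2) * (\<Sum>j\<in>{1..m}. alpha j (Ep a (m - j) X))"
        by (simp add: distrib_left cst_simps)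
      also have "\<dots> = cst (e m) * Ep a m X"
        unfolding Ep_rec[symmetric] by (simp add: e_def cst_simps cst_cst left_diff_distrib)
      finally have "cst (e m) * Ep a m X = cst (a / 2) * (\<Sum>j\<le>m. alphac c j (Ep a (m - j) X))" ..
      then have "vop D b c v (cst (e m) * Ep a m X) = vop D b c v (cst (a / 2) * (\<Sum>j\<le>m. alphac c j (Ep a (m - j) X)))"
        by simp
      then show ?thesis by (simp add: Z_def y_def)
    qed
    have "cst (of_nat k) * vop D (a + b) c (h a (int k) * v) X = (\<Sum>p\<le>D. cst (of_nat k) * hbin a (e p) k * y p)"
      unfolding main Zsum sum.distrib[symmetric]
    proof (rule sum.cong[OF refl])
      fix p
      have HHp: "cst (of_nat k) * hbin a (e p) k = cst (e p) * Q p + cst (a / 2) * (\<Sum>l\<in>{1..k}. amin l * hbin a (e p) (k - l))"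
        unfolding hbin_rec[OF False] by (simp add: Q_def e_def)
      show "cst (a / 2) * (\<Sum>l\<in>{1..k}. amin l * hbin a (e p) (k - l)) * y p + Q p * (cst (e p) * y p)
          = cst (of_nat k) * hbin a (e p) k * y p"
        unfolding HHp by (simp only: distrib_right mult.assoc mult.left_commute add.commute)
    qed
    then have "cst (of_nat k) * vop D (a + b) c (h a (int k) * v) X = cst (of_nat k) * (\<Sum>p\<le>D. hbin a (e p) k * y p)"
      by (simp only: sum_distrib_left mult.assoc)
    then have "vop D (a + b) c (h a (int k) * v) X = (\<Sum>p\<le>D. hbin a (e p) k * y p)"
      by (rule cst_cancel[rotated]) (use False in simp)
    then show ?thesis
      unfolding e_def y_def .
  qed
qed

section \<open>Comparison with the lattice vertex operator formula\<close>

definition emb :: "int \<Rightarrow> mser \<Rightarrow> vec" where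
  "emb c f = (\<lambda>(m, lam). if m = c then cf f lam else 0)"

definition wt_part :: "int \<Rightarrow> mser \<Rightarrow> mser" where
  "wt_part w f = Mser (\<lambda>m. if wt m = w then cf f m else 0)"

lemma cf_wt_part: "cf (wt_part w f) m = (if wt m = w then cf f m else 0)"
  by (simp add: wt_part_def)

lemma vsum_eq:
  assumes "finite I" "\<And>x. x \<notin> I \<Longrightarrow> g x k = 0"
  shows "vsum g k = (\<Sum>x\<in>I. g x k)"
  unfolding vsum_def by (rule sum.mono_neutral_left) (use assms in auto)

lemma emb_apply: "emb c f (m, nu) = (if m = c then cf f nu else 0)"
  by (simp add: emb_def)

lemma bas_emb: "bas (c, mu) = emb c (xmon mu)"
  by (auto simp: bas_def emb_def cf_xmon fun_eq_iff)

definition amode_ser :: "complex \<Rightarrow> int \<Rightarrow> mser \<Rightarrow> mser" where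
  "amode_ser c n f = (if n < 0 then xmon {#nat (- n)#} * f else alphac c (nat n) f)"

lemma lin_single:
  assumes "\<And>x. x \<noteq> x0 \<Longrightarrow> T x k = 0"
  shows "lin T f k = f x0 * T x0 k"
  unfolding lin_def
  by (subst vsum_eq[of "{x0}"]) (use assms in \<open>auto simp: vscale_def\<close>)

lemma amode_emb: "amode n (emb c f) = emb c (amode_ser (of_int c) n f)"
proof
  fix k :: key
  obtain m nu where k: "k = (m, nu)" by (cases k)
  consider "n < 0" "nat (- n) \<in># nu" | "n < 0" "nat (- n) \<notin># nu" | "n = 0" | "n > 0" by linarith
  then show "amode n (emb c f) k = emb c (amode_ser (of_int c) n f) k"
  proof cases
    case 1
    then show ?thesis
      unfolding amode_def k
      by (subst lin_single[of "(m, nu - {#nat (- n)#})"])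
        (auto simp: amode_b_def bas_def emb_apply amode_ser_def cf_xmon_times split: if_splits)
  next
    case 2
    then have "amode_b n x (m, nu) = 0" for x
      by (auto simp: amode_b_def bas_def split: prod.splits)
    then show ?thesis
      unfolding amode_def k using 2
      by (subst lin_single[of "(m, nu)"]) (auto simp: emb_apply amode_ser_def cf_xmon_times)
  next
    case 3
    then show ?thesis
      unfolding amode_def k
      by (subst lin_single[of "(m, nu)"])
        (auto simp: amode_b_def bas_def emb_apply amode_ser_def alphac_def vscale_def split: prod.splits)
  next
    case 4
    have "amode_b n x (m, nu) = 0" if "x \<noteq> (m, add_mset (nat n) nu)" for x
    proof (cases x)
      case (Pair m' lam)
      show ?thesis
      proof (cases "nat n \<in># lam")
        case True
        then show ?thesis using that 4 Pair by (auto simp: amode_b_def bas_def vscale_def)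
      next
        case False
        then show ?thesis using 4 Pair by (auto simp: amode_b_def vscale_def not_in_iff)
      qed
    qed
    then show ?thesis
      unfolding amode_def k using 4
      by (subst lin_single[of "(m, add_mset (nat n) nu)"])
        (auto simp: amode_b_def bas_def emb_apply amode_ser_def alphac_def cf_alpha vscale_def algebra_simps)
  qed
qed

lemma aprod_emb: "aprod ns (emb c f) = emb c (foldr (amode_ser (of_int c)) ns f)"
  by (induction ns) (auto simp: amode_emb)

lemma eshift_emb: "eshift b (emb c f) = emb (c + b) f"
proof
  fix k :: key
  obtain m nu where k: "k = (m, nu)" by (cases k)
  show "eshift b (emb c f) k = emb (c + b) f k"
    unfolding eshift_def k
    by (subst lin_single[of "(m - b, nu)"]) (auto simp: bas_def emb_apply split: prod.splits)
qed

definition alpham :: "complex \<Rightarrow> nat multiset \<Rightarrow> mser \<Rightarrow> mser" where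
  "alpham c p X = fold_mset (alphac c) X p"

lemma alpham_simps [simp]: "alpham c {#} X = X" "alpham c (add_mset n p) X = alphac c n (alpham c p X)"
proof -
  interpret comp_fun_commute "alphac c"
    by standard (auto simp: alphac_commute)
  show "alpham c {#} X = X" "alpham c (add_mset n p) X = alphac c n (alpham c p X)"
    by (simp_all add: alpham_def fold_mset_add_mset)
qed

lemma alpham_alphac: "alpham c p (alphac c n X) = alphac c n (alpham c p X)"
  by (induction p) (auto simp: alphac_commute)

lemma alpham_linear [simp]:
  "alpham c p (f + g) = alpham c p f + alpham c p g" "alpham c p (cst z * f) = cst z * alpham c p f"
  by (induction p) auto

lemma hom_alphac: "hom d f \<Longrightarrow> hom (d - int j) (alphac c j f)"
  by (auto simp: alphac_def)

lemma hom_alpham: "hom d f \<Longrightarrow> hom (d - wt p) (alpham c p f)"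
proof (induction p)
  case (add n p)
  then show ?case using hom_alphac[of "d - wt p" "alpham c p f" n c] by (simp add: algebra_simps)
qed simp

text \<open>One summand of \<open>Ybas\<close> transported to series: \<open>ns\<close> lists the
  modes of the derivative fields, \<open>p\<close> and \<open>q\<close> are the partitions from the
  annihilation and creation exponentials.\<close>

definition vterm :: "complex \<Rightarrow> int list \<Rightarrow> nat multiset \<Rightarrow> nat multiset \<Rightarrow> mser \<Rightarrow> mser" where
  "vterm c ns p q X = foldr (amode_ser c) (filter (\<lambda>n. n < 0) ns)
     (xmon q * foldr (amode_ser c) (filter (\<lambda>n. 0 \<le> n) ns) (alpham c p X))"

lemma foldr_amode_ser_nonneg_shift:
  "foldr (amode_ser c) (filter (\<lambda>n. 0 \<le> n) ns) (alphac c n X) = alphac c n (foldr (amode_ser c) (filter (\<lambda>n. 0 \<le> n) ns) X)"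
  by (induction ns) (auto simp: amode_ser_def alphac_commute)

lemma foldr_amode_ser_nonneg_linear:
  "foldr (amode_ser c) (filter (\<lambda>n. 0 \<le> n) ns) (f + g) = foldr (amode_ser c) (filter (\<lambda>n. 0 \<le> n) ns) f + foldr (amode_ser c) (filter (\<lambda>n. 0 \<le> n) ns) g"
  "foldr (amode_ser c) (filter (\<lambda>n. 0 \<le> n) ns) (cst z * f) = cst z * foldr (amode_ser c) (filter (\<lambda>n. 0 \<le> n) ns) f"
  by (induction ns) (auto simp: amode_ser_def)

lemma foldr_amode_ser_neg_linear:
  "foldr (amode_ser c) (filter (\<lambda>n. n < 0) ns) (f + g) = foldr (amode_ser c) (filter (\<lambda>n. n < 0) ns) f + foldr (amode_ser c) (filter (\<lambda>n. n < 0) ns) g"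
  "foldr (amode_ser c) (filter (\<lambda>n. n < 0) ns) (cst z * f) = cst z * foldr (amode_ser c) (filter (\<lambda>n. n < 0) ns) f"
  by (induction ns) (auto simp: amode_ser_def distrib_left mult.left_commute)

lemma vterm_linear [simp]:
  "vterm c ns p q (f + g) = vterm c ns p q f + vterm c ns p q g"
  "vterm c ns p q (cst z * f) = cst z * vterm c ns p q f"
  by (simp_all add: vterm_def foldr_amode_ser_neg_linear foldr_amode_ser_nonneg_linear distrib_left mult.left_commute)

lemma vterm_Cons:
  "vterm c (n # ns) p q X = (if n < 0 then xmon {#nat (- n)#} * vterm c ns p q X else vterm c ns p q (alphac c (nat n) X))"
  by (auto simp: vterm_def amode_ser_def alpham_alphac foldr_amode_ser_nonneg_shift)

lemma vterm_Nil: "vterm c [] p q X = xmon q * alpham c p X"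
  by (simp add: vterm_def)

text \<open>Creation modes do not see the charge, although in \<open>Ybas\<close> they act after the
  shift by \<open>b\<close>.\<close>

lemma foldr_amode_ser_neg_cong: "foldr (amode_ser c) (filter (\<lambda>n. n < 0) ns) f = foldr (amode_ser c') (filter (\<lambda>n. n < 0) ns) f"
  by (induction ns) (auto simp: amode_ser_def)

lemma foldr_amode_ser_create:
  "0 \<notin> set xs \<Longrightarrow> foldr (amode_ser c) (map (\<lambda>n. - int n) xs) f = xmon (mset xs) * f"
proof (induction xs)
  case (Cons x xs)
  have "xmon (add_mset x (mset xs)) = xmon {#x#} * xmon (mset xs)"
    using xmon_add[of "{#x#}" "mset xs"] by simp
  with Cons show ?case by (simp add: amode_ser_def mult.assoc)
qed simp

lemma foldr_amode_ser_int: "foldr (amode_ser c) (map int xs) f = alpham c (mset xs) f"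
  by (induction xs) (auto simp: amode_ser_def)

lemma vterm_vec:
  assumes "0 \<notin># q"
  shows "aprod (filter (\<lambda>n. n < 0) ns)
                 (aprod (map (\<lambda>n. - int n) (sorted_list_of_multiset q))
                   (eshift b
                     (aprod (filter (\<lambda>n. 0 \<le> n) ns)
                       (aprod (map int (sorted_list_of_multiset p)) (bas (c, mu))))))
    = emb (b + c) (vterm (of_int c) ns p q (xmon mu))"
  unfolding bas_emb aprod_emb eshift_emb vterm_def
  by (subst foldr_amode_ser_create) (use assms in \<open>auto simp: foldr_amode_ser_int add.commute intro: arg_cong[OF foldr_amode_ser_neg_cong]\<close>)

text \<open>\<open>d2\<close> is the weight left once all annihilation operators have acted, and the
  term vanishes if it is negative. Keeping it apart from the final weight is what bounds the mode
  lists and partitions that reach a given coefficient.\<close>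

lemma hom_vterm:
  assumes "hom e X" "0 \<notin># q"
  shows "\<exists>d2. hom (d2 + wt q - sum_list (filter (\<lambda>n. n < 0) ns)) (vterm c ns p q X)
    \<and> d2 = e - wt p - sum_list (filter (\<lambda>n. 0 \<le> n) ns) \<and> (d2 < 0 \<longrightarrow> vterm c ns p q X = 0)"
  using assms(1)
proof (induction ns arbitrary: e X)
  case Nil
  have "hom (e - wt p) (alpham c p X)" by (rule hom_alpham[OF Nil])
  then show ?case
    using hom_mult[OF hom_xmon[OF assms(2)], of "e - wt p" "alpham c p X"] hom_neg[of "e - wt p" "alpham c p X"]
    by (auto simp: vterm_Nil add.commute)
next
  case (Cons n ns)
  show ?case
  proof (cases "n < 0")
    case True
    have m: "hom (- n) (xmon {#nat (- n)#})" using True by (simp add: hom_def cf_xmon)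
    from Cons.IH[OF Cons.prems] obtain d2 where
      d2: "hom (d2 + wt q - sum_list (filter (\<lambda>n. n < 0) ns)) (vterm c ns p q X)"
      "d2 = e - wt p - sum_list (filter (\<lambda>n. 0 \<le> n) ns)" "d2 < 0 \<longrightarrow> vterm c ns p q X = 0" by blast
    then show ?thesis using True hom_mult[OF m d2(1)] by (auto simp: vterm_Cons algebra_simps)
  next
    case False
    from Cons.IH[OF hom_alphac[OF Cons.prems, where j = "nat n" and c = c]] False show ?thesis
      by (auto simp: vterm_Cons algebra_simps)
  qed
qed

definition parts :: "nat \<Rightarrow> nat multiset set" where
  "parts n = {m. 0 \<notin># m \<and> wt m = int n}"

lemma finite_parts [simp]: "finite (parts n)"
  by (rule finite_subset[OF _ finite_parts_le[of n]]) (auto simp: parts_def parts_le_def)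

lemma parts_0: "parts 0 = {{#}}"
  by (auto simp: parts_def dest: pos_wt_0)

text \<open>The expansion of the exponential over partitions obeys the recursion of
  \<open>Ep\<close>, by \<open>ecoef_degree\<close>; this links \<open>Ep\<close> to the
  coefficients in \<open>Ybas\<close>.\<close>

lemma Ep_eq_alpham: "Ep a n X = (\<Sum>p\<in>parts n. cst (ecoef (- a / 2) p) * alpham c p X)"
proof -
  define x where "x = - a / 2"
  define T where "T n = (\<Sum>p\<in>parts n. cst (ecoef x p) * alpham c p X)" for n
  have "cst (of_nat m) * T m = cst (- a / 2) * (\<Sum>n\<in>{1..m}. alpha n (T (m - n)))" for m
  proof -
    have "cst (of_nat m) * T m = (\<Sum>p\<in>parts m. cst (of_int (wt p) * ecoef x p) * alpham c p X)"
      unfolding T_def sum_distrib_left by (rule sum.cong) (auto simp: parts_def cst_cst)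
    also have "\<dots> = (\<Sum>p\<in>parts m. \<Sum>j\<in>set_mset p. cst (x * ecoef x (p - {#j#})) * alpham c p X)"
    proof (rule sum.cong[OF refl])
      fix p assume "p \<in> parts m"
      then have "0 \<notin># p" by (simp add: parts_def)
      from ecoef_degree[OF this, of x, symmetric]
      show "cst (of_int (wt p) * ecoef x p) * alpham c p X = (\<Sum>j\<in>set_mset p. cst (x * ecoef x (p - {#j#})) * alpham c p X)"
        by (simp only: cst_sum sum_distrib_right)
    qed
    also have "\<dots> = (\<Sum>(p,j)\<in>(SIGMA p:parts m. set_mset p). cst (x * ecoef x (p - {#j#})) * alpham c p X)"
      by (simp add: sum.Sigma)
    also have "\<dots> = (\<Sum>(n,p)\<in>(SIGMA n:{1..m}. parts (m - n)). cst (x * ecoef x p) * alpha n (alpham c p X))"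
    proof (rule sum.reindex_bij_witness[of _ "\<lambda>(n,p). (add_mset n p, n)" "\<lambda>(p,j). (j, p - {#j#})"], goal_cases)
      case (2 i)
      then obtain p j where i: "i = (p, j)" "p \<in> parts m" "j \<in># p" by auto
      then have "j \<noteq> 0" "0 \<notin># p - {#j#}" by (auto simp: parts_def dest: in_diffD intro: gr0I)
      moreover have "j \<le> m" using i elem_le_wt[of j p] by (auto simp: parts_def)
      ultimately show ?case using i by (auto simp: parts_def wt_remove of_nat_diff)
    next
      case (5 i)
      then obtain p j where i: "i = (p, j)" "p \<in> parts m" "j \<in># p" by auto
      then have "j \<noteq> 0" by (auto simp: parts_def intro: gr0I)
      moreover have "alpham c p X = alphac c j (alpham c (p - {#j#}) X)"
        using i alpham_simps(2)[of c j "p - {#j#}" X] by simp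
      ultimately show ?case by (simp add: i alphac_def)
    qed (auto simp: parts_def of_nat_diff)
    also have "\<dots> = cst (- a / 2) * (\<Sum>n\<in>{1..m}. alpha n (T (m - n)))"
      by (simp add: T_def sum.Sigma[symmetric] sum_distrib_left x_def cst_cst)
    finally show ?thesis .
  qed
  from Ep_unique[OF this, of n] show ?thesis
    by (simp add: T_def parts_0 x_def)
qed

lemma sum_parts_le: "(\<Sum>p\<in>parts_le D. f p) = (\<Sum>n\<le>D. \<Sum>p\<in>parts n. f p)"
proof -
  have "parts_le D = (\<Union>n\<in>{..D}. parts n)"
  proof (intro equalityI subsetI)
    fix p assume "p \<in> parts_le D"
    then show "p \<in> (\<Union>n\<in>{..D}. parts n)"
      by (intro UN_I[of "nat (wt p)"]) (auto simp: parts_le_def parts_def)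
  qed (auto simp: parts_le_def parts_def)
  then show ?thesis
    by (simp only:) (subst sum.UNION_disjoint, auto, auto simp: parts_def)
qed

text \<open>Equality modulo weights above \<open>M\<close>, the sense in which infinite sums are
  replaced by finite ones.\<close>

definition agree :: "int \<Rightarrow> mser \<Rightarrow> mser \<Rightarrow> bool" where
  "agree M f g \<longleftrightarrow> (\<forall>m. wt m \<le> M \<longrightarrow> cf f m = cf g m)"

lemma agree_refl [simp]: "agree M f f"
  and agree_trans: "agree M f g \<Longrightarrow> agree M g k \<Longrightarrow> agree M f k"
  and agree_add: "agree M f g \<Longrightarrow> agree M f' g' \<Longrightarrow> agree M (f + f') (g + g')"
  by (auto simp: agree_def)

lemma wt_mono: "p \<subseteq># m \<Longrightarrow> wt p \<le> wt m"
  by (metis le_add_same_cancel1 mset_subset_eq_exists_conv wt_nonneg wt_simps(3))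

lemma agree_mult:
  assumes "agree M f g" "agree M f' g'"
  shows "agree M (f * f') (g * g')"
  unfolding agree_def cf_times
proof (intro allI impI sum.cong refl)
  fix m p assume "wt m \<le> M" "p \<in> {p. p \<subseteq># m}"
  then have "wt p \<le> M" "wt (m - p) \<le> M"
    using wt_mono[of p m] wt_mono[of "m - p" m] by auto
  then show "cf f p * cf f' (m - p) = cf g p * cf g' (m - p)"
    using assms by (simp add: agree_def)
qed

text \<open>Modes below \<open>- M\<close> create weight above \<open>M\<close>, and modes above
  \<open>D\<close> annihilate everything of weight at most \<open>D\<close>.\<close>

definition mode_lists :: "nat \<Rightarrow> nat \<Rightarrow> nat \<Rightarrow> int list set" where
  "mode_lists M D n = {ns. set ns \<subseteq> {- int M..int D} \<and> length ns = n}"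

lemma finite_mode_lists [simp]: "finite (mode_lists M D n)"
  unfolding mode_lists_def by (rule finite_lists_length_eq) simp

lemma mode_lists_0: "mode_lists M D 0 = {[]}"
  by (auto simp: mode_lists_def)

lemma sum_mode_lists_Suc: "(\<Sum>ns\<in>mode_lists M D (Suc k). F ns) = (\<Sum>n\<in>{- int M..int D}. \<Sum>ns\<in>mode_lists M D k. F (n # ns))"
proof -
  have "(\<Sum>ns\<in>mode_lists M D (Suc k). F ns) = (\<Sum>(n,ns)\<in>{- int M..int D} \<times> mode_lists M D k. F (n # ns))"
  proof (rule sum.reindex_bij_witness[of _ "\<lambda>(n,ns). n # ns" "\<lambda>xs. (hd xs, tl xs)"], goal_cases)
    case (2 a)
    then show ?case by (cases a) (auto simp: mode_lists_def)
  next
    case (1 a)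
    then show ?case by (cases a) (auto simp: mode_lists_def)
  next
    case (5 a)
    then show ?case by (cases a) (auto simp: mode_lists_def)
  qed (auto simp: mode_lists_def)
  then show ?thesis by (simp add: sum.cartesian_product)
qed

definition ncoef :: "nat list \<Rightarrow> int list \<Rightarrow> complex" where
  "ncoef ls ns = prod_list (map2 (\<lambda>n l. (of_int (- n - 1) :: complex) gchoose (l - 1)) ns ls)"

definition vopn :: "nat \<Rightarrow> nat \<Rightarrow> complex \<Rightarrow> complex \<Rightarrow> nat list \<Rightarrow> mser \<Rightarrow> mser" where
  "vopn M D b c ls X = (\<Sum>ns\<in>mode_lists M D (length ls). \<Sum>p\<in>parts_le D. \<Sum>q\<in>parts_le M.
     cst (ncoef ls ns * ecoef (- b / 2) p * ecoef (b / 2) q) * vterm c ns p q X)"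

lemma vopn_linear [simp]:
  "vopn M D b c ls (f + g) = vopn M D b c ls f + vopn M D b c ls g" "vopn M D b c ls (cst z * f) = cst z * vopn M D b c ls f"
  by (simp_all add: vopn_def sum.distrib distrib_left sum_distrib_left mult.left_commute)

lemma vopn_0 [simp]: "vopn M D b c ls 0 = 0"
  using vopn_linear(2)[of M D b c ls 0 0] by simp

lemma vopn_sum [simp]: "vopn M D b c ls (sum f I) = (\<Sum>x\<in>I. vopn M D b c ls (f x))"
  by (induction I rule: infinite_finite_induct) auto

lemma vopn_Cons:
  "vopn M D b c (l # ls) X = (\<Sum>j\<in>{1..M}. cst ((of_nat j - 1) gchoose (l - 1)) * xmon {#j#}) * vopn M D b c ls X
     + vopn M D b c ls (aplus D c l X)"
proof -
  define g where "g n = ((of_int (- n - 1) :: complex) gchoose (l - 1))" for n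
  have *: "vopn M D b c (l # ls) X = (\<Sum>n\<in>{- int M..int D}. cst (g n) *
     (if n < 0 then xmon {#nat (- n)#} * vopn M D b c ls X else vopn M D b c ls (alphac c (nat n) X)))"
    unfolding vopn_def list.size(4) add_Suc_right add_0_right sum_mode_lists_Suc
  proof (rule sum.cong[OF refl])
    fix n
    show "(\<Sum>ns\<in>mode_lists M D (length ls). \<Sum>p\<in>parts_le D. \<Sum>q\<in>parts_le M.
            cst (ncoef (l # ls) (n # ns) * ecoef (- b / 2) p * ecoef (b / 2) q) * vterm c (n # ns) p q X) =
      cst (g n) * (if n < 0
         then xmon {#nat (- n)#} * (\<Sum>ns\<in>mode_lists M D (length ls). \<Sum>p\<in>parts_le D. \<Sum>q\<in>parts_le M.
               cst (ncoef ls ns * ecoef (- b / 2) p * ecoef (b / 2) q) * vterm c ns p q X)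
         else (\<Sum>ns\<in>mode_lists M D (length ls). \<Sum>p\<in>parts_le D. \<Sum>q\<in>parts_le M.
               cst (ncoef ls ns * ecoef (- b / 2) p * ecoef (b / 2) q) * vterm c ns p q (alphac c (nat n) X)))"
      by (simp add: vterm_Cons sum_distrib_left ncoef_def g_def cst_simps mult.assoc mult.left_commute)
  qed
  also have "\<dots> = (\<Sum>n\<in>{- int M..-1}. cst (g n) * (xmon {#nat (- n)#} * vopn M D b c ls X))
      + (\<Sum>n\<in>{0..int D}. cst (g n) * vopn M D b c ls (alphac c (nat n) X))"
  proof -
    have "{- int M..int D} = {- int M..-1} \<union> {0..int D}" by auto
    then show ?thesis by (simp add: sum.union_disjoint)
  qed
  also have "(\<Sum>n\<in>{- int M..-1}. cst (g n) * (xmon {#nat (- n)#} * vopn M D b c ls X))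
      = (\<Sum>j\<in>{1..M}. cst ((of_nat j - 1) gchoose (l - 1)) * xmon {#j#}) * vopn M D b c ls X"
    unfolding sum_distrib_right
    by (rule sum.reindex_bij_witness[of _ "\<lambda>j. - int j" "\<lambda>n. nat (- n)"]) (auto simp: g_def mult.assoc of_nat_nat)
  also have "(\<Sum>n\<in>{0..int D}. cst (g n) * vopn M D b c ls (alphac c (nat n) X)) = vopn M D b c ls (aplus D c l X)"
    unfolding aplus_def vopn_sum vopn_linear
    by (rule sum.reindex_bij_witness[of _ int nat]) (auto simp: g_def of_nat_nat)
  finally show ?thesis .
qed

text \<open>Only the creation side is cut off: \<open>amin\<close> and \<open>hsum\<close> lose
  their terms of weight above \<open>M\<close>, while the annihilation sums are the same on both
  sides.\<close>

lemma agree_vopn: "agree (int M) (vopn M D b c ls X) (vopl D b c ls X)"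
proof (induction ls arbitrary: X)
  case Nil
  have "vopn M D b c [] X = (\<Sum>q\<in>parts_le M. cst (ecoef (b / 2) q) * xmon q) * (\<Sum>p\<in>parts_le D. cst (ecoef (- b / 2) p) * alpham c p X)"
    unfolding sum_product
    by (subst sum.swap) (simp add: vopn_def mode_lists_0 ncoef_def vterm_Nil cst_simps mult.assoc mult.left_commute)
  also have "(\<Sum>p\<in>parts_le D. cst (ecoef (- b / 2) p) * alpham c p X) = (\<Sum>p\<le>D. Ep b p X)"
    by (simp add: sum_parts_le Ep_eq_alpham[of b _ X c])
  finally have "vopn M D b c [] X = (\<Sum>q\<in>parts_le M. cst (ecoef (b / 2) q) * xmon q) * (\<Sum>p\<le>D. Ep b p X)" .
  moreover have "agree (int M) (\<Sum>q\<in>parts_le M. cst (ecoef (b / 2) q) * xmon q) (hsum b)"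
    unfolding agree_def by (auto simp: cf_xmon cf_hbin parts_le_def[symmetric] if_distrib[of "\<lambda>x. _ * x"] cong: if_cong)
      (auto simp: parts_le_def)
  ultimately show ?case
    by (simp add: agree_mult)
next
  case (Cons l ls)
  have "agree (int M) (\<Sum>j\<in>{1..M}. cst ((of_nat j - 1) gchoose (l - 1)) * xmon {#j#}) (amin l)"
    unfolding agree_def
  proof (intro allI impI)
    fix m assume m: "wt m \<le> int M"
    show "cf (\<Sum>j\<in>{1..M}. cst ((of_nat j - 1) gchoose (l - 1)) * xmon {#j#}) m = cf (amin l) m"
    proof (cases "0 \<notin># m \<and> size m = 1")
      case True
      then obtain j where j: "m = {#j#}" using size_1_singleton_mset by blast
      with True m show ?thesis
        by (simp add: cf_xmon amin_def if_distrib[of "\<lambda>x. _ * x"] cong: if_cong)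
    next
      case False
      then have "m \<noteq> {#j#}" if "j \<in> {1..M}" for j using that by auto
      then have "cf (\<Sum>j\<in>{1..M}. cst ((of_nat j - 1) gchoose (l - 1)) * xmon {#j#}) m = 0"
        by (simp add: cf_xmon)
      then show ?thesis using False by (simp only: amin_def cf_Mser if_False)
    qed
  qed
  then show ?case
    unfolding vopn_Cons vopl.simps by (intro agree_add agree_mult Cons.IH)
qed

lemma sum_list_filter_le:
  "x \<in> set xs \<Longrightarrow> x \<ge> 0 \<Longrightarrow> (x::int) \<le> sum_list (filter (\<lambda>n. 0 \<le> n) xs)"
proof (induction xs)
  case (Cons a xs)
  have "0 \<le> sum_list (filter (\<lambda>n. 0 \<le> n) xs)"
    by (rule sum_list_nonneg) auto
  with Cons show ?case by auto
qed simp

lemma sum_list_filter_ge: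
  "x \<in> set xs \<Longrightarrow> x < 0 \<Longrightarrow> sum_list (filter (\<lambda>n. n < 0) xs) \<le> (x::int)"
proof (induction xs)
  case (Cons a xs)
  have "sum_list (filter (\<lambda>n. n < 0) xs) \<le> 0"
    by (rule sum_list_nonpos) auto
  with Cons show ?case by auto
qed simp

lemma sum_list_filter_split:
  "sum_list (filter (\<lambda>n. 0 \<le> n) xs) + sum_list (filter (\<lambda>n. n < (0::int)) xs) = sum_list xs"
  by (induction xs) auto

lemma sum_list_map2_exponent:
  "length ns = length ls \<Longrightarrow> sum_list (map2 (\<lambda>n l. - n - int l) ns ls) = - sum_list ns - int (sum_list ls)"
proof (induction ns arbitrary: ls)
  case (Cons n ns)
  then show ?case by (cases ls) auto
qed simp

text \<open>Every summand is homogeneous, so the condition on the exponent of z is a condition on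
  the weight of \<open>nu\<close> alone. It can be imposed after summation, which justifies setting
  z = 1 and projecting to one weight.\<close>

lemma Ybas_eq:
  assumes mu: "0 \<notin># mu" "wt mu \<le> int D"
  shows "Ybas (b, lam) r (c, mu) (m, nu) =
    (if m = b + c \<and> of_int (wt nu) = of_int (wt lam + wt mu) - of_int (b * c) / 2 - r - 1
     then cf (vopl D (of_int b) (of_int c) (sorted_list_of_multiset lam) (xmon mu)) nu else 0)"
proof -
  define ls where "ls = sorted_list_of_multiset lam"
  \<comment> \<open>Creation operators of weight above that of \<open>nu\<close> cannot contribute
    to the coefficient at \<open>nu\<close>.\<close>
  define M where "M = nat (wt nu)"
  define I where "I = mode_lists M D (length ls) \<times> parts_le D \<times> parts_le M"
  define cond where "cond ns p q \<longleftrightarrow> length ns = length ls \<and> 0 \<notin># p \<and> 0 \<notin># q \<and>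
           of_int (sum_list (map2 (\<lambda>n l. - n - int l) ns ls) - int (sum_mset p) + int (sum_mset q))
             + of_int (b * c) / 2 = - r - 1" for ns p q
  define co where "co ns p q = ncoef ls ns * ecoef (- of_int b / 2) p * ecoef (of_int b / 2) q" for ns p q
  define g where "g = (\<lambda>(ns, p, q). if cond ns p q then vscale (co ns p q)
     (aprod (filter (\<lambda>n. n < 0) ns)
                 (aprod (map (\<lambda>n. - int n) (sorted_list_of_multiset q))
                   (eshift b
                     (aprod (filter (\<lambda>n. 0 \<le> n) ns)
                       (aprod (map int (sorted_list_of_multiset p)) (bas (c, mu)))))))
     else vzero)"
  let ?w = "of_int (wt nu) = of_int (wt lam + wt mu) - of_int (b * c) / 2 - r - 1"
  let ?t = "\<lambda>ns p q. vterm (of_int c) ns p q (xmon mu)"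
  have Y: "Ybas (b, lam) r (c, mu) (m, nu) = vsum g (m, nu)"
    unfolding Ybas_def g_def cond_def co_def ncoef_def ls_def by (simp add: Let_def)
  have g: "g (ns, p, q) (m, nu) = (if cond ns p q \<and> m = b + c then co ns p q * cf (?t ns p q) nu else 0)" for ns p q
  proof (cases "cond ns p q")
    case True
    then have "0 \<notin># q" by (simp add: cond_def)
    with True show ?thesis by (simp add: g_def vterm_vec vscale_def emb_apply)
  qed (simp add: g_def vzero_def)
  have hm: "hom (wt mu) (xmon mu)" using mu(1) by (rule hom_xmon)
  have deg: "length ns = length ls \<Longrightarrow> ns \<in> mode_lists M D (length ls) \<and> p \<in> parts_le D \<and> q \<in> parts_le M"
    and deg2: "wt nu = wt mu - wt p + wt q - sum_list ns"
    if nz: "cf (?t ns p q) nu \<noteq> 0" and q: "0 \<notin># q" and p: "0 \<notin># p" for ns p q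
  proof -
    define s1 where "s1 = sum_list (filter (\<lambda>n. 0 \<le> n) ns)"
    define s2 where "s2 = sum_list (filter (\<lambda>n. n < 0) ns)"
    from hom_vterm[OF hm q, of ns "of_int c" p] obtain d2 where d2:
      "hom (d2 + wt q - s2) (?t ns p q)" "d2 = wt mu - wt p - s1" "d2 < 0 \<longrightarrow> ?t ns p q = 0"
      unfolding s1_def s2_def by blast
    from d2(3) nz have d0: "d2 \<ge> 0" by (metis cf_ring(1) not_less)
    from d2(1) nz have w: "wt nu = d2 + wt q - s2" by (auto simp: hom_def)
    show "wt nu = wt mu - wt p + wt q - sum_list ns"
      using w d2(2) sum_list_filter_split[of ns] by (simp add: s1_def s2_def)
    have s: "s1 \<ge> 0" "s2 \<le> 0"
      unfolding s1_def s2_def by (auto intro: sum_list_nonneg sum_list_nonpos)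
    assume "length ns = length ls"
    moreover have "- int M \<le> n \<and> n \<le> int D" if n: "n \<in> set ns" for n
    proof (cases "n < 0")
      case True
      have "s2 \<le> n" "int M = wt nu"
        using sum_list_filter_ge[OF n True] by (simp_all add: s2_def M_def)
      then show ?thesis using True w d0 wt_nonneg[of q] by linarith
    next
      case False
      have "n \<le> s1"
        using sum_list_filter_le[OF n] False by (simp add: s1_def)
      then show ?thesis using False d2(2) d0 wt_nonneg[of p] mu(2) by linarith
    qed
    moreover have "wt p \<le> int D" "wt q \<le> int M"
      using w d0 s d2(2) mu(2) wt_nonneg[of nu] unfolding M_def by simp_all
    ultimately show "ns \<in> mode_lists M D (length ls) \<and> p \<in> parts_le D \<and> q \<in> parts_le M"
      using p q by (auto simp: mode_lists_def parts_le_def)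
  qed
  have "vsum g (m, nu) = (\<Sum>x\<in>I. g x (m, nu))"
  proof (rule vsum_eq)
    show "finite I" by (simp add: I_def)
    fix x assume x: "x \<notin> I"
    obtain ns p q where xx: "x = (ns, p, q)" by (cases x)
    show "g x (m, nu) = 0"
    proof (rule ccontr)
      assume "g x (m, nu) \<noteq> 0"
      then have "cond ns p q" "cf (?t ns p q) nu \<noteq> 0" unfolding xx g by (auto split: if_splits)
      with deg[of ns p q] x show False by (auto simp: xx I_def cond_def)
    qed
  qed
  also have "\<dots> = (\<Sum>x\<in>I. if m = b + c \<and> ?w then (case x of (ns, p, q) \<Rightarrow> co ns p q * cf (?t ns p q) nu) else 0)"
  proof (rule sum.cong[OF refl])
    fix x assume x: "x \<in> I"
    obtain ns p q where xx: "x = (ns, p, q)" by (cases x)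
    have len: "length ns = length ls" and p: "0 \<notin># p" and q: "0 \<notin># q"
      using x by (auto simp: xx I_def mode_lists_def parts_le_def)
    have "cond ns p q \<longleftrightarrow> ?w" if nz: "cf (?t ns p q) nu \<noteq> 0"
    proof -
      have ls: "int (sum_list ls) = wt lam"
        by (metis ls_def mset_sorted_list_of_multiset sum_mset_sum_list wt_sum_mset)
      have "cond ns p q \<longleftrightarrow> of_int (- sum_list ns - wt lam - wt p + wt q) + of_int (b * c) / 2 = - r - 1"
        unfolding cond_def using len p q by (simp add: sum_list_map2_exponent ls wt_def)
      also have "- sum_list ns - wt lam - wt p + wt q = wt nu - wt lam - wt mu"
        using deg2[OF nz q p] by simp
      finally show ?thesis by (auto simp: algebra_simps)
    qed
    then show "g x (m, nu) = (if m = b + c \<and> ?w then (case x of (ns, p, q) \<Rightarrow> co ns p q * cf (?t ns p q) nu) else 0)"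
      unfolding xx g by auto
  qed
  also have "\<dots> = (if m = b + c \<and> ?w then cf (vopn M D (of_int b) (of_int c) ls (xmon mu)) nu else 0)"
  proof (cases "m = b + c \<and> ?w")
    case True
    then have "(\<Sum>x\<in>I. case x of (ns, p, q) \<Rightarrow> co ns p q * cf (?t ns p q) nu) = cf (vopn M D (of_int b) (of_int c) ls (xmon mu)) nu"
      by (simp add: vopn_def I_def sum.cartesian_product co_def mult.assoc split_def)
    then show ?thesis using True by (simp only: if_True simp_thms)
  qed (simp only: if_False sum.neutral_const)
  also have "\<dots> = (if m = b + c \<and> ?w then cf (vopl D (of_int b) (of_int c) ls (xmon mu)) nu else 0)"
    using agree_vopn[of M D "of_int b" "of_int c" ls "xmon mu"] by (simp add: agree_def M_def)
  finally show ?thesis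
    unfolding Y ls_def .
qed

lemma emb_nonzero: "emb c f k \<noteq> 0 \<Longrightarrow> fst k = c \<and> cf f (snd k) \<noteq> 0"
  by (cases k) (auto simp: emb_apply split: if_splits)

lemma xmon_expansion:
  assumes "bd (int D) X"
  shows "X = (\<Sum>m\<in>parts_le D. cst (cf X m) * xmon m)"
proof (rule mser_eqI)
  fix m
  show "cf X m = cf (\<Sum>m\<in>parts_le D. cst (cf X m) * xmon m) m"
    using assms by (auto simp: cf_xmon bd_def parts_le_def[symmetric] if_distrib[of "\<lambda>x. _ * x"] cong: if_cong)
      (auto simp: parts_le_def)
qed

text \<open>\<open>r\<close> is rational because the exponent \<open>b * c / 2\<close> is
  half-integral for odd charges, as happens in the definition of \<open>phi\<close>.\<close>

lemma mode_emb:
  assumes u: "hom d u" "d \<le> int D" and X: "hom e X" "e \<le> int D"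
    and w: "of_int w = of_int (d + e) - of_int (b * c) / 2 - r - 1"
  shows "mode (emb b u) r (emb c X) = emb (b + c) (wt_part w (vop D (of_int b) (of_int c) u X))"
proof
  fix k :: key
  obtain m nu where k: "k = (m, nu)" by (cases k)
  let ?Y = "\<lambda>lam mu. cf (vopl D (of_int b) (of_int c) (sorted_list_of_multiset lam) (xmon mu)) nu"
  let ?I = "Pair b ` parts_le D \<times> Pair c ` parts_le D"
  have supp: "lam \<in> parts_le D \<and> wt lam = d" if "cf u lam \<noteq> 0" for lam
    using that u by (auto simp: hom_def parts_le_def)
  have supp': "mu \<in> parts_le D \<and> wt mu = e" if "cf X mu \<noteq> 0" for mu
    using that X by (auto simp: hom_def parts_le_def)
  have "mode (emb b u) r (emb c X) k
     = (\<Sum>(kv, kw)\<in>?I. emb b u kv * emb c X kw * Ybas kv r kw k)"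
    unfolding mode_def
  proof (subst vsum_eq[of ?I])
    fix x :: "key \<times> key" assume x: "x \<notin> ?I"
    show "(case x of (kv, kw) \<Rightarrow> vscale (emb b u kv * emb c X kw) (Ybas kv r kw)) k = 0"
    proof (rule ccontr)
      assume *: "\<not> ?thesis"
      obtain kv kw where xx: "x = (kv, kw)" by (cases x)
      from * have "emb b u kv \<noteq> 0" "emb c X kw \<noteq> 0" by (auto simp: xx vscale_def)
      then have "kv \<in> Pair b ` parts_le D" "kw \<in> Pair c ` parts_le D"
        by (metis emb_nonzero supp supp' imageI prod.collapse)+
      with x show False by (simp add: xx)
    qed
  qed (auto simp: vscale_def split_def)
  also have "\<dots> = (\<Sum>lam\<in>parts_le D. \<Sum>mu\<in>parts_le D. cf u lam * cf X mu * Ybas (b, lam) r (c, mu) k)"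
    by (simp add: sum.cartesian_product[symmetric] sum.reindex inj_on_def emb_apply)
  also have "\<dots> = (\<Sum>lam\<in>parts_le D. \<Sum>mu\<in>parts_le D. if m = b + c \<and> wt nu = w then cf u lam * cf X mu * ?Y lam mu else 0)"
  proof (intro sum.cong refl)
    fix lam mu assume mu: "mu \<in> parts_le D"
    show "cf u lam * cf X mu * Ybas (b, lam) r (c, mu) k = (if m = b + c \<and> wt nu = w then cf u lam * cf X mu * ?Y lam mu else 0)"
    proof (cases "cf u lam = 0 \<or> cf X mu = 0")
      case False
      then have eqs: "wt lam = d" "wt mu = e" using supp supp' by auto
      have "of_int (wt nu) = of_int (wt lam + wt mu) - of_int (b * c) / 2 - r - 1 \<longleftrightarrow> wt nu = w"
        unfolding eqs w[symmetric] of_int_eq_iff ..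
      then show ?thesis
        unfolding k using mu by (subst Ybas_eq[of mu D]) (auto simp: parts_le_def)
    qed auto
  qed
  also have "\<dots> = (if m = b + c \<and> wt nu = w then \<Sum>lam\<in>parts_le D. \<Sum>mu\<in>parts_le D. cf u lam * (cf X mu * ?Y lam mu) else 0)"
    by (cases "m = b + c \<and> wt nu = w") (simp_all only: if_True if_False sum.neutral_const mult.assoc simp_thms)
  also have "(\<Sum>lam\<in>parts_le D. \<Sum>mu\<in>parts_le D. cf u lam * (cf X mu * ?Y lam mu)) = cf (vop D (of_int b) (of_int c) u X) nu"
    unfolding vop_def
    by (subst xmon_expansion[OF bd_mono[OF hom_bd[OF X(1)] X(2)]]) (simp add: sum_distrib_left)
  finally show "mode (emb b u) r (emb c X) k = emb (b + c) (wt_part w (vop D (of_int b) (of_int c) u X)) k"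
    by (auto simp: k emb_apply cf_wt_part)
qed

section \<open>The modes of the generator of W\<close>

lemma binc_1: "binc 1 j = (if j = 0 then 1 else if j = 1 then -1 else 0)"
proof -
  have "(1 :: complex) gchoose j = of_nat (1 choose j)"
    by (simp add: binomial_gbinomial)
  moreover have "1 choose j = 0" if "j > 1" using that by (simp add: binomial_eq_0)
  ultimately show ?thesis by (auto simp: binc_def)
qed

lemma sum_binc_1: "(\<Sum>j\<le>p. cst (binc 1 j) * F j) = F 0 - (if p = 0 then 0 else F 1)"
proof -
  have "(\<Sum>j\<le>p. cst (binc 1 j) * F j) = (\<Sum>j\<in>(if p = 0 then {0} else {0,1}). cst (binc 1 j) * F j)"
    by (rule sum.mono_neutral_right) (auto simp: binc_1)
  then show ?thesis by (auto simp: binc_1 cst_simps)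
qed

text \<open>Since (alpha, varpi) = 1, the series (1 - t)^1 stops after two terms: this is the
  substitution \<open>h_k -> h_k - z^-1 h_{k-1}\<close>.\<close>

lemma Ep2_h1: "Ep 2 p (h 1 k * f) = h 1 k * Ep 2 p f - (if p = 0 then 0 else h 1 (k - 1) * Ep 2 (p - 1) f)"
  by (simp add: Ep_h sum_binc_1)

lemma Ep1_h2: "Ep 1 p (h 2 k * f) = h 2 k * Ep 1 p f - (if p = 0 then 0 else h 2 (k - 1) * Ep 1 (p - 1) f)"
  by (simp add: Ep_h sum_binc_1)

lemma alpha_hbin: "j \<noteq> 0 \<Longrightarrow> alpha j (hbin a e k) = cst a * hbin a (e + of_nat j) k"
proof (rule mser_eqI)
  fix m assume j: "j \<noteq> 0"
  have "of_nat (2 * j * (count m j + 1)) * ecoef (a / 2) (add_mset j m)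
        = 2 * (of_nat (j * (count m j + 1)) * ecoef (a / 2) (add_mset j m))"
    by (simp add: algebra_simps)
  also have "\<dots> = a * ecoef (a / 2) m"
    unfolding ecoef_add_mset[OF j] by simp
  finally have *: "of_nat (2 * j * (count m j + 1)) * ecoef (a / 2) (add_mset j m) = a * ecoef (a / 2) m" .
  show "cf (alpha j (hbin a e k)) m = cf (cst a * hbin a (e + of_nat j) k) m"
  proof (cases "0 \<in># m")
    case False
    have "cf (alpha j (hbin a e k)) m = ((e + (of_nat j + of_int (wt m))) gchoose k) *
        (of_nat (2 * j * (count m j + 1)) * ecoef (a / 2) (add_mset j m))"
      using j False by (simp only: cf_alpha cf_hbin wt_simps) (simp add: mult.left_commute)
    then show ?thesis
      unfolding * using False by (simp add: cf_hbin add.assoc mult.left_commute)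
  qed (simp add: cf_alpha cf_hbin)
qed

lemma Ep2_hbin1: "Ep 2 p (hbin 1 e k * f) = hbin 1 e k * Ep 2 p f - (if p = 0 then 0 else hbin 1 (e + 1) k * Ep 2 (p - 1) f)"
  using Ep_mult_family[of "\<lambda>j. hbin 1 (e + of_nat j) k" 1 2 p f] by (simp add: alpha_hbin add.assoc sum_binc_1)

definition emodeb :: "nat \<Rightarrow> int \<Rightarrow> mser \<Rightarrow> mser" where
  "emodeb B N F = (\<Sum>r\<le>B. h 2 (N + int r) * Ep 2 r F)"

text \<open>
  Up to the shift in \<open>ealpha_mode\<close>, these are the modes of \<open>e\<^sup>\<alpha>\<close>. Every
  coefficient of \<open>emodeb B N F\<close> is stationary in \<open>B\<close>.
\<close>
definition emode :: "int \<Rightarrow> mser \<Rightarrow> mser" where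
  "emode N F = Mser (\<lambda>m. cf (emodeb (nat (wt m - N)) N F) m)"

lemma cf_h_mult_low: "wt m < q \<Longrightarrow> cf (h a q * G) m = 0"
  unfolding cf_times by (rule sum.neutral) (use wt_mono in \<open>fastforce simp: cf_h\<close>)

lemma emodeb_stable:
  assumes "wt m \<le> N + int B" "B \<le> B'"
  shows "cf (emodeb B' N F) m = cf (emodeb B N F) m"
  unfolding emodeb_def cf_sum
  by (rule sum.mono_neutral_right) (use assms in \<open>auto intro!: cf_h_mult_low\<close>)

lemma cf_emode:
  assumes "wt m \<le> N + int B"
  shows "cf (emode N F) m = cf (emodeb B N F) m"
proof -
  have "cf (emode N F) m = cf (emodeb (nat (wt m - N)) N F) m"
    by (simp add: emode_def)
  also have "\<dots> = cf (emodeb B N F) m"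
  proof (cases "nat (wt m - N) \<le> B")
    case True
    then show ?thesis by (intro emodeb_stable[symmetric]) auto
  next
    case False
    then show ?thesis using assms by (intro emodeb_stable) auto
  qed
  finally show ?thesis .
qed

lemma agree_emode: "M \<le> N + int B \<Longrightarrow> agree M (emode N F) (emodeb B N F)"
  by (auto simp: agree_def intro!: cf_emode)

lemma eq_by_agree: "(\<And>M. agree (int M) f g) \<Longrightarrow> f = g"
  by (rule mser_eqI) (metis agree_def nonneg_int_cases order_refl wt_nonneg)

lemma agree_sym: "agree M f g \<Longrightarrow> agree M g f"
  by (auto simp: agree_def)

lemma agree_diff: "agree M f g \<Longrightarrow> agree M f' g' \<Longrightarrow> agree M (f - f') (g - g')"
  by (auto simp: agree_def)

lemma agree_sum: "(\<And>x. x \<in> I \<Longrightarrow> agree M (f x) (g x)) \<Longrightarrow> agree M (sum f I) (sum g I)"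
  by (auto simp: agree_def)

lemma agree_alpha: "agree M f g \<Longrightarrow> agree (M - int j) (alpha j f) (alpha j g)"
  by (auto simp: agree_def cf_alpha)

lemma agree_Ep: "agree M f g \<Longrightarrow> agree (M - int p) (Ep a p f) (Ep a p g)"
proof (induction p rule: less_induct)
  case (less p)
  show ?case
  proof (cases "p = 0")
    case False
    have "agree (M - int p) (alpha n (Ep a (p - n) f)) (alpha n (Ep a (p - n) g))" if "n \<in> {1..p}" for n
      using agree_alpha[OF less.IH[of "p - n"], of n] less.prems that by (simp add: of_nat_diff)
    then have "agree (M - int p) (cst (- a / (2 * of_nat p)) * (\<Sum>n\<in>{1..p}. alpha n (Ep a (p - n) f)))
        (cst (- a / (2 * of_nat p)) * (\<Sum>n\<in>{1..p}. alpha n (Ep a (p - n) g)))"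
      by (intro agree_mult agree_refl agree_sum)
    then show ?thesis
      using False by (subst (1 2) Ep.simps) (simp only: if_False)
  qed (use less in simp)
qed

lemma emodeb_linear [simp]:
  "emodeb B N (f + g) = emodeb B N f + emodeb B N g" "emodeb B N (cst z * f) = cst z * emodeb B N f" "emodeb B N 0 = 0"
  by (simp_all add: emodeb_def distrib_left sum.distrib sum_distrib_left mult.left_commute)

lemma emode_linear [simp]:
  "emode N (f + g) = emode N f + emode N g" "emode N (cst z * f) = cst z * emode N f" "emode N 0 = 0"
  by (auto intro!: mser_eqI simp: emode_def)

lemma emode_sum [simp]: "emode N (sum f I) = (\<Sum>x\<in>I. emode N (f x))"
  by (induction I rule: infinite_finite_induct) auto

lemma emodeb_Suc_family:
  assumes "\<And>p. Ep 2 p (G * F) = G * Ep 2 p F - (if p = 0 then 0 else G' * Ep 2 (p - 1) F)"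
  shows "emodeb (Suc B) N (G * F) = G * emodeb (Suc B) N F - G' * emodeb B (N + 1) F"
proof -
  have "emodeb (Suc B) N (G * F) = G * emodeb (Suc B) N F - G' * (\<Sum>r\<le>Suc B. if r = 0 then 0 else h 2 (N + int r) * Ep 2 (r - 1) F)"
    unfolding emodeb_def assms
    by (simp add: right_diff_distrib sum_subtractf sum_distrib_left mult.left_commute if_distrib[of "\<lambda>x. _ * x"]
        del: sum.atMost_Suc cong: if_cong)
  also have "(\<Sum>r\<le>Suc B. if r = 0 then 0 else h 2 (N + int r) * Ep 2 (r - 1) F) = emodeb B (N + 1) F"
    by (subst sum.atMost_Suc_shift) (simp add: emodeb_def add.assoc)
  finally show ?thesis .
qed

lemma emode_family:
  assumes "\<And>p. Ep 2 p (G * F) = G * Ep 2 p F - (if p = 0 then 0 else G' * Ep 2 (p - 1) F)"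
  shows "emode N (G * F) = G * emode N F - G' * emode (N + 1) F"
proof (rule eq_by_agree)
  fix M
  define B where "B = nat (int M - N)"
  have "agree (int M) (emode N (G * F)) (emodeb (Suc B) N (G * F))"
    by (rule agree_emode) (simp add: B_def)
  moreover have "agree (int M) (G * emode N F - G' * emode (N + 1) F) (emodeb (Suc B) N (G * F))"
    unfolding emodeb_Suc_family[OF assms]
    by (intro agree_diff agree_mult agree_refl agree_emode) (simp_all add: B_def)
  ultimately show "agree (int M) (emode N (G * F)) (G * emode N F - G' * emode (N + 1) F)"
    by (blast intro: agree_trans agree_sym)
qed

lemma emode_h1: "emode N (h 1 k * F) = h 1 k * emode N F - h 1 (k - 1) * emode (N + 1) F"
  by (rule emode_family) (rule Ep2_h1)

lemma emode_hbin1: "emode N (hbin 1 e k * F) = hbin 1 e k * emode N F - hbin 1 (e + 1) k * emode (N + 1) F"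
  by (rule emode_family) (rule Ep2_hbin1)

text \<open>The same two-term contraction with the roles exchanged: it moves the annihilation half
  of e^varpi past a mode of e^alpha.\<close>

lemma Ep1_emode: "Ep 1 p (emode M F) = emode M (Ep 1 p F) - (if p = 0 then 0 else emode (M - 1) (Ep 1 (p - 1) F))"
proof (rule eq_by_agree)
  fix L
  define B where "B = nat (int L + int p + 1 - M)"
  have B: "int L + int p + 1 \<le> M + int B" by (simp add: B_def)
  have emodeb: "Ep 1 p (emodeb B M F) = emodeb B M (Ep 1 p F) - (if p = 0 then 0 else emodeb B (M - 1) (Ep 1 (p - 1) F))"
    by (cases "p = 0") (simp_all add: emodeb_def Ep1_h2 Ep_commute[of 1] sum_subtractf diff_add_eq add_diff_eq)
  have "agree (int L + int p) (emode M F) (emodeb B M F)"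
    by (rule agree_emode) (use B in simp)
  from agree_Ep[OF this, of p 1] have "agree (int L) (Ep 1 p (emode M F)) (Ep 1 p (emodeb B M F))" by simp
  moreover have "agree (int L) (emode M (Ep 1 p F) - (if p = 0 then 0 else emode (M - 1) (Ep 1 (p - 1) F))) (Ep 1 p (emodeb B M F))"
    unfolding emodeb by (intro agree_diff) (use B in \<open>auto intro!: agree_emode\<close>)
  ultimately show "agree (int L) (Ep 1 p (emode M F)) (emode M (Ep 1 p F) - (if p = 0 then 0 else emode (M - 1) (Ep 1 (p - 1) F)))"
    by (blast intro: agree_trans agree_sym)
qed

lemma hom_emodeb: "hom d F \<Longrightarrow> hom (d + N) (emodeb B N F)"
  unfolding emodeb_def
proof (intro hom_sum)
  fix r assume F: "hom d F"
  show "hom (d + N) (h 2 (N + int r) * Ep 2 r F)"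
    using hom_mult[OF hom_h[of "N + int r" 2] hom_Ep[OF F, of r 2]] by (simp add: algebra_simps)
qed

lemma emode_hom_eq:
  assumes F: "hom d F" "d \<le> int B"
  shows "emode N F = emodeb B N F"
proof (rule mser_eqI)
  fix m
  have "Ep 2 r F = 0" if "B < r" for r
    using Ep_high[OF F(1), of r] F(2) that by simp
  then have "emodeb (B + C) N F = emodeb B N F" for C
    unfolding emodeb_def by (intro sum.mono_neutral_right) auto
  moreover have "cf (emode N F) m = cf (emodeb (B + nat (wt m - N)) N F) m"
    by (rule cf_emode) simp
  ultimately show "cf (emode N F) m = cf (emodeb B N F) m" by simp
qed

lemma hom_emode: "hom d F \<Longrightarrow> hom (d + N) (emode N F)"
  using hom_emodeb[of d F N "nat d"] emode_hom_eq[of d F "nat d" N] by simp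

lemma agree_emode_0: "M < N \<Longrightarrow> agree M (emode N F) 0"
  using agree_emode[of M N 0 F] by (auto simp: agree_def emodeb_def cf_h_mult_low)

text \<open>
  Polynomials in the \<open>h 1 k\<close> of weight \<open>w\<close> and degree at most \<open>n\<close>;
  lower degrees are included since \<open>h 1 0 = 1\<close>.
\<close>
inductive hdeg :: "nat \<Rightarrow> int \<Rightarrow> mser \<Rightarrow> bool" where
  hdeg_cst: "hdeg 0 0 (cst z)"
| hdeg_h: "hdeg n w f \<Longrightarrow> hdeg (Suc n) (w + int k) (h 1 (int k) * f)"
| hdeg_add: "hdeg n w f \<Longrightarrow> hdeg n w g \<Longrightarrow> hdeg n w (f + g)"
| hdeg_0: "hdeg n w 0"

lemma hdeg_hom: "hdeg n w f \<Longrightarrow> hom w f"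
proof (induction rule: hdeg.induct)
  case (hdeg_h n w f k)
  then show ?case using hom_mult[OF hom_h[of "int k" 1]] by (simp add: add.commute)
qed auto

lemma hdeg_smult: "hdeg n w f \<Longrightarrow> hdeg n w (cst z * f)"
proof (induction rule: hdeg.induct)
  case (hdeg_cst z')
  have "cst z * cst z' = cst (z * z')" by (simp add: cst_simps)
  then show ?case by (simp add: hdeg.hdeg_cst)
next
  case (hdeg_h n w f k)
  then show ?case using hdeg.hdeg_h[of n w "cst z * f" k] by (simp add: mult.left_commute)
qed (auto simp: distrib_left intro: hdeg.intros)

lemma hdeg_sum: "(\<And>x. x \<in> I \<Longrightarrow> hdeg n w (f x)) \<Longrightarrow> hdeg n w (sum f I)"
  by (induction I rule: infinite_finite_induct) (auto intro: hdeg.intros)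

lemma hdeg_h_int: "hdeg n w f \<Longrightarrow> hdeg (Suc n) (w + k) (h 1 k * f)"
  using hdeg_h[of n w f "nat k"] by (cases "k < 0") (auto intro: hdeg_0)

lemma hdeg_alpha: "hdeg n w f \<Longrightarrow> j \<noteq> 0 \<Longrightarrow> hdeg n (w - int j) (alpha j f)"
proof (induction rule: hdeg.induct)
  case (hdeg_h n w f k)
  have "hdeg (Suc n) (w + int k - int j) (h 1 (int k - int j) * f)"
    using hdeg_h_int[OF hdeg_h(1), of "int k - int j"] by (simp add: add_diff_eq)
  moreover have "hdeg (Suc n) (w + int k - int j) (h 1 (int k) * alpha j f)"
    using hdeg_h_int[OF hdeg_h.IH[OF hdeg_h.prems], of "int k"] by (simp add: algebra_simps)
  ultimately show ?case
    using hdeg_h.prems by (simp add: alpha_mult alpha_h hdeg_add)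
qed (auto intro: hdeg.intros)

lemma hdeg_Ep: "hdeg n w f \<Longrightarrow> hdeg n (w - int p) (Ep a p f)"
proof (induction p rule: less_induct)
  case (less p)
  show ?case
  proof (cases "p = 0")
    case False
    have "hdeg n (w - int p) (alpha k (Ep a (p - k) f))" if "k \<in> {1..p}" for k
      using hdeg_alpha[OF less.IH[of "p - k"], of k] less.prems that by (simp add: of_nat_diff)
    then have "hdeg n (w - int p) (cst (- a / (2 * of_nat p)) * (\<Sum>k\<in>{1..p}. alpha k (Ep a (p - k) f)))"
      by (intro hdeg_smult hdeg_sum)
    then show ?thesis
      using False by (subst Ep.simps) (simp only: if_False)
  qed (use less in simp)
qed

text \<open>Each of the \<open>n\<close> factors supplies at most one power of z^-1.\<close>

lemma hdeg_Ep2_vanish: "hdeg n w f \<Longrightarrow> n < p \<Longrightarrow> Ep 2 p f = 0"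
  by (induction arbitrary: p rule: hdeg.induct) (auto simp: Ep_const Ep2_h1)

lemma vop_one: "bd (int D) X \<Longrightarrow> vop D 0 c (cst z) X = cst z * X"
proof -
  assume X: "bd (int D) X"
  have R0: "Ep 0 p X = (if p = 0 then X else 0)" for p
    by (subst Ep.simps) auto
  have e0: "ecoef 0 m = (if m = {#} then 1 else 0)" if "0 \<notin># m" for m
  proof (cases "m = {#}")
    case False
    then obtain n where n: "n \<in># m" by blast
    have "of_nat (n * count m n) * ecoef 0 m = 0"
      using ecoef_remove[OF that n, of 0] by simp
    moreover have "n \<noteq> 0" using n that by metis
    then have "n * count m n \<noteq> 0" using n by simp
    ultimately show ?thesis using False by (metis mult_eq_0_iff of_nat_eq_0_iff)
  qed simp
  have "hsum 0 = 1"
    by (intro mser_eqI) (auto simp: cf_hbin cf_one e0)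
  then have "vopl D 0 c [] X = X"
    by (simp add: R0)
  moreover have "vop D 0 c (cst z) X = (\<Sum>m\<in>{{#}}. cst (cf (cst z) m) * vopl D 0 c (sorted_list_of_multiset m) X)"
  proof -
    have "{#} \<in> parts_le D" by (simp add: parts_le_def)
    then show ?thesis
      unfolding vop_def by (intro sum.mono_neutral_right) (auto simp: cf_cst)
  qed
  ultimately show ?thesis by (simp add: cf_cst)
qed

text \<open>For one factor \<open>h 1 k\<close>, passing \<open>hbin\<close> shifts the index of the
  mode and the exponent, and passing \<open>Ep 1 p\<close> shifts the index and \<open>p\<close>.
  After reindexing \<open>p\<close> the two-term expressions agree up to sign, so each factor costs
  one sign and one index shift. In fields this turns (z_1 - z_2)^b into (z_2 - z_1)^b.\<close>

lemma emode_vop_commute: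
  assumes "hdeg b dv v" "hom d X" "d < int D" "d + N + int b \<le> int D" "dv \<le> int D"
  shows "emode N (vop D (of_nat b) c v X) = cst ((-1) ^ b) * vop D (of_nat b) (c + 2) v (emode (N + int b) X)"
  using assms
proof (induction arbitrary: N d X rule: hdeg.induct)
  case (hdeg_cst z)
  have "bd (int D) X" "bd (int D) (emode N X)"
    using hdeg_cst bd_mono[OF hom_bd[OF hdeg_cst(1)]] bd_mono[OF hom_bd[OF hom_emode[OF hdeg_cst(1), of N]]] by auto
  then show ?case by (simp add: vop_one)
next
  case (hdeg_h n w f k)
  note X = hdeg_h.prems(1)
  define y where "y p = vop D (of_nat n) c f (Ep 1 p X)" for p
  define z where "z M p = vop D (of_nat n) (c + 2) f (emode M (Ep 1 p X))" for M p
  define e where "e p = c / 2 - of_nat p" for p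
  define s where "s = ((-1) ^ n :: complex)"
  have w0: "w \<le> int D" using hdeg_h.prems(4) by simp
  have bdf: "bd w f" using hdeg_hom[OF hdeg_h.hyps] by (rule hom_bd)
  have bX: "bd (int D) X" "bd (int D) (emode (N + int (Suc n)) X)"
    using hdeg_h.prems bd_mono[OF hom_bd[OF X], of "int D"]
      bd_mono[OF hom_bd[OF hom_emode[OF X, of "N + int (Suc n)"]], of "int D"] by auto
  have IH: "emode M (y p) = cst s * z (M + int n) p" if "M \<le> N + 1" for M p
    unfolding y_def z_def s_def
    by (rule hdeg_h.IH[OF hom_Ep[OF X]]) (use hdeg_h.prems that w0 in simp_all)
  have "vop D (of_nat (Suc n)) c (h 1 (int k) * f) X = (\<Sum>p\<le>D. hbin 1 (e p) k * y p)"
    using vop_h[OF bdf _ bX(1), of k 1 "of_nat n" c] hdeg_h.prems(4) by (simp add: y_def e_def add.commute)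
  then have L: "emode N (vop D (of_nat (Suc n)) c (h 1 (int k) * f) X)
      = (\<Sum>p\<le>D. hbin 1 (e p) k * (cst s * z (N + int n) p) - hbin 1 (e p + 1) k * (cst s * z (N + 1 + int n) p))"
    by (simp add: emode_hbin1 IH)
  \<comment> \<open>The strict bound \<open>d < D\<close> is used here: the top summand vanishes, so
    moving \<open>p\<close> by one leaves no boundary term.\<close>
  have z0: "z (N + int n) D = 0"
    using Ep_high[OF X hdeg_h.prems(2)] by (simp add: z_def)
  have "vop D (of_nat (Suc n)) (c + 2) (h 1 (int k) * f) (emode (N + int (Suc n)) X)
     = (\<Sum>p\<le>D. hbin 1 (e p + 1) k * vop D (of_nat n) (c + 2) f (Ep 1 p (emode (N + int (Suc n)) X)))"
    using vop_h[OF bdf _ bX(2), of k 1 "of_nat n" "c + 2"] hdeg_h.prems(4)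
    by (simp add: e_def add.commute add_divide_distrib algebra_simps)
  also have "\<dots> = (\<Sum>p\<le>D. hbin 1 (e p + 1) k * z (N + int (Suc n)) p)
     - (\<Sum>p\<le>D. if p = 0 then 0 else hbin 1 (e p + 1) k * z (N + int n) (p - 1))"
    unfolding sum_subtractf[symmetric]
  proof (rule sum.cong[OF refl])
    fix p
    have "vop D (of_nat n) (c + 2) f (amin - B) = vop D (of_nat n) (c + 2) f amin - vop D (of_nat n) (c + 2) f B" for amin B
      using vop_linear(1)[of D "of_nat n" "c + 2" f "amin - B" B] by simp
    then show "hbin 1 (e p + 1) k * vop D (of_nat n) (c + 2) f (Ep 1 p (emode (N + int (Suc n)) X)) =
      hbin 1 (e p + 1) k * z (N + int (Suc n)) p - (if p = 0 then 0 else hbin 1 (e p + 1) k * z (N + int n) (p - 1))"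
      by (simp add: Ep1_emode z_def right_diff_distrib)
  qed
  also have "(\<Sum>p\<le>D. if p = 0 then 0 else hbin 1 (e p + 1) k * z (N + int n) (p - 1)) = (\<Sum>p\<le>D. hbin 1 (e p) k * z (N + int n) p)"
  proof (cases D)
    case 0
    then show ?thesis using z0 by simp
  next
    case (Suc D')
    have "e (Suc p) + 1 = e p" for p by (simp add: e_def)
    then have "(\<Sum>p\<le>D. if p = 0 then 0 else hbin 1 (e p + 1) k * z (N + int n) (p - 1)) = (\<Sum>p\<le>D'. hbin 1 (e p) k * z (N + int n) p)"
      unfolding Suc by (subst sum.atMost_Suc_shift) simp
    also have "\<dots> = (\<Sum>p\<le>D. hbin 1 (e p) k * z (N + int n) p)"
      using z0 by (simp add: Suc)
    finally show ?thesis .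
  qed
  finally have "vop D (of_nat (Suc n)) (c + 2) (h 1 (int k) * f) (emode (N + int (Suc n)) X)
    = (\<Sum>p\<le>D. hbin 1 (e p + 1) k * z (N + int (Suc n)) p) - (\<Sum>p\<le>D. hbin 1 (e p) k * z (N + int n) p)" .
  then show ?case
    unfolding L by (simp add: s_def[symmetric] cst_simps sum_subtractf right_diff_distrib sum_distrib_left
        sum_negf mult.left_commute add.commute add.left_commute)
next
  case (hdeg_add n w f g)
  then show ?case by (simp add: distrib_left)
qed simp

text \<open>\<open>Ep 2 r f\<close> vanishes for \<open>r > n\<close> and \<open>h 2 (M + r)\<close>
  for \<open>r < - M\<close>; when \<open>M < - n\<close> these cases exhaust all
  \<open>r\<close>.\<close>

lemma hdeg_emode_low:
  assumes "hdeg n w f" "M < - int n"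
  shows "emode M f = 0"
proof -
  have "h 2 (M + int r) * Ep 2 r f = 0" for r
    using hdeg_Ep2_vanish[OF assms(1), of r] assms(2) by (cases "n < r") auto
  then have "emodeb B M f = 0" for B
    unfolding emodeb_def by simp
  then show ?thesis by (intro mser_eqI) (simp add: emode_def)
qed

lemma hbin_Pascal: "hbin a (e + 1) k = hbin a e k + (if k = 0 then 0 else hbin a e (k - 1))"
proof (cases k)
  case (Suc j)
  have "(e + 1 + of_int (wt m)) gchoose Suc j = ((e + of_int (wt m)) gchoose j) + ((e + of_int (wt m)) gchoose Suc j)" for m
    using gbinomial_Suc_Suc[of "e + of_int (wt m)" j] by (simp add: add_ac)
  then show ?thesis by (intro mser_eqI) (simp add: cf_hbin Suc algebra_simps)
qed (simp add: hbin_0[of a "e + 1"] hbin_0[of a e])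

text \<open>\<open>h 2 t\<close> times e^alpha is the \<open>t\<close>-th divided derivative of
  e^alpha. The mode of index \<open>N\<close> comes with z^(N + c) on charge \<open>c\<close>, which
  accounts for the binomial coefficient.\<close>

lemma emode_assoc_base:
  assumes X: "hom d X" "d < int D" and t: "int t \<le> int D" and B: "w < int B" "d < int B"
  shows "agree w (vop D 2 c (emode (int t) (cst z)) X)
    (\<Sum>N\<in>{- int B..int B}. cst ((of_int N + c) gchoose t) * emode N (cst z * X))"
proof -
  have bX: "bd (int D) X" using X by (intro bd_mono[OF hom_bd[OF X(1)]]) simp
  have "emode (int t) (cst z) = h 2 (int t) * cst z"
    by (subst emode_hom_eq[OF hom_const, of 0]) (simp_all add: emodeb_def)
  then have "vop D 2 c (emode (int t) (cst z)) X = (\<Sum>p\<le>D. hbin 2 (c - of_nat p) t * (cst z * Ep 2 p X))"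
    using vop_h[OF hom_bd[OF hom_const] _ bX, of t 2 0 c z] t bd_mono[OF bd_Ep[OF bX], of _ "int D"]
    by (simp add: vop_one)
  also have "agree w \<dots> (\<Sum>p\<le>D. (\<Sum>N\<in>{- int B..int B}. cst ((of_int N + c) gchoose t) * h 2 (N + int p)) * (cst z * Ep 2 p X))"
  proof (intro agree_sum)
    fix p
    show "agree w (hbin 2 (c - of_nat p) t * (cst z * Ep 2 p X))
       ((\<Sum>N\<in>{- int B..int B}. cst ((of_int N + c) gchoose t) * h 2 (N + int p)) * (cst z * Ep 2 p X))"
    proof (cases "int p \<le> d")
      case True
      have "agree w (hbin 2 (c - of_nat p) t) (\<Sum>N\<in>{- int B..int B}. cst ((of_int N + c) gchoose t) * h 2 (N + int p))"
        unfolding agree_def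
      proof (intro allI impI)
        fix m assume m: "wt m \<le> w"
        have "wt m - int p \<in> {- int B..int B}"
          using m B True wt_nonneg[of m] unfolding atLeastAtMost_iff by linarith
        then have "cf (\<Sum>N\<in>{- int B..int B}. cst ((of_int N + c) gchoose t) * h 2 (N + int p)) m
          = (\<Sum>N\<in>{wt m - int p}. ((of_int N + c) gchoose t) * cf (h 2 (N + int p)) m)"
          unfolding cf_sum cf_cst_times
          by (intro sum.mono_neutral_right) (auto simp: cf_h)
        also have "\<dots> = cf (hbin 2 (c - of_nat p) t) m"
          by (simp add: cf_h cf_hbin algebra_simps)
        finally show "cf (hbin 2 (c - of_nat p) t) m = cf (\<Sum>N\<in>{- int B..int B}. cst ((of_int N + c) gchoose t) * h 2 (N + int p)) m" ..
      qed
      then show ?thesis by (intro agree_mult agree_refl)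
    next
      case False
      then have "Ep 2 p X = 0" by (intro Ep_high[OF X(1)]) simp
      then show ?thesis by simp
    qed
  qed
  also have "(\<Sum>p\<le>D. (\<Sum>N\<in>{- int B..int B}. cst ((of_int N + c) gchoose t) * h 2 (N + int p)) * (cst z * Ep 2 p X))
     = (\<Sum>N\<in>{- int B..int B}. \<Sum>p\<le>D. cst ((of_int N + c) gchoose t) * (cst z * (h 2 (N + int p) * Ep 2 p X)))"
    by (subst sum.swap) (simp only: sum_distrib_right sum_distrib_left mult.assoc mult.left_commute)
  also have "\<dots> = (\<Sum>N\<in>{- int B..int B}. cst ((of_int N + c) gchoose t) * emode N (cst z * X))"
    using X by (simp add: emode_hom_eq[OF X(1), of D] emodeb_def sum_distrib_left)
  finally show ?thesis .
qed

text \<open>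
  Since the modes of \<open>e\<^sup>\<alpha>\<close> commute with those of \<open>v\<close> up to sign, the
  two sums of Borcherds' identity merge into one in which \<open>e\<^sup>\<alpha>\<close> acts last.
\<close>
lemma emode_assoc:
  assumes "hdeg b dv v" "hom d X" "d < int D" "dv \<le> int D" "dv + int t - int b \<le> int D"
    "w < int B" "d + int b < int B"
  shows "agree w (vop D (of_nat b + 2) c (emode (int t - int b) v) X)
    (\<Sum>N\<in>{- int B..int B}. cst ((of_int N + c + of_nat b) gchoose t) * emode N (vop D (of_nat b) c v X))"
  using assms
proof (induction arbitrary: t d X rule: hdeg.induct)
  case (hdeg_cst z)
  have "bd (int D) X" using hdeg_cst by (intro bd_mono[OF hom_bd[OF hdeg_cst(1)]]) simp
  then show ?case using emode_assoc_base[OF hdeg_cst(1,2), of t w B c z] hdeg_cst by (simp add: vop_one)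
next
  case (hdeg_h n dv f k)
  note X = hdeg_h.prems(1)
  define y where "y p = vop D (of_nat n) c f (Ep 1 p X)" for p
  define e where "e p = c / 2 - of_nat p" for p
  define cb where "cb N t = ((of_int N + c + of_nat n) gchoose t)" for N t
  define S where "S t Y = (\<Sum>N\<in>{- int B..int B}. cst (cb N t) * emode N Y)" for t Y
  define L where "L j p = vop D (of_nat n + 2) c (emode (j - int n) f) (Ep 1 p X)" for j p
  define Sm where "Sm Y = (if t = 0 then 0 else S (t - 1) Y)" for Y
  define Hm where "Hm p = (if k = 0 then 0 else hbin 1 (e p) (k - 1))" for p
  have fhom: "hom dv f" using hdeg_hom[OF hdeg_h.hyps] .
  have bX: "bd (int D) X" using hdeg_h.prems by (intro bd_mono[OF hom_bd[OF X]]) simp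
  have nd: "dv \<le> int D" using hdeg_h.prems(3) by simp
  have IH: "agree w (L (int j) p) (S j (y p))" if "dv + int j - int n \<le> int D" for j p
    unfolding L_def S_def y_def cb_def
    by (rule hdeg_h.IH[OF hom_Ep[OF X]]) (use hdeg_h.prems that nd in simp_all)
  have cst3: "of_nat (Suc n) + 2 = (1 :: complex) + (of_nat n + 2)" by simp
  have L1: "vop D (of_nat (Suc n) + 2) c (h 1 (int k) * emode (int t - int (Suc n)) f) X
     = (\<Sum>p\<le>D. hbin 1 (e p) k * L (int t - 1) p)"
  proof -
    have "int t - int (Suc n) = int t - 1 - int n" by simp
    then show ?thesis
      unfolding cst3 using hdeg_h.prems(4)
      by (simp only: L_def e_def) (subst vop_h[OF hom_bd[OF hom_emode[OF fhom]] _ bX], simp_all)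
  qed
  have L2: "vop D (of_nat (Suc n) + 2) c (h 1 (int k - 1) * emode (int t - int n) f) X
     = (\<Sum>p\<le>D. Hm p * L (int t) p)"
  proof (cases k)
    case (Suc k')
    then have "int k - 1 = int k'" by simp
    then show ?thesis
      unfolding cst3 using hdeg_h.prems(4) Suc
      by (simp only: L_def e_def Hm_def) (subst vop_h[OF hom_bd[OF hom_emode[OF fhom]] _ bX], simp_all)
  qed (simp add: Hm_def)
  have "emode (int t - int (Suc n)) (h 1 (int k) * f)
    = h 1 (int k) * emode (int t - int (Suc n)) f - h 1 (int k - 1) * emode (int t - int n) f"
    by (simp add: emode_h1)
  moreover have "vop D b c (u - v) X = vop D b c u X - vop D b c v X" for b u v
    using vop_linear(3)[of D b c "u - v" v X] by simp
  ultimately have lhs: "vop D (of_nat (Suc n) + 2) c (emode (int t - int (Suc n)) (h 1 (int k) * f)) X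
    = (\<Sum>p\<le>D. hbin 1 (e p) k * L (int t - 1) p - Hm p * L (int t) p)"
    by (simp only: L1 L2 sum_subtractf)
  \<comment> \<open>For \<open>t = 0\<close> the left side involves the mode of index
    \<open>- 1 - n\<close> on a vector of degree \<open>n\<close>, which vanishes by the degree
    bound; hence the default 0 in \<open>Sm\<close>.\<close>
  have a1: "agree w (hbin 1 (e p) k * L (int t - 1) p) (hbin 1 (e p) k * Sm (y p))" for p
  proof (cases "t = 0")
    case True
    then show ?thesis
      using hdeg_emode_low[OF hdeg_h.hyps, of "- 1 - int n"] by (simp add: L_def Sm_def)
  next
    case False
    then show ?thesis
      using IH[of "t - 1" p] hdeg_h.prems(4) by (intro agree_mult) (simp_all add: Sm_def of_nat_diff)
  qed
  have a2: "agree w (Hm p * L (int t) p) (Hm p * S t (y p))" for p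
  proof (cases "k = 0")
    case False
    then show ?thesis
      using IH[of t p] hdeg_h.prems(4) by (intro agree_mult) simp_all
  qed (simp add: Hm_def)
  have lhs': "agree w (vop D (of_nat (Suc n) + 2) c (emode (int t - int (Suc n)) (h 1 (int k) * f)) X)
    (\<Sum>p\<le>D. hbin 1 (e p) k * Sm (y p) - Hm p * S t (y p))"
    unfolding lhs by (intro agree_sum agree_diff a1 a2)
  have y: "vop D (of_nat (Suc n)) c (h 1 (int k) * f) X = (\<Sum>p\<le>D. hbin 1 (e p) k * y p)"
    using vop_h[OF hom_bd[OF fhom] _ bX, of k 1 "of_nat n" c] hdeg_h.prems(3) by (simp add: y_def e_def add.commute)
  have cb1: "of_int N + c + of_nat (Suc n) = of_int (N + 1) + c + of_nat n" for N
    by simp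
  have Pascal: "(\<Sum>N\<in>{- int B..int B}. cst (cb (N + 1) t) * emode N Y) = S t Y + Sm Y" for Y
  proof (cases t)
    case (Suc t')
    have "cb (N + 1) t = cb N t + cb N t'" for N
      using gbinomial_Suc_Suc[of "of_int N + c + of_nat n" t'] by (simp add: cb_def Suc add_ac)
    then show ?thesis by (simp add: S_def Sm_def Suc cst_simps distrib_right sum.distrib)
  qed (simp add: S_def Sm_def cb_def)
  \<comment> \<open>Reindexing moves the window by one. The term that leaves at \<open>- B\<close>
    is zero because its weight would be negative, and the term that enters at \<open>B + 1\<close>
    lies above weight \<open>w\<close>.\<close>
  have shift: "agree w (\<Sum>N\<in>{- int B..int B}. cst (cb (N + 1) t) * emode (N + 1) (y p)) (S t (y p))" for p
  proof -
    have "emode (- int B) (y p) = 0"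
    proof -
      have "d - int p + (- int B + int n) < 0" using hdeg_h.prems by simp
      then have "emode (- int B + int n) (Ep 1 p X) = 0"
        by (rule hom_neg[OF hom_emode[OF hom_Ep[OF X]]])
      then show ?thesis
        unfolding y_def
        by (subst emode_vop_commute[OF hdeg_h.hyps hom_Ep[OF X]]) (use hdeg_h.prems nd in simp_all)
    qed
    moreover have "(\<Sum>N\<in>{- int B..int B}. cst (cb (N + 1) t) * emode (N + 1) (y p))
      = (\<Sum>N\<in>{- int B + 1..int B + 1}. cst (cb N t) * emode N (y p))"
      by (rule sum.reindex_bij_witness[of _ "\<lambda>N. N - 1" "\<lambda>N. N + 1"]) auto
    moreover have "{- int B + 1..int B + 1} = insert (int B + 1) {- int B + 1..int B}"
      and "{- int B..int B} = insert (- int B) {- int B + 1..int B}" by auto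
    ultimately have "(\<Sum>N\<in>{- int B..int B}. cst (cb (N + 1) t) * emode (N + 1) (y p))
      = cst (cb (int B + 1) t) * emode (int B + 1) (y p) + S t (y p)"
      by (simp add: S_def)
    moreover have "agree w (cst (cb (int B + 1) t) * emode (int B + 1) (y p)) (cst (cb (int B + 1) t) * 0)"
      using hdeg_h.prems by (intro agree_mult agree_refl agree_emode_0) simp
    ultimately show ?thesis
      using agree_add[of w _ 0 "S t (y p)" "S t (y p)"] by simp
  qed
  have "(\<Sum>N\<in>{- int B..int B}. cst ((of_int N + c + of_nat (Suc n)) gchoose t) * emode N (vop D (of_nat (Suc n)) c (h 1 (int k) * f) X))
    = (\<Sum>N\<in>{- int B..int B}. \<Sum>p\<le>D. hbin 1 (e p) k * (cst (cb (N + 1) t) * emode N (y p))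
        - hbin 1 (e p + 1) k * (cst (cb (N + 1) t) * emode (N + 1) (y p)))"
    unfolding y cb1
    by (simp only: emode_sum emode_hbin1 cb_def[symmetric] sum_distrib_left right_diff_distrib mult.left_commute)
  also have "\<dots> = (\<Sum>p\<le>D. hbin 1 (e p) k * (\<Sum>N\<in>{- int B..int B}. cst (cb (N + 1) t) * emode N (y p))
        - hbin 1 (e p + 1) k * (\<Sum>N\<in>{- int B..int B}. cst (cb (N + 1) t) * emode (N + 1) (y p)))"
    by (subst sum.swap) (simp only: sum_subtractf sum_distrib_left)
  also have "agree w \<dots> (\<Sum>p\<le>D. hbin 1 (e p) k * (S t (y p) + Sm (y p)) - hbin 1 (e p + 1) k * S t (y p))"
    unfolding Pascal by (intro agree_sum agree_diff agree_mult agree_refl shift)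
  also have "(\<Sum>p\<le>D. hbin 1 (e p) k * (S t (y p) + Sm (y p)) - hbin 1 (e p + 1) k * S t (y p))
    = (\<Sum>p\<le>D. hbin 1 (e p) k * Sm (y p) - Hm p * S t (y p))"
  proof (rule sum.cong[OF refl])
    fix p
    have "hbin 1 (e p + 1) k = hbin 1 (e p) k + Hm p"
      unfolding hbin_Pascal Hm_def ..
    then show "hbin 1 (e p) k * (S t (y p) + Sm (y p)) - hbin 1 (e p + 1) k * S t (y p) = hbin 1 (e p) k * Sm (y p) - Hm p * S t (y p)"
      by (simp only:) (simp add: algebra_simps)
  qed
  finally show ?case
    by (rule agree_trans[OF lhs' agree_sym])
next
  case (hdeg_add n w' f g)
  show ?case
    using agree_add[OF hdeg_add.IH(1)[OF hdeg_add.prems] hdeg_add.IH(2)[OF hdeg_add.prems]]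
    by (simp add: distrib_left sum.distrib)
qed simp

section \<open>Series killed by low modes of the generator\<close>

lemma hdeg_mult: "hdeg n w f \<Longrightarrow> hdeg n' w' g \<Longrightarrow> hdeg (n + n') (w + w') (f * g)"
proof (induction rule: hdeg.induct)
  case (hdeg_h n w f k)
  show ?case
    using hdeg.hdeg_h[OF hdeg_h.IH[OF hdeg_h.prems], of k] by (simp add: ac_simps)
next
  case (hdeg_add n w f g)
  then show ?case by (simp add: distrib_right hdeg.hdeg_add)
qed (auto intro: hdeg_smult hdeg_0)

lemma hdeg_Suc: "hdeg n w f \<Longrightarrow> hdeg (Suc n) w f"
  using hdeg_h[of n w f 0] by simp

lemma hdeg_mono: "hdeg n w f \<Longrightarrow> n \<le> n' \<Longrightarrow> hdeg n' w f"
  by (induction n') (auto simp: le_Suc_eq intro: hdeg_Suc)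

lemma hdeg_diff: "hdeg n w f \<Longrightarrow> hdeg n w g \<Longrightarrow> hdeg n w (f - g)"
  using hdeg_add[OF _ hdeg_smult[of n w g "-1"], of f] by (simp add: cst_simps)

text \<open>Solve \<open>h_rec\<close> for x_l and recurse on the smaller indices. The existence of
  some degree suffices, so the degrees are bounded crudely by their sum.\<close>

lemma hdeg_xmon_single: "l \<noteq> 0 \<Longrightarrow> \<exists>n. hdeg n (int l) (xmon {#l#})"
proof (induction l rule: less_induct)
  case (less l)
  define N where "N j = (SOME n. hdeg n (int j) (xmon {#j#}))" for j
  have N: "hdeg (N j) (int j) (xmon {#j#})" if "j \<in> {1..<l}" for j
    unfolding N_def by (rule someI_ex, rule less.IH) (use that in auto)
  define M where "M = Suc (\<Sum>j\<in>{1..<l}. Suc (N j))"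
  have 1: "hdeg M (int l) (xmon {#j#} * h 1 (int l - int j))" if j: "j \<in> {1..<l}" for j
  proof -
    have "hdeg (Suc 0) (0 + (int l - int j)) (h 1 (int l - int j) * cst 1)"
      by (rule hdeg_h_int[OF hdeg_cst])
    from hdeg_mult[OF N[OF j] this] have "hdeg (N j + Suc 0) (int l) (xmon {#j#} * h 1 (int l - int j))"
      by simp
    moreover have "Suc (N j) \<le> (\<Sum>j\<in>{1..<l}. Suc (N j))"
      by (rule member_le_sum) (use j in auto)
    ultimately show ?thesis by (elim hdeg_mono) (simp add: M_def)
  qed
  have "hdeg (Suc 0) (int l) (h 1 (int l))"
    using hdeg_h[OF hdeg_cst[of 1], of l] by simp
  then have 2: "hdeg M (int l) (cst (2 * of_nat l) * h 1 (int l))"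
    by (intro hdeg_smult) (auto elim!: hdeg_mono simp: M_def)
  have "{1..l} = insert l {1..<l}" using less.prems by auto
  then have "cst (of_nat l) * h 1 (int l) = cst (1 / 2) * (xmon {#l#} + (\<Sum>j\<in>{1..<l}. xmon {#j#} * h 1 (int l - int j)))"
    using h_rec[of l 1] by simp
  then have "cst 2 * (cst (of_nat l) * h 1 (int l)) = cst 2 * (cst (1 / 2) * (xmon {#l#} + (\<Sum>j\<in>{1..<l}. xmon {#j#} * h 1 (int l - int j))))"
    by simp
  then have "xmon {#l#} = cst (2 * of_nat l) * h 1 (int l) - (\<Sum>j\<in>{1..<l}. xmon {#j#} * h 1 (int l - int j))"
    by (simp add: cst_cst)
  moreover have "hdeg M (int l) (cst (2 * of_nat l) * h 1 (int l) - (\<Sum>j\<in>{1..<l}. xmon {#j#} * h 1 (int l - int j)))"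
    by (intro hdeg_diff 2 hdeg_sum 1)
  ultimately show ?case by auto
qed

lemma hdeg_xmon_ex: "0 \<notin># m \<Longrightarrow> \<exists>n. hdeg n (wt m) (xmon m)"
proof (induction m)
  case empty
  then show ?case using hdeg_cst[of 1] by auto
next
  case (add x m)
  then obtain n n' where "hdeg n (wt m) (xmon m)" "hdeg n' (int x) (xmon {#x#})"
    using hdeg_xmon_single[of x] by auto
  from hdeg_mult[OF this(2,1)] show ?case
    using xmon_add[of "{#x#}" m] by auto
qed

lemma hdeg_ex:
  assumes "hom d v"
  shows "\<exists>n. hdeg n d v"
proof -
  define D where "D = nat d"
  have b: "bd (int D) v" using bd_mono[OF hom_bd[OF assms], of "int D"] by (simp add: D_def)
  define N where "N m = (SOME n. hdeg n (wt m) (xmon m))" for m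
  have N: "hdeg (N m) (wt m) (xmon m)" if "0 \<notin># m" for m
    unfolding N_def by (rule someI_ex, rule hdeg_xmon_ex[OF that])
  define M where "M = (\<Sum>m\<in>parts_le D. N m)"
  have "hdeg M d (cst (cf v m) * xmon m)" if m: "m \<in> parts_le D" for m
  proof (cases "cf v m = 0")
    case False
    then have "wt m = d" "0 \<notin># m" using assms by (auto simp: hom_def)
    moreover have "N m \<le> M" unfolding M_def by (rule member_le_sum) (use m in auto)
    ultimately show ?thesis using N[of m] by (auto intro: hdeg_smult hdeg_mono)
  qed (auto intro: hdeg_0)
  then have "hdeg M d (\<Sum>m\<in>parts_le D. cst (cf v m) * xmon m)" by (rule hdeg_sum)
  then show ?thesis using xmon_expansion[OF b] by auto
qed

section \<open>Linear independence of the products and descent of the degree\<close>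

definition hprod :: "nat multiset \<Rightarrow> mser" where
  "hprod P = (\<Prod>k\<in>#P. h 1 (int k))"

lemma hprod_simps [simp]: "hprod {#} = 1" "hprod (add_mset k P) = h 1 (int k) * hprod P"
  by (simp_all add: hprod_def)

text \<open>The entry 0 is allowed: as \<open>h 1 0 = 1\<close>, products of exactly
  \<open>n\<close> factors describe all degrees up to \<open>n\<close>.\<close>

definition msets :: "nat \<Rightarrow> int \<Rightarrow> nat multiset set" where
  "msets n w = {M. size M = n \<and> wt M = w}"

lemma finite_msets [simp]: "finite (msets n w)"
proof (rule finite_subset)
  show "msets n w \<subseteq> mset ` {xs. set xs \<subseteq> {..nat w} \<and> length xs = n}"
  proof
    fix m assume m: "m \<in> msets n w"
    obtain xs where xs: "mset xs = m" using ex_mset by blast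
    have "k \<le> nat w" if "k \<in># m" for k
      using elem_le_wt[OF that] m by (auto simp: msets_def)
    then have "set xs \<subseteq> {..nat w}" by (auto simp flip: xs)
    moreover have "length xs = n"
      using m by (auto simp: msets_def simp flip: xs)
    ultimately show "m \<in> mset ` {xs. set xs \<subseteq> {..nat w} \<and> length xs = n}" using xs by blast
  qed
qed (simp add: finite_lists_length_eq)

lemma hdeg_hprod: "P \<in> msets n w \<Longrightarrow> hdeg n w (hprod P)"
proof (induction P arbitrary: n w)
  case empty
  then show ?case using hdeg_cst[of 1] by (auto simp: msets_def)
next
  case (add k P)
  then have "P \<in> msets (n - 1) (w - int k)" "n = Suc (n - 1)" by (auto simp: msets_def)
  with add.IH have "hdeg (Suc (n - 1)) (w - int k + int k) (h 1 (int k) * hprod P)" by (intro hdeg_h)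
  then show ?case using \<open>n = Suc (n - 1)\<close> by simp
qed

lemma hdeg_rep: "hdeg n w v \<Longrightarrow> \<exists>c. v = (\<Sum>P\<in>msets n w. cst (c P) * hprod P)"
proof (induction rule: hdeg.induct)
  case (hdeg_cst z)
  have "msets 0 0 = {{#}}" by (auto simp: msets_def)
  then show ?case by (intro exI[of _ "\<lambda>_. z"]) simp
next
  case (hdeg_h n w f k)
  then obtain c where c: "f = (\<Sum>P\<in>msets n w. cst (c P) * hprod P)" by blast
  define c' where "c' P = (if k \<in># P then c (P - {#k#}) else 0)" for P
  have "(\<Sum>P\<in>msets (Suc n) (w + int k). cst (c' P) * hprod P) = (\<Sum>P\<in>add_mset k ` msets n w. cst (c' P) * hprod P)"
  proof (rule sum.mono_neutral_right)
    show "add_mset k ` msets n w \<subseteq> msets (Suc n) (w + int k)" by (auto simp: msets_def)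
    show "\<forall>P\<in>msets (Suc n) (w + int k) - add_mset k ` msets n w. cst (c' P) * hprod P = 0"
    proof
      fix P assume P: "P \<in> msets (Suc n) (w + int k) - add_mset k ` msets n w"
      have "k \<notin># P"
      proof
        assume k: "k \<in># P"
        then have "P - {#k#} \<in> msets n w" using P by (auto simp: msets_def size_Diff_singleton wt_remove)
        with k have "P \<in> add_mset k ` msets n w" by (intro image_eqI[of _ _ "P - {#k#}"]) auto
        with P show False by blast
      qed
      then show "cst (c' P) * hprod P = 0" by (simp add: c'_def)
    qed
  qed simp
  also have "\<dots> = h 1 (int k) * f"
    unfolding c sum_distrib_left by (subst sum.reindex) (auto simp: inj_on_def c'_def mult.left_commute intro!: sum.cong)
  finally show ?case by metis
next
  case (hdeg_add n w f g)
  then obtain c c' where "f = (\<Sum>P\<in>msets n w. cst (c P) * hprod P)" "g = (\<Sum>P\<in>msets n w. cst (c' P) * hprod P)" by blast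
  then have "f + g = (\<Sum>P\<in>msets n w. cst (c P + c' P) * hprod P)"
    by (simp add: cst_simps distrib_right sum.distrib)
  then show ?case by (intro exI[of _ "\<lambda>P. c P + c' P"])
next
  case (hdeg_0 n w)
  then show ?case by (intro exI[of _ "\<lambda>_. 0"]) simp
qed

definition posp :: "nat multiset \<Rightarrow> nat multiset" where
  "posp P = filter_mset (\<lambda>k. k \<noteq> 0) P"

lemma posp_simps [simp]: "posp {#} = {#}" "posp (add_mset k P) = (if k = 0 then posp P else add_mset k (posp P))"
  by (auto simp: posp_def)

lemma posp_inj: "posp P = posp Q \<Longrightarrow> size P = size Q \<Longrightarrow> P = Q"
proof -
  assume 1: "posp P = posp Q" and 2: "size P = size Q"
  have *: "P = posp P + replicate_mset (size P - size (posp P)) 0" for P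
  proof -
    have "P = posp P + filter_mset (\<lambda>k. k = 0) P"
      unfolding posp_def using multiset_partition[of P "\<lambda>k. k \<noteq> 0"] by simp
    moreover have "filter_mset (\<lambda>k. k = 0) P = replicate_mset (count P 0) 0"
      by (rule filter_eq_replicate_mset)
    ultimately have e: "P = posp P + replicate_mset (count P 0) 0" by simp
    then have "size P = size (posp P) + count P 0" by (metis size_replicate_mset size_union)
    with e show ?thesis by simp
  qed
  from *[of P] *[of Q] 1 2 show "P = Q" by metis
qed

lemma ecoef_single_nonzero: "k \<noteq> 0 \<Longrightarrow> x \<noteq> 0 \<Longrightarrow> ecoef x {#k#} \<noteq> 0"
  using ecoef_add_mset[of k "{#}" x] by auto

text \<open>
  The shortest monomial of a product of \<open>h 1 k\<close> records its factors other than \<open>h 1 0 =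
  1\<close>; hence the products are linearly independent.
\<close>
lemma hprod_leading:
  shows "cf (hprod P) lam \<noteq> 0 \<Longrightarrow> size (posp P) < size lam \<or> lam = posp P"
    and "cf (hprod P) (posp P) \<noteq> 0"
proof (induction P arbitrary: lam)
  case empty
  {
    case 1
    then show ?case by (auto simp: cf_one split: if_splits)
  next
    case 2
    then show ?case by (simp add: cf_one)
  }
next
  case (add k P)
  have key: "size (posp P) + 1 < size lam \<or> (p = {#k#} \<and> lam = add_mset k (posp P))"
    if k: "k \<noteq> 0" and p: "p \<subseteq># lam" "cf (h 1 (int k)) p \<noteq> 0" "cf (hprod P) (lam - p) \<noteq> 0" for lam p
  proof -
    from p(2) have pw: "0 \<notin># p" "wt p = int k" by (auto simp: cf_h split: if_splits)
    then have "p \<noteq> {#}" using k by auto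
    have sz: "size lam = size p + size (lam - p)"
      using p(1) by (metis size_union subset_mset.add_diff_inverse)
    show ?thesis
    proof (cases "size p = 1")
      case True
      then obtain j where "p = {#j#}" using size_1_singleton_mset by blast
      with pw have pk: "p = {#k#}" by simp
      from add.IH(1)[OF p(3)] show ?thesis
      proof
        assume "lam - p = posp P"
        then show ?thesis using p(1) pk by (metis add_mset_add_single subset_mset.diff_add)
      qed (use sz True in simp)
    next
      case False
      moreover have "size p \<noteq> 0" using \<open>p \<noteq> {#}\<close> by simp
      ultimately have "size p \<ge> 2" by linarith
      moreover have "size (posp P) \<le> size (lam - p)" using add.IH(1)[OF p(3)] by auto
      ultimately show ?thesis using sz by simp
    qed
  qed
  {
    case 1
    show ?case
    proof (cases "k = 0")
      case True
      then show ?thesis using 1 add.IH(1) by simp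
    next
      case False
      from 1 obtain p where "p \<subseteq># lam" "cf (h 1 (int k)) p \<noteq> 0" "cf (hprod P) (lam - p) \<noteq> 0"
        by (auto simp: cf_times elim: sum.not_neutral_contains_not_neutral)
      from key[OF False this] False show ?thesis by auto
    qed
  next
    case 2
    show ?case
    proof (cases "k = 0")
      case True
      then show ?thesis using add.IH(2) by simp
    next
      case False
      let ?lam = "add_mset k (posp P)"
      have "cf (hprod (add_mset k P)) ?lam = (\<Sum>p\<in>{{#k#}}. cf (h 1 (int k)) p * cf (hprod P) (?lam - p))"
        unfolding hprod_simps cf_times
      proof (rule sum.mono_neutral_right)
        show "\<forall>p\<in>{p. p \<subseteq># ?lam} - {{#k#}}. cf (h 1 (int k)) p * cf (hprod P) (?lam - p) = 0"
        proof (rule ballI, rule ccontr)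
          fix p assume p: "p \<in> {p. p \<subseteq># ?lam} - {{#k#}}" "cf (h 1 (int k)) p * cf (hprod P) (?lam - p) \<noteq> 0"
          then have "size (posp P) + 1 < size ?lam \<or> p = {#k#}" using key[OF False, of p ?lam] by auto
          with p(1) show False by simp
        qed
      qed auto
      also have "\<dots> = ecoef (1 / 2) {#k#} * cf (hprod P) (posp P)"
        using False by (simp add: cf_h)
      finally show ?thesis
        using False add.IH(2) ecoef_single_nonzero[of k "1/2"] by simp
    qed
  }
qed

text \<open>Among the products with nonzero coefficient choose \<open>Q\<close> with
  \<open>posp Q\<close> shortest. By \<open>hprod_leading\<close> the monomial \<open>posp Q\<close>
  then occurs in no other of these products.\<close>

lemma hprod_independent:
  assumes "finite S" "\<And>P. P \<in> S \<Longrightarrow> size P = n" "(\<Sum>P\<in>S. cst (c P) * hprod P) = 0" "P \<in> S"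
  shows "c P = 0"
proof (rule ccontr)
  assume "c P \<noteq> 0"
  define T where "T = {P \<in> S. c P \<noteq> 0}"
  have "P \<in> T" using assms(4) \<open>c P \<noteq> 0\<close> by (simp add: T_def)
  then obtain Q where Q: "Q \<in> T" "\<And>P. P \<in> T \<Longrightarrow> size (posp Q) \<le> size (posp P)"
    using ex_has_least_nat[of "\<lambda>P. P \<in> T" P "\<lambda>P. size (posp P)"] by blast
  have "0 = (\<Sum>P\<in>S. c P * cf (hprod P) (posp Q))"
    using arg_cong[OF assms(3), of "\<lambda>f. cf f (posp Q)"] by simp
  also have "\<dots> = (\<Sum>P\<in>{Q}. c P * cf (hprod P) (posp Q))"
  proof (rule sum.mono_neutral_right)
    show "\<forall>P\<in>S - {Q}. c P * cf (hprod P) (posp Q) = 0"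
    proof (rule ballI, rule ccontr)
      fix P assume P: "P \<in> S - {Q}" "c P * cf (hprod P) (posp Q) \<noteq> 0"
      then have "P \<in> T" "cf (hprod P) (posp Q) \<noteq> 0" by (auto simp: T_def)
      with hprod_leading(1)[of P "posp Q"] Q(2)[of P] have "posp P = posp Q" by auto
      moreover have "P \<in> S" "Q \<in> S" using P(1) Q(1) by (auto simp: T_def)
      then have "size P = size Q" by (simp only: assms(2))
      ultimately have "P = Q" by (rule posp_inj)
      with P show False by simp
    qed
  qed (use assms(1) Q(1) in \<open>auto simp: T_def\<close>)
  finally show False
    using Q(1) hprod_leading(2)[of Q] by (simp add: T_def)
qed

text \<open>The highest power of z^-1 takes the second term \<open>- h 1 (k - 1)\<close> from every
  factor.\<close>

lemma Ep2_hprod_top: "0 \<notin># P \<Longrightarrow> Ep 2 (size P) (hprod P) = cst ((-1) ^ size P) * hprod (image_mset (\<lambda>k. k - 1) P)"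
proof (induction P)
  case (add k P)
  have "Ep 2 (Suc (size P)) (hprod P) = 0"
    by (rule hdeg_Ep2_vanish[OF hdeg_hprod[of P "size P" "wt P"]]) (auto simp: msets_def)
  moreover obtain j where "k = Suc j" using add.prems by (cases k) auto
  moreover have "Ep 2 (size P) (hprod P) = cst ((-1) ^ size P) * hprod (image_mset (\<lambda>k. k - 1) P)"
    using add by simp
  moreover have "cst ((-1) ^ Suc (size P)) = - cst ((-1) ^ size P)"
    by (simp add: cst_simps(5))
  ultimately show ?case
    by (simp add: Ep2_h1 mult.left_commute)
qed simp

text \<open>Products containing \<open>h 1 0\<close> already have degree \<open>n\<close>. The
  remaining ones have as top term the product with all indices lowered by one, up to a common sign;
  this map is injective, so independence forces their coefficients to vanish.\<close>

lemma hdeg_reduce: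
  assumes v: "hdeg (Suc n) w v" and 0: "Ep 2 (Suc n) v = 0"
  shows "hdeg n w v"
proof -
  obtain c where c: "v = (\<Sum>P\<in>msets (Suc n) w. cst (c P) * hprod P)" using hdeg_rep[OF v] by blast
  define Z where "Z = {P \<in> msets (Suc n) w. 0 \<in># P}"
  define S where "S = {P \<in> msets (Suc n) w. 0 \<notin># P}"
  have fin_supp: "finite Z" "finite S" by (simp_all add: Z_def S_def)
  have "msets (Suc n) w = Z \<union> S" "Z \<inter> S = {}" by (auto simp: Z_def S_def)
  then have split: "v = (\<Sum>P\<in>Z. cst (c P) * hprod P) + (\<Sum>P\<in>S. cst (c P) * hprod P)"
    using fin_supp c by (simp add: sum.union_disjoint)
  have Zn: "hdeg n w (\<Sum>P\<in>Z. cst (c P) * hprod P)"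
  proof (intro hdeg_sum hdeg_smult)
    fix P assume P: "P \<in> Z"
    then have "0 \<in># P" by (simp add: Z_def)
    then have "hprod P = h 1 (int 0) * hprod (P - {#0#})" using hprod_simps(2)[of 0 "P - {#0#}"] by simp
    moreover have "P - {#0#} \<in> msets n w" using P by (auto simp: Z_def msets_def size_Diff_singleton wt_remove)
    ultimately show "hdeg n w (hprod P)" using hdeg_hprod by simp
  qed
  define pr :: "nat multiset \<Rightarrow> nat multiset" where "pr = image_mset (\<lambda>k. k - 1)"
  have inj: "inj_on pr S"
  proof (rule inj_onI)
    fix P Q assume *: "P \<in> S" "Q \<in> S" "pr P = pr Q"
    have "image_mset Suc (pr P) = P" if "P \<in> S" for P
    proof -
      have "Suc (k - 1) = k" if "k \<in># P" for k
        using that \<open>P \<in> S\<close> by (cases k) (auto simp: S_def)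
      then have "image_mset Suc (pr P) = image_mset (\<lambda>k. k) P"
        unfolding pr_def image_mset.compositionality by (intro image_mset_cong) simp
      then show ?thesis by simp
    qed
    with * show "P = Q" by metis
  qed
  have "0 = Ep 2 (Suc n) (\<Sum>P\<in>S. cst (c P) * hprod P)"
    using 0 hdeg_Ep2_vanish[OF Zn, of "Suc n"] by (subst (asm) split) simp
  also have "\<dots> = (\<Sum>P\<in>S. cst (c P) * (cst ((-1) ^ Suc n) * hprod (pr P)))"
    unfolding Ep_sum Ep_cst
  proof (rule sum.cong[OF refl])
    fix P assume "P \<in> S"
    then have "0 \<notin># P" "size P = Suc n" by (auto simp: S_def msets_def)
    then show "cst (c P) * Ep 2 (Suc n) (hprod P) = cst (c P) * (cst ((-1) ^ Suc n) * hprod (pr P))"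
      using Ep2_hprod_top[of P] by (simp add: pr_def)
  qed
  also have "\<dots> = (\<Sum>Q\<in>pr ` S. cst (c (inv_into S pr Q) * (-1) ^ Suc n) * hprod Q)"
    by (subst sum.reindex[OF inj]) (auto simp: inv_into_f_f[OF inj] cst_cst intro!: sum.cong)
  finally have ind: "(\<Sum>Q\<in>pr ` S. cst (c (inv_into S pr Q) * (-1) ^ Suc n) * hprod Q) = 0" ..
  have "c P = 0" if P: "P \<in> S" for P
  proof -
    have "size Q = Suc n" if "Q \<in> pr ` S" for Q
      using that by (auto simp: pr_def S_def msets_def)
    from hprod_independent[OF _ this ind, of "pr P"] fin_supp P inv_into_f_f[OF inj P] show ?thesis
      by simp
  qed
  then have "(\<Sum>P\<in>S. cst (c P) * hprod P) = 0" by (intro sum.neutral) simp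
  then show ?thesis using Zn split by simp
qed

lemma hdeg_descend:
  assumes "hdeg n d v" "\<And>p. c < int p \<Longrightarrow> Ep 2 p v = 0"
  shows "if c < 0 then v = 0 else hdeg (nat c) d v"
  using assms(1)
proof (induction n)
  case 0
  show ?case
  proof (cases "c < 0")
    case True
    then have "Ep 2 0 v = 0" by (intro assms(2)) simp
    then show ?thesis using True by simp
  next
    case False
    then show ?thesis using hdeg_mono[OF 0, of "nat c"] by simp
  qed
next
  case (Suc n)
  show ?case
  proof (cases "c < int (Suc n)")
    case True
    then show ?thesis using Suc.IH hdeg_reduce[OF Suc.prems assms(2)] by simp
  next
    case False
    then show ?thesis using hdeg_mono[OF Suc.prems, of "nat c"] by simp
  qed
qed

text \<open>Converse of \<open>hdeg_emode_low\<close>, by triangularity: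
  \<open>emode (- p) v\<close> equals \<open>Ep 2 p v\<close> plus terms with
  \<open>Ep 2 r v\<close> for \<open>r > p\<close>. Descending from \<open>p > d\<close>, where
  weights rule everything out, gives \<open>Ep 2 p v = 0\<close> for all
  \<open>p > c\<close>.\<close>

lemma emode_low_imp_hdeg:
  assumes v: "hom d v" and 0: "\<And>N. N < - c \<Longrightarrow> emode N v = 0"
  shows "if c < 0 then v = 0 else hdeg (nat c) d v"
proof -
  obtain n where n: "hdeg n d v" using hdeg_ex[OF v] by blast
  have "Ep 2 p v = 0" if "c < int p" for p
    using that
  proof (induction "nat d - p" arbitrary: p rule: less_induct)
    case less
    show ?case
    proof (cases "d < int p")
      case True
      then show ?thesis by (rule Ep_high[OF v])
    next
      case False
      have "emode (- int p) v = emodeb (nat d) (- int p) v"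
        by (rule emode_hom_eq[OF v]) simp
      also have "\<dots> = (\<Sum>r\<in>{p}. h 2 (- int p + int r) * Ep 2 r v)"
        unfolding emodeb_def
      proof (rule sum.mono_neutral_right)
        show "\<forall>r\<in>{..nat d} - {p}. h 2 (- int p + int r) * Ep 2 r v = 0"
        proof
          fix r assume r: "r \<in> {..nat d} - {p}"
          show "h 2 (- int p + int r) * Ep 2 r v = 0"
          proof (cases "r < p")
            case False
            then have "Ep 2 r v = 0" using r less.prems by (intro less.hyps) auto
            then show ?thesis by simp
          qed simp
        qed
      qed (use False in auto)
      finally show ?thesis using 0[of "- int p"] less.prems by simp
    qed
  qed
  then show ?thesis by (intro hdeg_descend[OF n])
qed

section \<open>Associativity and commutation\<close>

lemma wt_part_linear [simp]:
  "wt_part w (f + g) = wt_part w f + wt_part w g" "wt_part w (cst z * f) = cst z * wt_part w f" "wt_part w 0 = 0"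
  "wt_part w (f - g) = wt_part w f - wt_part w g"
  by (auto intro!: mser_eqI simp: cf_wt_part)

lemma wt_part_sum [simp]: "wt_part w (sum f I) = (\<Sum>x\<in>I. wt_part w (f x))"
  by (induction I rule: infinite_finite_induct) auto

lemma wt_part_hom: "hom d f \<Longrightarrow> wt_part w f = (if w = d then f else 0)"
  by (intro mser_eqI) (auto simp: cf_wt_part hom_def)

lemma wt_part_mult_hom:
  assumes "hom q f"
  shows "wt_part w (f * G) = f * wt_part (w - q) G"
proof (rule mser_eqI)
  fix m
  have "cf f p * cf (wt_part (w - q) G) (m - p) = (if wt m = w then cf f p * cf G (m - p) else 0)"
    if "p \<in> {p. p \<subseteq># m}" for p
  proof (cases "cf f p = 0")
    case False
    then have "wt p = q" using assms by (auto simp: hom_def)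
    moreover have "wt m = wt p + wt (m - p)"
      using that by (metis mem_Collect_eq subset_mset.add_diff_inverse wt_simps(3))
    ultimately show ?thesis by (auto simp: cf_wt_part)
  qed simp
  then have "cf (f * wt_part (w - q) G) m = (\<Sum>p\<in>{p. p \<subseteq># m}. if wt m = w then cf f p * cf G (m - p) else 0)"
    unfolding cf_times by (intro sum.cong refl)
  then show "cf (wt_part w (f * G)) m = cf (f * wt_part (w - q) G) m"
    by (simp add: cf_wt_part cf_times)
qed

lemma wt_part_alpha: "wt_part w (alpha j f) = alpha j (wt_part (w + int j) f)"
  by (intro mser_eqI) (auto simp: cf_wt_part cf_alpha)

lemma wt_part_Ep: "wt_part w (Ep a p f) = Ep a p (wt_part (w + int p) f)"
proof (induction p arbitrary: w rule: less_induct)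
  case (less p)
  show ?case
  proof (cases "p = 0")
    case False
    have "wt_part w (alpha n (Ep a (p - n) f)) = alpha n (Ep a (p - n) (wt_part (w + int p) f))" if "n \<in> {1..p}" for n
      using less.IH[of "p - n" "w + int n"] that by (simp add: wt_part_alpha of_nat_diff)
    then show ?thesis
      using False by (subst (1 2) Ep.simps) simp
  qed simp
qed

lemma wt_part_emode: "wt_part w (emode N F) = emode N (wt_part (w - N) F)"
proof (rule mser_eqI)
  fix m
  define B where "B = nat (wt m - N)"
  have "wt_part w (emodeb B N F) = emodeb B N (wt_part (w - N) F)"
  proof -
    have "w - (N + int r) + int r = w - N" for r by simp
    then show ?thesis by (simp add: emodeb_def wt_part_mult_hom[OF hom_h] wt_part_Ep)
  qed
  moreover have "cf (emode N G) m = cf (emodeb B N G) m" for G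
    by (rule cf_emode) (simp add: B_def)
  ultimately show "cf (wt_part w (emode N F)) m = cf (emode N (wt_part (w - N) F)) m"
    by (metis cf_wt_part)
qed

definition posm :: "mser \<Rightarrow> bool" where
  "posm f \<longleftrightarrow> (\<forall>m. 0 \<in># m \<longrightarrow> cf f m = 0)"

lemma posm_mult: "posm f \<Longrightarrow> posm g \<Longrightarrow> posm (f * g)"
  unfolding posm_def by (auto intro: cf_mult_pos)

lemma posm_add: "posm f \<Longrightarrow> posm g \<Longrightarrow> posm (f + g)"
  by (auto simp: posm_def)

lemma posm_sum: "(\<And>x. x \<in> I \<Longrightarrow> posm (f x)) \<Longrightarrow> posm (sum f I)"
  by (auto simp: posm_def)

lemma posm_cst: "posm f \<Longrightarrow> posm (cst z * f)"
  by (auto simp: posm_def)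

lemma bd_posm: "bd d f \<Longrightarrow> posm f"
  by (auto simp: bd_def posm_def)

lemma posm_vopl: "bd (int D) X \<Longrightarrow> posm (vopl D b c ls X)"
proof (induction ls arbitrary: X)
  case Nil
  then show ?case
    by (auto intro!: posm_mult posm_sum bd_posm[OF bd_Ep]) (auto simp: posm_def cf_hbin)
next
  case (Cons l ls)
  have "posm (amin l)" by (auto simp: posm_def amin_def)
  then show ?case using Cons by (auto intro!: posm_add posm_mult bd_aplus)
qed

lemma posm_vop: "bd (int D) X \<Longrightarrow> posm (vop D b c u X)"
  unfolding vop_def by (intro posm_sum posm_cst posm_vopl)

lemma hom_wt_part: "posm f \<Longrightarrow> hom w (wt_part w f)"
  by (auto simp: hom_def posm_def cf_wt_part split: if_splits)

lemma emb_inj: "emb c f = emb c g \<Longrightarrow> f = g"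
proof (rule mser_eqI)
  fix m assume "emb c f = emb c g"
  then have "emb c f (c, m) = emb c g (c, m)" by simp
  then show "cf f m = cf g m" by (simp add: emb_apply)
qed

text \<open>Both truncations compute the same mode by \<open>mode_emb\<close>; \<open>r\<close> is
  chosen so that the mode lands in the weight of \<open>m\<close>.\<close>

lemma vop_indep:
  assumes "hom d u" "hom e X" "d \<le> int D" "e \<le> int D" "d \<le> int D'" "e \<le> int D'"
  shows "vop D (of_int b) (of_int c) u X = vop D' (of_int b) (of_int c) u X"
proof (rule mser_eqI)
  fix m
  define r where "r = of_int (d + e) - of_int (b * c) / 2 - 1 - (of_int (wt m) :: rat)"
  have w: "of_int (wt m) = of_int (d + e) - of_int (b * c) / 2 - r - 1" by (simp add: r_def)
  have "emb (b + c) (wt_part (wt m) (vop D (of_int b) (of_int c) u X)) = emb (b + c) (wt_part (wt m) (vop D' (of_int b) (of_int c) u X))"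
    using mode_emb[OF assms(1,3,2,4) w] mode_emb[OF assms(1,5,2,6) w] by simp
  then have "wt_part (wt m) (vop D (of_int b) (of_int c) u X) = wt_part (wt m) (vop D' (of_int b) (of_int c) u X)"
    by (rule emb_inj)
  then have "cf (wt_part (wt m) (vop D (of_int b) (of_int c) u X)) m = cf (wt_part (wt m) (vop D' (of_int b) (of_int c) u X)) m"
    by simp
  then show "cf (vop D (of_int b) (of_int c) u X) m = cf (vop D' (of_int b) (of_int c) u X) m"
    by (simp add: cf_wt_part)
qed

text \<open>
  The component of weight \<open>w\<close> of \<open>Y(u, 1) X\<close>; by \<open>vop_indep\<close> any other
  admissible truncation gives the same.
\<close>
definition vmode :: "int \<Rightarrow> int \<Rightarrow> int \<Rightarrow> mser \<Rightarrow> mser \<Rightarrow> mser" where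
  "vmode b c w u X = wt_part w (vop (LEAST D. bd (int D) u \<and> bd (int D) X) (of_int b) (of_int c) u X)"

lemma hom_bd_le: "hom d u \<Longrightarrow> bd D u \<Longrightarrow> u \<noteq> 0 \<Longrightarrow> d \<le> D"
  by (metis bd_def cf_ring(1) hom_def mser_eqI)

lemma vmode_eq:
  assumes "hom d u" "hom e X" "d \<le> int D" "e \<le> int D"
  shows "vmode b c w u X = wt_part w (vop D (of_int b) (of_int c) u X)"
proof (cases "u = 0 \<or> X = 0")
  case False
  let ?P = "\<lambda>D. bd (int D) u \<and> bd (int D) X"
  have "?P D" using assms bd_mono[OF hom_bd] by blast
  then have "?P (LEAST D. ?P D)" by (rule LeastI)
  then have "d \<le> int (LEAST D. ?P D)" "e \<le> int (LEAST D. ?P D)"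
    using False hom_bd_le assms by blast+
  then show ?thesis
    unfolding vmode_def using vop_indep[OF assms(1,2) _ _ assms(3,4)] by metis
qed (auto simp: vmode_def)

lemma hom_vmode: "hom d u \<Longrightarrow> hom e X \<Longrightarrow> hom w (vmode b c w u X)"
proof -
  assume u: "hom d u" and X: "hom e X"
  have "vmode b c w u X = wt_part w (vop (nat (max d e)) (of_int b) (of_int c) u X)"
    by (rule vmode_eq[OF u X]) auto
  moreover have "bd (int (nat (max d e))) X" using bd_mono[OF hom_bd[OF X]] by simp
  ultimately show ?thesis using posm_vop hom_wt_part by metis
qed

lemma vmode_imode:
  assumes "hom d u" "hom e X" "even (b * c)" "w = d + e - (b * c) div 2 - n - 1"
  shows "imode (emb b u) n (emb c X) = emb (b + c) (vmode b c w u X)"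
proof -
  define D where "D = nat (max d e)"
  have D: "d \<le> int D" "e \<le> int D" by (auto simp: D_def)
  have "(of_int (b * c) :: rat) / 2 = of_int ((b * c) div 2)"
    using assms(3) by (metis dvd_div_mult_self nonzero_mult_div_cancel_right of_int_mult of_int_numeral zero_neq_numeral)
  then have "(of_int w :: rat) = of_int (d + e) - of_int (b * c) / 2 - of_int n - 1"
    by (simp add: assms(4))
  from mode_emb[OF assms(1) D(1) assms(2) D(2) this] show ?thesis
    unfolding imode_def vmode_eq[OF assms(1,2) D] .
qed

lemma vmode_add:
  assumes "hom d u" "hom d u'" "hom e X" "hom e X'"
  shows "vmode b c w (u + u') X = vmode b c w u X + vmode b c w u' X"
    and "vmode b c w u (X + X') = vmode b c w u X + vmode b c w u X'"
    and "vmode b c w (cst z * u) X = cst z * vmode b c w u X"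
    and "vmode b c w u (cst z * X) = cst z * vmode b c w u X"
proof -
  define D where "D = nat (max d e)"
  have D: "d \<le> int D" "e \<le> int D" by (auto simp: D_def)
  note V = vmode_eq[OF _ _ D]
  show "vmode b c w (u + u') X = vmode b c w u X + vmode b c w u' X"
    using assms by (subst (1 2 3) V) auto
  show "vmode b c w u (X + X') = vmode b c w u X + vmode b c w u X'"
    using assms by (subst (1 2 3) V) auto
  show "vmode b c w (cst z * u) X = cst z * vmode b c w u X"
    using assms by (subst (1 2) V) auto
  show "vmode b c w u (cst z * X) = cst z * vmode b c w u X"
    using assms by (subst (1 2) V) auto
qed

lemma vmode_0 [simp]: "vmode b c w 0 X = 0" "vmode b c w u 0 = 0"
  by (simp_all add: vmode_def)

lemma vmode_sum_right:
  assumes "hom d u" "\<And>x. x \<in> I \<Longrightarrow> hom e (f x)"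
  shows "vmode b c w u (\<Sum>x\<in>I. f x) = (\<Sum>x\<in>I. vmode b c w u (f x))"
  using assms(2)
proof (induction I rule: infinite_finite_induct)
  case (insert x F)
  then have h: "hom e (f x)" "hom e (sum f F)" by auto
  show ?case using insert vmode_add(2)[OF assms(1) assms(1) h, of b c w] by simp
qed auto

lemma vmode_neg: "hom d u \<Longrightarrow> hom e X \<Longrightarrow> w < 0 \<Longrightarrow> vmode b c w u X = 0"
  using hom_neg[OF hom_vmode] by blast

lemma vmode_one:
  assumes "hom e X"
  shows "vmode 0 c w (cst z) X = (if w = e then cst z * X else 0)"
proof -
  define D where "D = nat e"
  have D: "0 \<le> int D" "e \<le> int D" by (auto simp: D_def)
  have "bd (int D) X" using bd_mono[OF hom_bd[OF assms] D(2)] .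
  then have "vmode 0 c w (cst z) X = wt_part w (cst z * X)"
    by (subst vmode_eq[OF hom_const assms D]) (simp add: vop_one)
  then show ?thesis using wt_part_hom[OF assms] by simp
qed

lemma vmode_emode:
  assumes v: "hdeg b d v" and X: "hom e X"
  shows "emode N (vmode (int b) c w v X) = cst ((-1) ^ b) * vmode (int b) (c + 2) (w + N) v (emode (N + int b) X)"
proof -
  define D where "D = nat (max (max d (e + 1)) (e + N + int b))"
  have D: "d \<le> int D" "e < int D" "e + N + int b \<le> int D" "e \<le> int D" "e + (N + int b) \<le> int D"
    by (auto simp: D_def)
  have "emode N (vmode (int b) c w v X) = wt_part (w + N) (emode N (vop D (of_nat b) (of_int c) v X))"
    using vmode_eq[OF hdeg_hom[OF v] X D(1,4)] by (simp add: wt_part_emode)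
  also have "\<dots> = cst ((-1) ^ b) * vmode (int b) (c + 2) (w + N) v (emode (N + int b) X)"
    using vmode_eq[OF hdeg_hom[OF v] hom_emode[OF X] D(1,5), of "int b" "c + 2" "w + N"]
    by (simp add: emode_vop_commute[OF v X D(2,3,1)])
  finally show ?thesis .
qed

lemma vmode_emode_low:
  assumes "hdeg b d v" "hom e X" "N < - (e + int b)"
  shows "emode N (vmode (int b) c w v X) = 0"
proof -
  have "emode (N + int b) X = 0"
    by (rule hom_neg[OF hom_emode[OF assms(2)]]) (use assms(3) in simp)
  then show ?thesis using vmode_emode[OF assms(1,2)] by simp
qed

lemma wt_part_agree: "agree M f g \<Longrightarrow> w \<le> M \<Longrightarrow> wt_part w f = wt_part w g"
  by (intro mser_eqI) (auto simp: agree_def cf_wt_part)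

text \<open>The index set may be any finite superset of the range where terms can be nonzero, since
  \<open>vmode_commute\<close> has to compare two sums with different natural ranges. For
  \<open>M + b < 0\<close> the vector \<open>emode M v\<close> is zero by
  \<open>hdeg_emode_low\<close>.\<close>

lemma vmode_assoc:
  assumes v: "hdeg b d v" and X: "hom e X" and M: "0 \<le> M + int b"
    and I: "finite I" "{- (e + int b)..w} \<subseteq> I"
  shows "vmode (int b + 2) c w (emode M v) X
    = (\<Sum>N\<in>I. cst ((of_int N + of_int c + of_nat b) gchoose nat (M + int b)) * emode N (vmode (int b) c (w - N) v X))"
proof -
  define t where "t = nat (M + int b)"
  have M': "M = int t - int b" using M by (simp add: t_def)
  define D where "D = nat (max (max d (e + 1)) (d + M))"
  have D: "d \<le> int D" "e < int D" "d + int t - int b \<le> int D" "e \<le> int D" "d + M \<le> int D"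
    by (auto simp: D_def M')
  define B where "B = nat (max (w + 1) (e + int b + 1))"
  have B: "w < int B" "e + int b < int B" by (auto simp: B_def)
  let ?g = "\<lambda>N. cst ((of_int N + of_int c + of_nat b) gchoose t) * emode N (vmode (int b) c (w - N) v X)"
  have 0: "?g N = 0" if "N \<notin> {- (e + int b)..w}" for N
  proof (cases "N \<le> w")
    case True
    then have "emode N (vmode (int b) c (w - N) v X) = 0"
      using that by (intro vmode_emode_low[OF v X]) auto
    then show ?thesis by simp
  next
    case False
    then show ?thesis using vmode_neg[OF hdeg_hom[OF v] X] by simp
  qed
  have "vmode (int b + 2) c w (emode M v) X = wt_part w (vop D (of_nat b + 2) (of_int c) (emode (int t - int b) v) X)"
    using vmode_eq[OF hom_emode[OF hdeg_hom[OF v]] X D(5,4)] by (simp add: M')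
  also have "\<dots> = wt_part w (\<Sum>N\<in>{- int B..int B}. cst ((of_int N + of_int c + of_nat b) gchoose t) * emode N (vop D (of_nat b) (of_int c) v X))"
    by (rule wt_part_agree[OF emode_assoc[OF v X D(2,1,3) B(1,2)]]) simp
  also have "\<dots> = (\<Sum>N\<in>{- int B..int B}. ?g N)"
    using vmode_eq[OF hdeg_hom[OF v] X D(1,4), of "int b" c] by (simp add: wt_part_emode)
  also have "\<dots> = (\<Sum>N\<in>{- (e + int b)..w}. ?g N)"
    by (rule sum.mono_neutral_right) (use 0 B in auto)
  also have "\<dots> = (\<Sum>N\<in>I. ?g N)"
    by (rule sum.mono_neutral_left) (use 0 I in auto)
  finally show ?thesis by (simp add: t_def)
qed

lemma h_add: "h (a + b) k = (\<Sum>i\<in>{0..k}. h a i * h b (k - i))"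
proof (rule mser_eqI)
  fix m
  have *: "cf (\<Sum>i\<in>{0..k}. h a i * h b (k - i)) m = (\<Sum>p\<in>{p. p \<subseteq># m}. \<Sum>i\<in>{0..k}. cf (h a i) p * cf (h b (k - i)) (m - p))"
    unfolding cf_sum cf_times by (rule sum.swap)
  have "(\<Sum>i\<in>{0..k}. cf (h a i) p * cf (h b (k - i)) (m - p)) = (if wt m = k then cf (hsum a) p * cf (hsum b) (m - p) else 0)"
    if "p \<in> {p. p \<subseteq># m}" for p
  proof -
    have wm: "wt m = wt p + wt (m - p)"
      using that by (metis mem_Collect_eq subset_mset.add_diff_inverse wt_simps(3))
    have "(\<Sum>i\<in>{0..k}. cf (h a i) p * cf (h b (k - i)) (m - p))
       = (\<Sum>i\<in>{0..k}. if i = wt p then (if wt m = k then cf (hsum a) p * cf (hsum b) (m - p) else 0) else 0)"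
      by (rule sum.cong) (auto simp: cf_h cf_hbin wm)
    also have "\<dots> = (if wt m = k then cf (hsum a) p * cf (hsum b) (m - p) else 0)"
      using wm by auto
    finally show ?thesis .
  qed
  then have "cf (\<Sum>i\<in>{0..k}. h a i * h b (k - i)) m = (if wt m = k then cf (hsum a * hsum b) m else 0)"
    unfolding * by (simp add: cf_times)
  also have "\<dots> = cf (h (a + b) k) m"
    by (simp add: hsum_add[symmetric] cf_hbin cf_h)
  finally show "cf (h (a + b) k) m = cf (\<Sum>i\<in>{0..k}. h a i * h b (k - i)) m" ..
qed

lemma hdeg_h2: "hdeg 2 k (h 2 k)"
proof -
  have "hdeg 2 k (h 1 i * h 1 (k - i))" for i
    using hdeg_h_int[OF hdeg_h_int[OF hdeg_cst[of 1]], of "k - i" i] by (simp add: numeral_2_eq_2)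
  moreover have "h 2 k = (\<Sum>i\<in>{0..k}. h 1 i * h 1 (k - i))"
    using h_add[of 1 1 k] by simp
  ultimately show ?thesis by (simp add: hdeg_sum)
qed

lemma hdeg_emode: "hdeg n w f \<Longrightarrow> hdeg (n + 2) (w + N) (emode N f)"
proof -
  assume f: "hdeg n w f"
  have "hdeg (2 + n) ((N + int r) + (w - int r)) (h 2 (N + int r) * Ep 2 r f)" for r
    by (rule hdeg_mult[OF hdeg_h2 hdeg_Ep[OF f]])
  then have "hdeg (n + 2) (w + N) (h 2 (N + int r) * Ep 2 r f)" for r
    by (simp add: add.commute)
  then have "hdeg (n + 2) (w + N) (emodeb (nat w) N f)"
    unfolding emodeb_def by (intro hdeg_sum)
  then show ?thesis
    using emode_hom_eq[OF hdeg_hom[OF f], of "nat w" N] by simp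
qed

text \<open>What the modes of e^alpha generate from the vacuum, with charge \<open>b\<close> and
  weight \<open>d\<close> recorded. Closure under the modes of all such vectors is
  \<open>wdeg_vmode\<close>.\<close>

inductive wdeg :: "nat \<Rightarrow> int \<Rightarrow> mser \<Rightarrow> bool" where
  wdeg_cst: "wdeg 0 0 (cst z)"
| wdeg_emode: "wdeg b d u \<Longrightarrow> wdeg (b + 2) (d + N) (emode N u)"
| wdeg_add: "wdeg b d u \<Longrightarrow> wdeg b d v \<Longrightarrow> wdeg b d (u + v)"
| wdeg_0: "wdeg b d 0"

lemma wdeg_hdeg: "wdeg b d u \<Longrightarrow> hdeg b d u"
  by (induction rule: wdeg.induct) (auto intro: hdeg.intros hdeg_emode[simplified])

lemma wdeg_hom: "wdeg b d u \<Longrightarrow> hom d u"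
  by (rule hdeg_hom[OF wdeg_hdeg])

lemma wdeg_smult: "wdeg b d u \<Longrightarrow> wdeg b d (cst z * u)"
proof (induction rule: wdeg.induct)
  case (wdeg_cst z')
  then show ?case using wdeg.wdeg_cst[of "z * z'"] by (simp add: cst_simps)
next
  case (wdeg_emode b d u N)
  then show ?case using wdeg.wdeg_emode[of b d "cst z * u" N] by simp
qed (auto simp: distrib_left intro: wdeg.intros)

lemma wdeg_sum: "(\<And>x. x \<in> I \<Longrightarrow> wdeg b d (f x)) \<Longrightarrow> wdeg b d (sum f I)"
  by (induction I rule: infinite_finite_induct) (auto intro: wdeg.intros)

text \<open>Associativity writes a mode of \<open>emode N u\<close> as a combination of modes of
  e^alpha applied after modes of \<open>u\<close>, so the left argument unwinds to a scalar.\<close>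

lemma wdeg_vmode: "wdeg b d u \<Longrightarrow> wdeg b' d' v \<Longrightarrow> wdeg (b + b') w (vmode (int b) (int b') w u v)"
proof (induction arbitrary: w rule: wdeg.induct)
  case (wdeg_cst z)
  then show ?case using vmode_one[OF wdeg_hom[OF wdeg_cst]] by (auto intro: wdeg_smult wdeg_0)
next
  case (wdeg_emode b d u N)
  show ?case
  proof (cases "0 \<le> N + int b")
    case True
    have "vmode (int b + 2) (int b') w (emode N u) v
      = (\<Sum>M\<in>{- (d' + int b)..w}. cst ((of_int M + of_int (int b') + of_nat b) gchoose nat (N + int b)) * emode M (vmode (int b) (int b') (w - M) u v))"
      by (rule vmode_assoc[OF wdeg_hdeg[OF wdeg_emode.hyps] wdeg_hom[OF wdeg_emode.prems] True]) auto
    also have "wdeg (b + b' + 2) w \<dots>"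
    proof (intro wdeg_sum wdeg_smult)
      fix M
      show "wdeg (b + b' + 2) w (emode M (vmode (int b) (int b') (w - M) u v))"
        using wdeg.wdeg_emode[OF wdeg_emode.IH[OF wdeg_emode.prems], of "w - M" M] by simp
    qed
    finally show ?thesis by (simp add: ac_simps)
  next
    case False
    then have "emode N u = 0" by (intro hdeg_emode_low[OF wdeg_hdeg[OF wdeg_emode.hyps]]) simp
    then show ?thesis by (simp add: wdeg_0)
  qed
next
  case (wdeg_add b d u u')
  have "vmode (int b) (int b') w (u + u') v = vmode (int b) (int b') w u v + vmode (int b) (int b') w u' v"
    by (rule vmode_add(1)[OF wdeg_hom[OF wdeg_add.hyps(1)] wdeg_hom[OF wdeg_add.hyps(2)] wdeg_hom[OF wdeg_add.prems] hom_0])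
  then show ?case using wdeg_add wdeg.wdeg_add by simp
qed (simp add: wdeg_0)

text \<open>Induction on the generation of \<open>u\<close>: associativity makes the outermost mode
  of e^alpha act last, where it passes \<open>v\<close> with sign (-1)^b', trivial as
  \<open>b'\<close> is even. \<open>w1'\<close> is the intermediate weight that the opposite order
  must have for the total weight to be the same.\<close>

lemma vmode_commute:
  assumes "wdeg b d u" and v: "hdeg b' d' v" "even b'" and X: "hom e X"
    and w: "w1' = e + (w2 - w1) + int (b * b') div 2"
  shows "vmode (int b) (int b' + c) w2 u (vmode (int b') c w1 v X) = vmode (int b') (int b + c) w2 v (vmode (int b) c w1' u X)"
  using assms(1) w
proof (induction arbitrary: w2 w1' rule: wdeg.induct)
  case (wdeg_cst z)
  have h1: "hom w1 (vmode (int b') c w1 v X)" by (rule hom_vmode[OF hdeg_hom[OF v(1)] X])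
  have "vmode (int b') c w2 v (cst z * X) = cst z * vmode (int b') c w2 v X"
    by (rule vmode_add(4)[OF hdeg_hom[OF v(1)] hdeg_hom[OF v(1)] X X])
  then show ?case
    using wdeg_cst vmode_one[OF h1, of "int b' + c" w2 z] vmode_one[OF X, of c w1' z] by auto
next
  case (wdeg_emode b d u M)
  show ?case
  proof (cases "0 \<le> M + int b")
    case False
    then have "emode M u = 0" by (intro hdeg_emode_low[OF wdeg_hdeg[OF wdeg_emode.hyps]]) simp
    then show ?thesis by simp
  next
    case True
    have u: "hdeg b d u" by (rule wdeg_hdeg[OF wdeg_emode.hyps])
    have "int ((b + 2) * b') div 2 = int (b * b') div 2 + int b'"
      using v(2) by (auto elim!: evenE simp: algebra_simps)
    then have w1': "w1' = e + (w2 - w1) + int (b * b') div 2 + int b'"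
      using wdeg_emode.prems by simp
    define Y where "Y = vmode (int b') c w1 v X"
    have Y: "hom w1 Y" unfolding Y_def by (rule hom_vmode[OF hdeg_hom[OF v(1)] X])
    \<comment> \<open>Wide enough for associativity in charge \<open>b' + c\<close> and, after a
      shift by \<open>b'\<close>, in charge \<open>c\<close>.\<close>
    define I where "I = {min (- (w1 + int b)) (- (e + int b) - int b')..max w2 (w1' - int b')}"
    define g where "g N = ((of_int N + of_int (int b' + c) + of_nat b) gchoose nat (M + int b) :: complex)" for N
    define X2 where "X2 N = vmode (int b) c (w1' - int b' - N) u X" for N
    have X2: "hom (w1' - int b' - N) (X2 N)" for N
      unfolding X2_def by (rule hom_vmode[OF hdeg_hom[OF u] X])
    have "vmode (int b + 2) (int b' + c) w2 (emode M u) Y = (\<Sum>N\<in>I. cst (g N) * emode N (vmode (int b) (int b' + c) (w2 - N) u Y))"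
      unfolding g_def by (rule vmode_assoc[OF u Y True]) (auto simp: I_def)
    also have "\<dots> = (\<Sum>N\<in>I. cst (g N) * vmode (int b') (int b + c + 2) w2 v (emode (N + int b') (X2 N)))"
    proof (intro sum.cong refl arg_cong2[of _ _ _ _ "(*)"])
      fix N
      have "vmode (int b) (int b' + c) (w2 - N) u Y = vmode (int b') (int b + c) (w2 - N) v (X2 N)"
        unfolding Y_def X2_def by (rule wdeg_emode.IH) (simp add: w1')
      then show "emode N (vmode (int b) (int b' + c) (w2 - N) u Y) = vmode (int b') (int b + c + 2) w2 v (emode (N + int b') (X2 N))"
        using vmode_emode[OF v(1) X2, of N "int b + c" "w2 - N" N] v(2) by simp
    qed
    also have "\<dots> = vmode (int b') (int b + c + 2) w2 v (\<Sum>N\<in>I. cst (g N) * emode (N + int b') (X2 N))"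
    proof -
      have hE: "hom w1' (emode (N + int b') (X2 N))" for N
        using hom_emode[OF X2, of N "N + int b'"] by simp
      have "vmode (int b') (int b + c + 2) w2 v (cst (g N) * emode (N + int b') (X2 N)) = cst (g N) * vmode (int b') (int b + c + 2) w2 v (emode (N + int b') (X2 N))" for N
        by (rule vmode_add(4)[OF hdeg_hom[OF v(1)] hdeg_hom[OF v(1)] hE hE])
      then show ?thesis
        by (subst vmode_sum_right[OF hdeg_hom[OF v(1)], of I w1']) (auto intro: hE)
    qed
    also have "(\<Sum>N\<in>I. cst (g N) * emode (N + int b') (X2 N))
       = (\<Sum>N\<in>(\<lambda>N. N + int b') ` I. cst ((of_int N + of_int c + of_nat b) gchoose nat (M + int b)) * emode N (vmode (int b) c (w1' - N) u X))"
      by (subst sum.reindex) (auto simp: inj_on_def g_def X2_def algebra_simps)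
    also have "\<dots> = vmode (int b + 2) c w1' (emode M u) X"
    proof (rule vmode_assoc[OF u X True, symmetric])
      show "{- (e + int b)..w1'} \<subseteq> (\<lambda>N. N + int b') ` I"
      proof
        fix N assume "N \<in> {- (e + int b)..w1'}"
        then show "N \<in> (\<lambda>N. N + int b') ` I"
          by (intro image_eqI[of _ _ "N - int b'"]) (auto simp: I_def)
      qed
    qed (simp add: I_def)
    finally show ?thesis by (simp add: Y_def ac_simps)
  qed
next
  case (wdeg_add b d u u')
  have h: "hom d u" "hom d u'" using wdeg_add.hyps wdeg_hom by auto
  have Y: "hom w1 (vmode (int b') c w1 v X)" by (rule hom_vmode[OF hdeg_hom[OF v(1)] X])
  have z: "hom w1' (vmode (int b) c w1' u X)" "hom w1' (vmode (int b) c w1' u' X)"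
    using hom_vmode[OF h(1) X] hom_vmode[OF h(2) X] by auto
  show ?case
    using vmode_add(1)[OF h Y Y] vmode_add(1)[OF h X X] vmode_add(2)[OF hdeg_hom[OF v(1)] hdeg_hom[OF v(1)] z]
      wdeg_add.IH[OF wdeg_add.prems] by simp
qed simp

section \<open>The quotient in each charge\<close>

text \<open>In \<open>amin l\<close> the coefficient of x_j is a binomial that vanishes for
  \<open>j < l\<close> and is 1 for \<open>j = l\<close>. The lowest term of the field on the vacuum
  is therefore the monomial itself, which is the creation property.\<close>

lemma cf_vopl_vac:
  "0 \<notin> set ls \<Longrightarrow> wt m \<le> wt (mset ls) \<Longrightarrow> cf (vopl D b 0 ls 1) m = (if m = mset ls then 1 else 0)"
proof (induction ls arbitrary: m)
  case Nil
  have "Ep b p 1 = (if p = 0 then 1 else 0)" for p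
    using Ep_const[of b p 1] by simp
  then have "vopl D b 0 [] 1 = hsum b" by simp
  moreover have "cf (hsum b) m = (if m = {#} then 1 else 0)"
    using Nil pos_wt_0[of m] wt_nonneg[of m] by (auto simp: cf_hbin)
  ultimately show ?case by simp
next
  case (Cons l ls)
  have D0: "aplus D 0 l 1 = 0"
    using alpha_const[of _ 1] by (auto simp: aplus_def alphac_def intro!: sum.neutral)
  have *: "((of_nat j - 1) gchoose (l - 1)) * cf (vopl D b 0 ls 1) (m - {#j#}) = (if j = l \<and> m = mset (l # ls) then 1 else 0)"
    if j: "j \<in> set_mset m - {0}" for j
  proof (cases "l \<le> j")
    case True
    have "wt (m - {#j#}) \<le> wt (mset ls)"
      using Cons.prems j True by (simp add: wt_remove)
    then have IH: "cf (vopl D b 0 ls 1) (m - {#j#}) = (if m - {#j#} = mset ls then 1 else 0)"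
      using Cons by simp
    show ?thesis
    proof (cases "m - {#j#} = mset ls")
      case m: True
      then have mj: "m = add_mset j (mset ls)" using j by (metis Diff_iff insert_DiffM)
      then have jl: "j = l" using Cons.prems True by simp
      have "((of_nat l - 1 :: complex) gchoose (l - 1)) = 1"
        using Cons.prems binomial_gbinomial[of "l - 1" "l - 1", where 'a = complex] by (simp add: of_nat_diff Suc_le_eq)
      then show ?thesis using IH m mj jl by simp
    next
      case False
      then show ?thesis using IH by auto
    qed
  next
    case False
    then have "j - 1 < l - 1" using j by auto
    then have "(j - 1) choose (l - 1) = 0" by (rule binomial_eq_0)
    then have "((of_nat j - 1 :: complex) gchoose (l - 1)) = 0"
      using j binomial_gbinomial[of "j - 1" "l - 1", where 'a = complex] by (simp add: of_nat_diff Suc_le_eq binomial_eq_0)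
    then show ?thesis using False by auto
  qed
  have "cf (vopl D b 0 (l # ls) 1) m = (\<Sum>j\<in>set_mset m - {0}. if j = l \<and> m = mset (l # ls) then 1 else 0)"
    unfolding vopl.simps D0 vopl_0 add_0_right cf_amin_times by (rule sum.cong[OF refl *])
  also have "\<dots> = (if m = mset (l # ls) then 1 else 0)"
    using Cons.prems by auto
  finally show ?case .
qed

lemma vmode_creation:
  assumes v: "hom d v" and w: "w \<le> d"
  shows "vmode b 0 w v 1 = (if w = d then v else 0)"
proof (rule mser_eqI)
  fix m
  define D where "D = nat d"
  have D: "d \<le> int D" "0 \<le> int D" by (auto simp: D_def)
  have V: "vmode b 0 w v 1 = wt_part w (vop D (of_int b) 0 v 1)"
    using vmode_eq[OF v hom_1 D] by simp
  show "cf (vmode b 0 w v 1) m = cf (if w = d then v else 0) m"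
  proof (cases "wt m = w")
    case True
    have "cf (vop D (of_int b) 0 v 1) m = (\<Sum>p\<in>parts_le D. cf v p * cf (vopl D (of_int b) 0 (sorted_list_of_multiset p) 1) m)"
      by (simp add: vop_def)
    also have "\<dots> = (\<Sum>p\<in>parts_le D. if p = m then cf v m else 0)"
    proof (rule sum.cong[OF refl])
      fix p assume p: "p \<in> parts_le D"
      show "cf v p * cf (vopl D (of_int b) 0 (sorted_list_of_multiset p) 1) m = (if p = m then cf v m else 0)"
      proof (cases "cf v p = 0")
        case False
        then have "wt p = d" "0 \<notin># p" using v by (auto simp: hom_def)
        then show ?thesis using True w by (subst cf_vopl_vac) auto
      qed auto
    qed
    also have "\<dots> = cf v m"
    proof -
      have "m \<in> parts_le D" if "cf v m \<noteq> 0"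
        using that v D by (auto simp: hom_def parts_le_def)
      then show ?thesis by auto
    qed
    finally have "cf (vmode b 0 w v 1) m = cf v m" using True by (simp add: V cf_wt_part)
    then show ?thesis using v True by (auto simp: hom_def)
  next
    case False
    then show ?thesis using v by (auto simp: V cf_wt_part hom_def)
  qed
qed

lemma wt_part_mult: "wt_part w (F * G) = (\<Sum>q\<in>{0..w}. wt_part q F * wt_part (w - q) G)"
proof (rule mser_eqI)
  fix m
  have "cf (\<Sum>q\<in>{0..w}. wt_part q F * wt_part (w - q) G) m = (\<Sum>p\<in>{p. p \<subseteq># m}. \<Sum>q\<in>{0..w}. cf (wt_part q F) p * cf (wt_part (w - q) G) (m - p))"
    unfolding cf_sum cf_times by (rule sum.swap)
  also have "\<dots> = (\<Sum>p\<in>{p. p \<subseteq># m}. if wt m = w then cf F p * cf G (m - p) else 0)"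
  proof (rule sum.cong[OF refl])
    fix p assume "p \<in> {p. p \<subseteq># m}"
    then have wm: "wt m = wt p + wt (m - p)"
      by (metis mem_Collect_eq subset_mset.add_diff_inverse wt_simps(3))
    have "(\<Sum>q\<in>{0..w}. cf (wt_part q F) p * cf (wt_part (w - q) G) (m - p))
       = (\<Sum>q\<in>{0..w}. if q = wt p then (if wt m = w then cf F p * cf G (m - p) else 0) else 0)"
      by (rule sum.cong) (auto simp: cf_wt_part wm)
    also have "\<dots> = (if wt m = w then cf F p * cf G (m - p) else 0)"
      using wm by auto
    finally show "(\<Sum>q\<in>{0..w}. cf (wt_part q F) p * cf (wt_part (w - q) G) (m - p)) = (if wt m = w then cf F p * cf G (m - p) else 0)" .
  qed
  finally show "cf (wt_part w (F * G)) m = cf (\<Sum>q\<in>{0..w}. wt_part q F * wt_part (w - q) G) m"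
    by (simp add: cf_wt_part cf_times)
qed

lemma wt_part_hbin: "wt_part w (hbin a e k) = cst ((e + of_int w) gchoose k) * h a w"
  by (intro mser_eqI) (auto simp: cf_wt_part cf_hbin cf_h)

text \<open>The coefficient of z_1^i z_2^j in the normally ordered product of e^varpi(z_1) and
  e^varpi(z_2) on \<open>X\<close> of charge \<open>2 * g\<close>. The summand
  \<open>p = q = 0\<close> is the \<open>f_i\<close> of the overview.\<close>

definition hconv :: "nat \<Rightarrow> int \<Rightarrow> mser \<Rightarrow> int \<Rightarrow> int \<Rightarrow> mser" where
  "hconv D g X i j = (\<Sum>p\<le>D. \<Sum>q\<le>D. h 1 (i - g + int p) * (h 1 (j - g + int q) * Ep 1 q (Ep 1 p X)))"

text \<open>The field of the vector is the divided derivative of order \<open>a\<close> in z_1 and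
  \<open>b\<close> in z_2 of the normally ordered product at z_1 = z_2 = 1; these derivatives give
  the two binomials, and the total weight fixes \<open>i + j = s\<close>.\<close>

lemma vmode_hh:
  assumes X: "hom e X" "e \<le> int D" and ab: "a + b \<le> D" and I: "finite I" "{g - int D..s - g + int D} \<subseteq> I"
    and w: "w = s + e - 2 * g"
  shows "vmode 2 (2 * g) w (h 1 (int a) * h 1 (int b)) X
    = (\<Sum>i\<in>I. cst ((of_int i gchoose a) * (of_int (s - i) gchoose b)) * hconv D g X i (s - i))"
proof -
  let ?c = "of_int (2 * g) :: complex"
  have bX: "bd (int D) X" using bd_mono[OF hom_bd[OF X(1)] X(2)] .
  have bR: "bd (int D) (Ep 1 p X)" for p using bd_mono[OF bd_Ep[OF bX]] by simp
  have bRR: "bd (int D) (Ep 1 q (Ep 1 p X))" for p q using bd_mono[OF bd_Ep[OF bR]] by simp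
  have u: "hom (int a + int b) (h 1 (int a) * h 1 (int b))" by (rule hom_mult[OF hom_h hom_h])
  have 1: "vop D 1 ?c (h 1 (int b)) Z = (\<Sum>q\<le>D. hbin 1 (of_int g - of_nat q) b * Ep 1 q Z)" if "bd (int D) Z" for Z
  proof -
    have "bd (int D) (Ep 1 q Z)" for q using bd_mono[OF bd_Ep[OF that]] by simp
    then have "vop D 0 ?c 1 (Ep 1 q Z) = Ep 1 q Z" for q
      using vop_one[of D _ ?c 1] by simp
    then show ?thesis
      using vop_h[OF hom_bd[OF hom_1] _ that, of b 1 0 ?c] ab by simp
  qed
  have "vop D 2 ?c (h 1 (int a) * h 1 (int b)) X = (\<Sum>p\<le>D. hbin 1 (of_int g - of_nat p) a * vop D 1 ?c (h 1 (int b)) (Ep 1 p X))"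
    using vop_h[OF hom_bd[OF hom_h] _ bX, of "int b" a 1 1 ?c 1] ab by simp
  also have "\<dots> = (\<Sum>p\<le>D. \<Sum>q\<le>D. (hbin 1 (of_int g - of_nat p) a * hbin 1 (of_int g - of_nat q) b) * Ep 1 q (Ep 1 p X))"
    by (simp only: 1[OF bR] sum_distrib_left mult.assoc)
  finally have Y: "vop D 2 ?c (h 1 (int a) * h 1 (int b)) X
    = (\<Sum>p\<le>D. \<Sum>q\<le>D. Ep 1 q (Ep 1 p X) * (hbin 1 (of_int g - of_nat p) a * hbin 1 (of_int g - of_nat q) b))"
    by (simp only: mult.commute)
  have summand: "wt_part w (Ep 1 q (Ep 1 p X) * (hbin 1 (of_int g - of_nat p) a * hbin 1 (of_int g - of_nat q) b))
     = (\<Sum>i\<in>I. cst ((of_int i gchoose a) * (of_int (s - i) gchoose b)) * (h 1 (i - g + int p) * (h 1 (s - i - g + int q) * Ep 1 q (Ep 1 p X))))"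
    if pq: "p \<le> D" "q \<le> D" for p q
  proof -
    define G where "G = Ep 1 q (Ep 1 p X)"
    define v where "v = w - (e - int p - int q)"
    have G: "hom (e - int p - int q) G" unfolding G_def by (intro hom_Ep X(1))
    have "wt_part w (G * (hbin 1 (of_int g - of_nat p) a * hbin 1 (of_int g - of_nat q) b))
      = G * (\<Sum>k\<in>{0..v}. (cst ((of_int g - of_nat p + of_int k) gchoose a) * h 1 k) * (cst ((of_int g - of_nat q + of_int (v - k)) gchoose b) * h 1 (v - k)))"
      unfolding wt_part_mult_hom[OF G] unfolding wt_part_mult wt_part_hbin v_def ..
    also have "\<dots> = (\<Sum>k\<in>{0..v}. cst (((of_int g - of_nat p + of_int k) gchoose a) * ((of_int g - of_nat q + of_int (v - k)) gchoose b)) * (h 1 k * (h 1 (v - k) * G)))"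
      by (simp add: sum_distrib_left cst_simps ac_simps)
    also have "\<dots> = (\<Sum>i\<in>{g - int p..g - int p + v}. cst ((of_int i gchoose a) * (of_int (s - i) gchoose b)) * (h 1 (i - g + int p) * (h 1 (s - i - g + int q) * G)))"
    proof (rule sum.reindex_bij_witness[of _ "\<lambda>i. i - g + int p" "\<lambda>k. g - int p + k"], goal_cases)
      case (5 k)
      have "s - (g - int p + k) - g + int q = v - k" "g - int p + k - g + int p = k" by (simp_all add: v_def w)
      moreover have "(of_int (s - (g - int p + k)) :: complex) = of_int g - of_nat q + of_int (v - k)"
        "(of_int (g - int p + k) :: complex) = of_int g - of_nat p + of_int k"
        by (simp_all add: v_def w)
      ultimately show ?case by (simp only:)
    qed auto
    also have "\<dots> = (\<Sum>i\<in>I. cst ((of_int i gchoose a) * (of_int (s - i) gchoose b)) * (h 1 (i - g + int p) * (h 1 (s - i - g + int q) * G)))"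
    proof (rule sum.mono_neutral_left)
      show "{g - int p..g - int p + v} \<subseteq> I"
        using pq I(2) by (auto simp: v_def w intro!: subsetD[OF I(2)])
      show "\<forall>i\<in>I - {g - int p..g - int p + v}. cst ((of_int i gchoose a) * (of_int (s - i) gchoose b)) * (h 1 (i - g + int p) * (h 1 (s - i - g + int q) * G)) = 0"
      proof
        fix i assume "i \<in> I - {g - int p..g - int p + v}"
        then have "i - g + int p < 0 \<or> s - i - g + int q < 0" by (auto simp: v_def w)
        then show "cst ((of_int i gchoose a) * (of_int (s - i) gchoose b)) * (h 1 (i - g + int p) * (h 1 (s - i - g + int q) * G)) = 0"
          by auto
      qed
    qed (rule I(1))
    finally show ?thesis by (simp add: G_def)
  qed
  have "vmode 2 (2 * g) w (h 1 (int a) * h 1 (int b)) X = wt_part w (vop D 2 ?c (h 1 (int a) * h 1 (int b)) X)"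
    using vmode_eq[OF u X(1) _ X(2)] ab by simp
  also have "\<dots> = (\<Sum>p\<le>D. \<Sum>q\<le>D. \<Sum>i\<in>I. cst ((of_int i gchoose a) * (of_int (s - i) gchoose b)) * (h 1 (i - g + int p) * (h 1 (s - i - g + int q) * Ep 1 q (Ep 1 p X))))"
    unfolding Y wt_part_sum by (intro sum.cong refl summand) auto
  also have "\<dots> = (\<Sum>p\<le>D. \<Sum>i\<in>I. \<Sum>q\<le>D. cst ((of_int i gchoose a) * (of_int (s - i) gchoose b)) * (h 1 (i - g + int p) * (h 1 (s - i - g + int q) * Ep 1 q (Ep 1 p X))))"
    by (rule sum.cong[OF refl], rule sum.swap)
  also have "\<dots> = (\<Sum>i\<in>I. \<Sum>p\<le>D. \<Sum>q\<le>D. cst ((of_int i gchoose a) * (of_int (s - i) gchoose b)) * (h 1 (i - g + int p) * (h 1 (s - i - g + int q) * Ep 1 q (Ep 1 p X))))"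
    by (rule sum.swap)
  finally show ?thesis by (simp add: hconv_def sum_distrib_left)
qed

text \<open>For \<open>0 <= i <= s\<close> both binomials are nonzero only if
  \<open>a <= i <= s - b\<close>, and \<open>s = a + b + 1\<close>, the value belonging to the
  (-2)-product, leaves two indices. Outside this range an upper entry is negative and the binomials
  need not vanish.\<close>

lemma two_term:
  assumes I: "finite I" "{0..int s} \<subseteq> I" and s: "s = a + b + 1"
  shows "(\<Sum>i\<in>I. cst ((of_int i gchoose a) * (of_int (int s - i) gchoose b)) * F i)
     = cst (of_nat b + 1) * F (int a) + cst (of_nat a + 1) * F (int a + 1)
       + (\<Sum>i\<in>I - {0..int s}. cst ((of_int i gchoose a) * (of_int (int s - i) gchoose b)) * F i)"
proof -
  let ?t = "\<lambda>i. cst ((of_int i gchoose a) * (of_int (int s - i) gchoose b)) * F i"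
  have co: "((of_int (int i) :: complex) gchoose a) * (of_int (int s - int i) gchoose b) = of_nat ((i choose a) * ((s - i) choose b))"
    if "i \<le> s" for i
    using that by (simp add: binomial_gbinomial of_nat_diff)
  have "(\<Sum>i\<in>I. ?t i) = (\<Sum>i\<in>{0..int s}. ?t i) + (\<Sum>i\<in>I - {0..int s}. ?t i)"
    using sum.subset_diff[OF I(2,1), of ?t] by (simp only: add.commute)
  also have "(\<Sum>i\<in>{0..int s}. ?t i) = (\<Sum>i\<in>{int a, int a + 1}. ?t i)"
  proof (rule sum.mono_neutral_right)
    show "\<forall>i\<in>{0..int s} - {int a, int a + 1}. ?t i = 0"
    proof
      fix i assume i: "i \<in> {0..int s} - {int a, int a + 1}"
      then obtain k where k: "i = int k" using nonneg_int_cases[of i] by auto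
      have "k < a \<or> s - k < b" using i k s by auto
      then show "?t i = 0" unfolding k using i k by (subst co) (auto simp: binomial_eq_0)
    qed
  qed (use s in auto)
  also have "\<dots> = ?t (int a) + ?t (int a + 1)" by simp
  also have "?t (int a) = cst (of_nat b + 1) * F (int a)"
    using co[of a] s by (simp add: add.commute)
  also have "?t (int a + 1) = cst (of_nat a + 1) * F (int a + 1)"
    using co[of "a + 1"] s by (simp add: add.commute)
  finally show ?thesis .
qed

lemma vmode_hh_vac:
  "vmode 2 0 (int a + int b + 1) (h 1 (int a) * h 1 (int b)) 1
    = cst (of_nat b + 1) * (h 1 (int a) * h 1 (int b + 1)) + cst (of_nat a + 1) * (h 1 (int a + 1) * h 1 (int b))"
proof -
  define D where "D = a + b + 1"
  have Ep1: "Ep 1 p 1 = (if p = 0 then 1 else 0)" for p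
    using Ep_const[of 1 p 1] by simp
  have F: "hconv D 0 1 i j = h 1 i * h 1 j" for i j
  proof -
    have "(\<Sum>q\<le>D. h 1 (i - 0 + int p) * (h 1 (j - 0 + int q) * Ep 1 q (Ep 1 p 1))) = (if p = 0 then h 1 i * h 1 j else 0)" for p
    proof (cases "p = 0")
      case True
      then have "(\<Sum>q\<le>D. h 1 (i - 0 + int p) * (h 1 (j - 0 + int q) * Ep 1 q (Ep 1 p 1))) = (\<Sum>q\<le>D. if q = 0 then h 1 i * h 1 j else 0)"
        by (intro sum.cong refl) (auto simp: Ep1)
      then show ?thesis using True by simp
    qed (simp add: Ep1)
    then show ?thesis by (simp add: hconv_def)
  qed
  have "vmode 2 (2 * 0) (int a + int b + 1) (h 1 (int a) * h 1 (int b)) 1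
    = (\<Sum>i\<in>{- int D..int D + int D}. cst ((of_int i gchoose a) * (of_int (int D - i) gchoose b)) * hconv D 0 1 i (int D - i))"
    by (rule vmode_hh[OF hom_1]) (auto simp: D_def)
  also have "\<dots> = cst (of_nat b + 1) * hconv D 0 1 (int a) (int D - int a) + cst (of_nat a + 1) * hconv D 0 1 (int a + 1) (int D - (int a + 1))
     + (\<Sum>i\<in>{- int D..int D + int D} - {0..int D}. cst ((of_int i gchoose a) * (of_int (int D - i) gchoose b)) * hconv D 0 1 i (int D - i))"
    by (rule two_term) (auto simp: D_def)
  also have "(\<Sum>i\<in>{- int D..int D + int D} - {0..int D}. cst ((of_int i gchoose a) * (of_int (int D - i) gchoose b)) * hconv D 0 1 i (int D - i)) = 0"
    by (rule sum.neutral) (auto simp: F)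
  also have "int D - int a = int b + 1" by (simp add: D_def)
  also have "int D - (int a + 1) = int b" by (simp add: D_def)
  finally show ?thesis by (simp add: F)
qed

section \<open>Reduction modulo a subspace that contains the (-2)-products\<close>

definition subsp :: "(mser \<Rightarrow> bool) \<Rightarrow> bool" where
  "subsp Q \<longleftrightarrow> Q 0 \<and> (\<forall>f g. Q f \<longrightarrow> Q g \<longrightarrow> Q (f + g)) \<and> (\<forall>z f. Q f \<longrightarrow> Q (cst z * f))"

lemma subsp_sum: "subsp Q \<Longrightarrow> (\<And>x. x \<in> I \<Longrightarrow> Q (f x)) \<Longrightarrow> Q (sum f I)"
  by (induction I rule: infinite_finite_induct) (auto simp: subsp_def)

lemma subsp_diff: "subsp Q \<Longrightarrow> Q f \<Longrightarrow> Q g \<Longrightarrow> Q (f - g)"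
proof -
  assume "subsp Q" "Q f" "Q g"
  then have "Q (f + cst (-1) * g)" by (simp add: subsp_def)
  then show ?thesis by (simp add: cst_simps)
qed

lemma subsp_cancel: "subsp Q \<Longrightarrow> Q (cst z * f) \<Longrightarrow> z \<noteq> 0 \<Longrightarrow> Q f"
proof -
  assume "subsp Q" "Q (cst z * f)" and z: "z \<noteq> 0"
  then have "Q (cst (1 / z) * (cst z * f))" by (simp add: subsp_def)
  then show ?thesis using z by (simp add: cst_cst)
qed

lemma hdeg_Suc_span:
  assumes "subsp Q" "\<And>k w' g. hdeg n w' g \<Longrightarrow> w' + int k = w \<Longrightarrow> Q (h 1 (int k) * g)" "hdeg (Suc n) w f"
  shows "Q f"
proof -
  have "hdeg m w' f \<Longrightarrow> m = Suc n \<Longrightarrow> w' = w \<Longrightarrow> Q f" for m w'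
    by (induction rule: hdeg.induct) (use assms(1,2) in \<open>auto simp: subsp_def\<close>)
  then show ?thesis using assms(3) by blast
qed

lemma hh_reduce:
  assumes Q: "subsp Q" and g: "0 < g"
    and gen: "\<And>a b e X. hdeg (2 * g) e X \<Longrightarrow>
      Q (vmode 2 (2 * int g) (int a + int b + 1 + e - 2 * int g) (h 1 (int a) * h 1 (int b)) X)"
    and X: "hdeg (2 * g) e X"
  shows "Q (h 1 x * (h 1 y * X))"
  using X
proof (induction "nat e" arbitrary: e X x y rule: less_induct)
  case less
  have Q0: "Q 0" using Q by (simp add: subsp_def)
  have Xh: "hom e X" using hdeg_hom[OF less.prems] .
  show ?case
  proof (cases "x < 0 \<or> y < 0 \<or> e < 0")
    case True
    then show ?thesis using Q0 hom_neg[OF Xh] by auto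
  next
    case False
    define s where "s = nat (x + y) + 2 * g"
    have s: "int s = x + y + 2 * int g" using False by (simp add: s_def)
    define D where "D = nat e + s"
    have D: "e \<le> int D" "s \<le> D" by (auto simp: D_def)
    define F where "F i = hconv D (int g) X i (int s - i)" for i
    define l where "l i = h 1 (i - int g) * (h 1 (int s - i - int g) * X)" for i
    have lead: "Q (F i - l i)" for i
    proof -
      let ?t = "\<lambda>(p, q). h 1 (i - int g + int p) * (h 1 (int s - i - int g + int q) * Ep 1 q (Ep 1 p X))"
      have "F i = (\<Sum>pq\<in>{..D} \<times> {..D}. ?t pq)"
        by (simp add: F_def hconv_def sum.cartesian_product)
      also have "\<dots> = ?t (0, 0) + (\<Sum>pq\<in>{..D} \<times> {..D} - {(0, 0)}. ?t pq)"
        by (rule sum.remove) auto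
      finally have "F i - l i = (\<Sum>pq\<in>{..D} \<times> {..D} - {(0, 0)}. ?t pq)"
        by (simp add: l_def)
      also have "Q \<dots>"
      proof (rule subsp_sum[OF Q])
        fix pq assume pq: "pq \<in> {..D} \<times> {..D} - {(0::nat, 0::nat)}"
        obtain p q where pq': "pq = (p, q)" by (cases pq)
        have K: "hdeg (2 * g) (e - int p - int q) (Ep 1 q (Ep 1 p X))" by (intro hdeg_Ep less.prems)
        show "Q (?t pq)"
        proof (cases "e - int p - int q < 0")
          case True
          then have "Ep 1 q (Ep 1 p X) = 0" using hom_neg[OF hdeg_hom[OF K]] by simp
          then show ?thesis using Q0 by (simp add: pq')
        next
          case False
          then have "nat (e - int p - int q) < nat e" using pq pq' by auto
          then show ?thesis using less.hyps[OF _ K] by (simp add: pq')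
        qed
      qed
      finally show ?thesis .
    qed
    have Qadd: "Q f \<Longrightarrow> Q f' \<Longrightarrow> Q (f + f')" for f f' using Q by (simp add: subsp_def)
    \<comment> \<open>Here the leading term has a negative index. For \<open>g > 0\<close> this
      starts the chain at \<open>F 0\<close> and also disposes of the indices outside
      \<open>0..s\<close> left over by \<open>two_term\<close>.\<close>
    have out: "Q (F i)" if "i < int g \<or> int s - i < int g" for i
    proof -
      have "l i = 0" using that by (auto simp: l_def)
      then show ?thesis using lead[of i] by simp
    qed
    have rel: "Q (cst (of_nat b + 1) * F (int a) + cst (of_nat a + 1) * F (int a + 1))" if "a + b + 1 = s" for a b
    proof -
      define I where "I = {min 0 (int g - int D)..max (int s) (int s - int g + int D)}"
      have V: "vmode 2 (2 * int g) (int s + e - 2 * int g) (h 1 (int a) * h 1 (int b)) X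
        = (\<Sum>i\<in>I. cst ((of_int i gchoose a) * (of_int (int s - i) gchoose b)) * F i)"
        unfolding F_def by (rule vmode_hh[OF Xh D(1)]) (use that D in \<open>auto simp: I_def\<close>)
      also have "\<dots> = cst (of_nat b + 1) * F (int a) + cst (of_nat a + 1) * F (int a + 1)
       + (\<Sum>i\<in>I - {0..int s}. cst ((of_int i gchoose a) * (of_int (int s - i) gchoose b)) * F i)"
        by (rule two_term) (use that in \<open>auto simp: I_def\<close>)
      finally have "cst (of_nat b + 1) * F (int a) + cst (of_nat a + 1) * F (int a + 1)
        = vmode 2 (2 * int g) (int s + e - 2 * int g) (h 1 (int a) * h 1 (int b)) X
         - (\<Sum>i\<in>I - {0..int s}. cst ((of_int i gchoose a) * (of_int (int s - i) gchoose b)) * F i)" by simp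
      also have "Q \<dots>"
      proof (rule subsp_diff[OF Q])
        have "int a + int b + 1 = int s" using that by simp
        then show "Q (vmode 2 (2 * int g) (int s + e - 2 * int g) (h 1 (int a) * h 1 (int b)) X)"
          using gen[OF less.prems, of a b] by simp
        show "Q (\<Sum>i\<in>I - {0..int s}. cst ((of_int i gchoose a) * (of_int (int s - i) gchoose b)) * F i)"
        proof (rule subsp_sum[OF Q])
          fix i assume "i \<in> I - {0..int s}"
          then have "Q (F i)" using g by (intro out) auto
          then show "Q (cst ((of_int i gchoose a) * (of_int (int s - i) gchoose b)) * F i)"
            using Q by (simp add: subsp_def)
        qed
      qed
      finally show ?thesis .
    qed
    have all: "k \<le> s \<Longrightarrow> Q (F (int k))" for k
    proof (induction k)
      case 0
      show ?case by (rule out) (use g in simp)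
    next
      case (Suc k)
      then have "Q (F (int k))" by simp
      then have 1: "Q (cst (of_nat (s - Suc k) + 1) * F (int k))" using Q by (simp add: subsp_def)
      have "Q (cst (of_nat (s - Suc k) + 1) * F (int k) + cst (of_nat k + 1) * F (int k + 1))"
        by (rule rel) (use Suc in simp)
      from subsp_diff[OF Q this 1] have "Q (cst (of_nat k + 1) * F (int k + 1))" by simp
      moreover have "(of_nat k + 1 :: complex) \<noteq> 0"
        using of_nat_neq_0[of k, where 'a = complex] by (simp add: add.commute)
      ultimately show ?case using subsp_cancel[OF Q] by (simp add: add.commute)
    qed
    have "nat x \<le> nat (x + y)" using False by (intro nat_mono) simp
    then have "Q (F (x + int g))"
      using all[of "nat x + g"] False by (simp add: s_def)
    from subsp_diff[OF Q this lead[of "x + int g"]] have "Q (l (x + int g))" by simp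
    then show ?thesis by (simp add: l_def s)
  qed
qed

lemma hdeg_reduce_high:
  assumes Q: "subsp Q" and g: "0 < g"
    and gen: "\<And>a b e X. hdeg (2 * g) e X \<Longrightarrow>
      Q (vmode 2 (2 * int g) (int a + int b + 1 + e - 2 * int g) (h 1 (int a) * h 1 (int b)) X)"
    and f: "hdeg (2 * g + 2) w f"
  shows "Q f"
proof -
  have hr: "Q (h 1 x * (h 1 y * X))" if "hdeg (2 * g) e X" for x y e X
  proof (rule hh_reduce[OF Q g _ that])
    fix a b e X
    assume "hdeg (2 * g) e X"
    then show "Q (vmode 2 (2 * int g) (int a + int b + 1 + e - 2 * int g) (h 1 (int a) * h 1 (int b)) X)"
      by (rule gen)
  qed
  have 1: "Q (h 1 (int k) * f')" if f': "hdeg (Suc (2 * g)) w' f'" for k w' f'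
  proof (rule hdeg_Suc_span[where Q = "\<lambda>f. Q (h 1 (int k) * f)", OF _ _ f'])
    show "subsp (\<lambda>f. Q (h 1 (int k) * f))"
      using Q by (simp add: subsp_def distrib_left mult.left_commute)
    fix k' w'' X assume "hdeg (2 * g) w'' X"
    then show "Q (h 1 (int k) * (h 1 (int k') * X))" by (rule hr)
  qed
  have "hdeg (Suc (Suc (2 * g))) w f" using f by simp
  then show ?thesis
  proof (rule hdeg_Suc_span[OF Q, rotated])
    fix k w' f' assume "hdeg (Suc (2 * g)) w' f'"
    then show "Q (h 1 (int k) * f')" by (rule 1)
  qed
qed

text \<open>e^varpi(-n-1) creates \<open>h 1 n\<close> from the vacuum; the second e^varpi contracts
  with it through (1 - t)^(1/2), because (varpi, varpi) = 1/2.\<close>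

definition phi_ser :: "nat \<Rightarrow> mser" where
  "phi_ser n = (\<Sum>p\<le>n. cst (binc (1 / 2) p) * (h 1 (int n + int p) * h 1 (int n - int p)))"

lemma hdeg_phi_ser: "hdeg 2 (2 * int n) (phi_ser n)"
  unfolding phi_ser_def
proof (intro hdeg_sum hdeg_smult)
  fix p
  have "hdeg (Suc (Suc 0)) (0 + (int n - int p) + (int n + int p)) (h 1 (int n + int p) * (h 1 (int n - int p) * cst 1))"
    by (intro hdeg_h_int hdeg_cst)
  then show "hdeg 2 (2 * int n) (h 1 (int n + int p) * h 1 (int n - int p))"
    by (simp add: numeral_2_eq_2)
qed

lemma vop_exp: "bd (int D) X \<Longrightarrow> vop D 1 c 1 X = hsum 1 * (\<Sum>p\<le>D. Ep 1 p X)"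
proof -
  assume X: "bd (int D) X"
  have "bd (int D) (\<Sum>p\<le>D. Ep 1 p X)"
  proof (rule bd_sum)
    fix p show "bd (int D) (Ep 1 p X)" using bd_mono[OF bd_Ep[OF X]] by simp
  qed
  from vop_one[OF this, of c 1] show ?thesis
    using vop_charge[OF X, of 1 0 c 1] by simp
qed

lemma phi_eq: "phi n = emb 2 (phi_ser n)"
proof -
  have evp: "evarpi = emb 1 1" and vacp: "vac = emb 0 1"
    by (simp_all add: evarpi_def vac_def bas_emb)
  have b1: "bd (int D) 1" for D by (rule bd_mono[OF hom_bd[OF hom_1]]) simp
  have Ep1: "Ep 1 p 1 = (if p = 0 then 1 else 0)" for p
    using Ep_const[of 1 p 1] by simp
  have 1: "mode evarpi (- of_nat n - 1) vac = emb 1 (h 1 (int n))"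
  proof -
    have "mode (emb 1 1) (- of_nat n - 1) (emb 0 1) = emb (1 + 0) (wt_part (int n) (vop n (of_int 1) (of_int 0) 1 1))"
      by (rule mode_emb[OF hom_1 _ hom_1]) auto
    also have "vop n (of_int 1) (of_int 0) 1 1 = hsum 1"
      using vop_exp[OF b1, of n 0] by (simp add: Ep1)
    finally show ?thesis by (simp add: evp vacp wt_part_hbin)
  qed
  have bh: "bd (int (n + n)) (h 1 (int n))" by (rule bd_mono[OF hom_bd[OF hom_h]]) simp
  have "mode (emb 1 1) (- of_nat n - 3 / 2) (emb 1 (h 1 (int n)))
    = emb (1 + 1) (wt_part (2 * int n) (vop (n + n) (of_int 1) (of_int 1) 1 (h 1 (int n))))"
    by (rule mode_emb[OF hom_1 _ hom_h]) auto
  also have "wt_part (2 * int n) (vop (n + n) (of_int 1) (of_int 1) 1 (h 1 (int n))) = phi_ser n"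
  proof -
    have Rh: "Ep 1 p (h 1 (int n)) = cst (binc (1 / 2) p) * h 1 (int n - int p)" for p
    proof -
      have "Ep 1 p (h 1 (int n) * 1) = (\<Sum>j\<le>p. if j = p then cst (binc (1 / 2) p) * h 1 (int n - int p) else 0)"
        unfolding Ep_h by (intro sum.cong refl) (auto simp: Ep1)
      then show ?thesis by simp
    qed
    have "vop (n + n) (of_int 1) (of_int 1) 1 (h 1 (int n)) = (\<Sum>p\<le>n + n. cst (binc (1 / 2) p) * (h 1 (int n - int p) * hsum 1))"
      using vop_exp[OF bh, of 1] by (simp add: Rh sum_distrib_left ac_simps)
    then have "wt_part (2 * int n) (vop (n + n) (of_int 1) (of_int 1) 1 (h 1 (int n)))
      = (\<Sum>p\<le>n + n. cst (binc (1 / 2) p) * (h 1 (int n - int p) * h 1 (2 * int n - (int n - int p))))"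
      by (simp add: wt_part_mult_hom[OF hom_h] wt_part_hbin)
    also have "\<dots> = (\<Sum>p\<le>n. cst (binc (1 / 2) p) * (h 1 (int n - int p) * h 1 (2 * int n - (int n - int p))))"
      by (rule sum.mono_neutral_right) auto
    also have "\<dots> = phi_ser n"
      unfolding phi_ser_def
    proof (rule sum.cong[OF refl])
      fix p
      have "2 * int n - (int n - int p) = int n + int p" by simp
      then show "cst (binc (1 / 2) p) * (h 1 (int n - int p) * h 1 (2 * int n - (int n - int p)))
        = cst (binc (1 / 2) p) * (h 1 (int n + int p) * h 1 (int n - int p))"
        by (simp only: mult.commute)
    qed
    finally show ?thesis .
  qed
  finally show ?thesis
    unfolding phi_def 1 by (simp add: evp)
qed

text \<open>Up to the sign (-1)^n, the multiple of \<open>h 1 0 * h 1 (2 * n)\<close> to which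
  \<open>phi_ser n\<close> reduces modulo (-2)-products in charge 2.\<close>

definition kappa :: "nat \<Rightarrow> complex" where
  "kappa n = (1 / 2 + of_nat (2 * n)) gchoose n"

lemma kappa_nonzero: "kappa n \<noteq> 0"
proof -
  have "fact n * kappa n = (\<Prod>i = 0..<n. 1 / 2 + of_nat (2 * n) - of_nat i)"
    unfolding kappa_def by (rule gbinomial_mult_fact)
  also have "\<dots> \<noteq> 0"
  proof (subst prod_zero_iff, simp, rule notI, elim bexE)
    fix i assume "i \<in> {0..<n}" and 0: "1 / 2 + of_nat (2 * n) - of_nat i = (0 :: complex)"
    from arg_cong[OF 0, of Re] have "1 / 2 + 2 * real n - real i = 0" by simp
    moreover have "real i < real n" using \<open>i \<in> {0..<n}\<close> by simp
    ultimately show False by linarith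
  qed
  finally show ?thesis by auto
qed

lemma kappa_sum: "(\<Sum>p\<le>n. ((1 / 2 :: complex) gchoose p) * of_nat ((2 * n) choose (n - p))) = kappa n"
  using gbinomial_Vandermonde[of "1 / 2 :: complex" "of_nat (2 * n)" n]
  by (simp add: kappa_def binomial_gbinomial atMost_atLeast0)

text \<open>The two-term recursion gives \<open>G i = (-1)^i * (N choose i) * G 0\<close> modulo
  \<open>Q\<close>. For odd \<open>N\<close> the symmetry \<open>G N = G 0\<close> makes
  \<open>2 * G 0\<close> vanish; for even \<open>N\<close> the series \<open>phi_ser n\<close> is a
  nonzero multiple of \<open>G 0\<close>.\<close>

lemma charge2_span:
  assumes Q: "subsp Q"
    and gen: "\<And>a b. Q (vmode 2 0 (int a + int b + 1) (h 1 (int a) * h 1 (int b)) 1)"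
    and f: "hdeg 2 w f"
  shows "\<exists>z n. Q (f - cst z * phi_ser n)"
proof -
  have Q0: "Q 0" and Qadd: "\<And>f g. Q f \<Longrightarrow> Q g \<Longrightarrow> Q (f + g)" and Qc: "\<And>z f. Q f \<Longrightarrow> Q (cst z * f)"
    using Q by (auto simp: subsp_def)
  have Qd: "\<And>f g. Q f \<Longrightarrow> Q g \<Longrightarrow> Q (f - g)" by (rule subsp_diff[OF Q])
  show ?thesis
  proof (cases "w < 0")
    case True
    then have "f = 0" using hom_neg[OF hdeg_hom[OF f]] by simp
    then show ?thesis using Q0 by (intro exI[of _ 0]) simp
  next
    case False
    define N where "N = nat w"
    have w: "w = int N" using False by (simp add: N_def)
    define G where "G i = h 1 (int i) * h 1 (int N - int i)" for i
    have rel: "Q (cst (of_nat (N - i)) * G i + cst (of_nat (Suc i)) * G (Suc i))" if "i < N" for i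
    proof -
      have e: "int (N - Suc i) + 1 = int N - int i" "int (N - Suc i) = int N - int (Suc i)" "int i + 1 = int (Suc i)"
        using that by (auto simp: of_nat_diff)
      have c: "(of_nat (N - Suc i) + 1 :: complex) = of_nat (N - i)" "(of_nat i + 1 :: complex) = of_nat (Suc i)"
        using that by (simp_all add: of_nat_diff Suc_le_eq)
      have "vmode 2 0 (int i + int (N - Suc i) + 1) (h 1 (int i) * h 1 (int (N - Suc i))) 1
        = cst (of_nat (N - i)) * G i + cst (of_nat (Suc i)) * G (Suc i)"
        unfolding vmode_hh_vac c G_def e(1) e(3) by (simp only: e(2))
      then show ?thesis using gen[of i "N - Suc i"] by simp
    qed
    have Gi: "i \<le> N \<Longrightarrow> Q (G i - cst ((-1) ^ i * of_nat (N choose i)) * G 0)" for i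
    proof (induction i)
      case 0
      show ?case using Q0 by simp
    next
      case (Suc i)
      then have IH: "Q (G i - cst ((-1) ^ i * of_nat (N choose i)) * G 0)" by simp
      have bin: "(of_nat (Suc i) :: complex) * of_nat (N choose Suc i) = of_nat (N - i) * of_nat (N choose i)"
      proof -
        have "Suc i * (N choose Suc i) = (N - i) * (N choose i)"
          by (simp only: binomial_absorption binomial_absorb_comp)
        then show ?thesis by (simp only: of_nat_mult[symmetric])
      qed
      have "cst (of_nat (Suc i)) * (G (Suc i) - cst ((-1) ^ Suc i * of_nat (N choose Suc i)) * G 0)
        = (cst (of_nat (N - i)) * G i + cst (of_nat (Suc i)) * G (Suc i))
         - cst (of_nat (N - i)) * (G i - cst ((-1) ^ i * of_nat (N choose i)) * G 0)"
      proof -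
        have "cst (of_nat (Suc i)) * (cst ((-1) ^ Suc i * of_nat (N choose Suc i)) * G 0)
          = - (cst (of_nat (N - i)) * (cst ((-1) ^ i * of_nat (N choose i)) * G 0))"
        proof -
          have "of_nat (Suc i) * ((-1) ^ Suc i * of_nat (N choose Suc i)) = - (of_nat (N - i) * ((-1) ^ i * of_nat (N choose i)) :: complex)"
            using bin by (simp add: mult.left_commute del: of_nat_Suc)
          then show ?thesis unfolding cst_cst by (simp only: cst_simps(5)) simp
        qed
        then show ?thesis by (simp add: right_diff_distrib del: of_nat_Suc)
      qed
      also have "Q \<dots>" using Suc.prems by (intro Qd rel Qc IH) simp
      finally show ?case by (rule subsp_cancel[OF Q]) (simp del: of_nat_Suc)
    qed
    have fG: "\<exists>z. Q (f - cst z * G 0)"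
    proof -
      obtain c where c: "f = (\<Sum>P\<in>msets 2 w. cst (c P) * hprod P)" using hdeg_rep[OF f] by blast
      have "\<exists>z. Q (cst (c P) * hprod P - cst z * G 0)" if P: "P \<in> msets 2 w" for P
      proof -
        have "size P = Suc 1" using P by (simp add: msets_def)
        then obtain i P' where P': "P = add_mset i P'" by (metis size_eq_Suc_imp_eq_union)
        with \<open>size P = Suc 1\<close> have "size P' = 1" by simp
        then obtain j where "P' = {#j#}" using size_1_singleton_mset by blast
        with P' have ij: "P = {#i, j#}" by simp
        then have "int j = int N - int i" "i \<le> N" using P by (auto simp: msets_def w)
        then have "hprod P = G i" by (simp add: ij G_def)
        moreover have "Q (cst (c P) * (G i - cst ((-1) ^ i * of_nat (N choose i)) * G 0))"
          by (intro Qc Gi \<open>i \<le> N\<close>)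
        ultimately show ?thesis
          by (intro exI[of _ "c P * ((-1) ^ i * of_nat (N choose i))"]) (simp add: right_diff_distrib cst_cst)
      qed
      then obtain z where z: "\<And>P. P \<in> msets 2 w \<Longrightarrow> Q (cst (c P) * hprod P - cst (z P) * G 0)" by metis
      have "Q (\<Sum>P\<in>msets 2 w. cst (c P) * hprod P - cst (z P) * G 0)"
        by (rule subsp_sum[OF Q z])
      then have "Q (f - cst (\<Sum>P\<in>msets 2 w. z P) * G 0)"
        by (simp add: c sum_subtractf cst_sum sum_distrib_right)
      then show ?thesis by blast
    qed
    then obtain z where z: "Q (f - cst z * G 0)" by blast
    show ?thesis
    proof (cases "even N")
      case False
      have "G N = G 0" by (simp add: G_def mult.commute)
      moreover have "(-1) ^ N * of_nat (N choose N) = (-1 :: complex)" using False by simp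
      moreover have "G 0 - cst (-1) * G 0 = cst 2 * G 0"
        using cst_simps(3)[of 1 1] cst_simps(5)[of 1] by (simp add: distrib_right)
      moreover have "Q (G N - cst ((-1) ^ N * of_nat (N choose N)) * G 0)" by (rule Gi) simp
      ultimately have "Q (cst 2 * G 0)" by (simp only:)
      then have "Q (G 0)" by (rule subsp_cancel[OF Q]) simp
      then have "Q (cst z * G 0)" by (rule Qc)
      from Qadd[OF z this] have "Q f" by simp
      then show ?thesis by (intro exI[of _ 0]) simp
    next
      case True
      then obtain n where n: "N = 2 * n" by (elim evenE)
      have "Q (phi_ser n - cst ((-1) ^ n * kappa n) * G 0)"
      proof -
        let ?c = "\<lambda>p. binc (1 / 2) p * ((-1) ^ (n - p) * of_nat (N choose (n - p)))"
        have "Q (\<Sum>p\<le>n. cst (binc (1 / 2) p) * (G (n - p) - cst ((-1) ^ (n - p) * of_nat (N choose (n - p))) * G 0))"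
          by (intro subsp_sum[OF Q] Qc Gi) (auto simp: n)
        also have "(\<Sum>p\<le>n. cst (binc (1 / 2) p) * (G (n - p) - cst ((-1) ^ (n - p) * of_nat (N choose (n - p))) * G 0))
          = (\<Sum>p\<le>n. cst (binc (1 / 2) p) * G (n - p)) - cst (\<Sum>p\<le>n. ?c p) * G 0"
          by (simp add: right_diff_distrib sum_subtractf cst_cst cst_sum sum_distrib_right)
        also have "(\<Sum>p\<le>n. cst (binc (1 / 2) p) * G (n - p)) = phi_ser n"
          unfolding phi_ser_def
        proof (rule sum.cong[OF refl])
          fix p assume "p \<in> {..n}"
          then have "int (n - p) = int n - int p" "int N - int (n - p) = int n + int p" by (auto simp: n of_nat_diff)
          then show "cst (binc (1 / 2) p) * G (n - p) = cst (binc (1 / 2) p) * (h 1 (int n + int p) * h 1 (int n - int p))"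
            by (simp only: G_def mult.commute)
        qed
        also have "(\<Sum>p\<le>n. ?c p) = (-1) ^ n * kappa n"
        proof -
          have "?c p = (-1) ^ n * (((1 / 2) gchoose p) * of_nat ((2 * n) choose (n - p)))" if "p \<in> {..n}" for p
          proof -
            have "(-1 :: complex) ^ n = (-1) ^ p * (-1) ^ (n - p)" using that by (simp flip: power_add)
            then show ?thesis by (simp add: binc_def n)
          qed
          then show ?thesis unfolding kappa_sum[symmetric] sum_distrib_left by (intro sum.cong refl)
        qed
        finally show ?thesis .
      qed
      then have "Q (cst (z / ((-1) ^ n * kappa n)) * (phi_ser n - cst ((-1) ^ n * kappa n) * G 0))" by (rule Qc)
      then have "Q (cst (z / ((-1) ^ n * kappa n)) * phi_ser n - cst z * G 0)"
        using kappa_nonzero[of n] by (simp add: right_diff_distrib cst_cst)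
      from Qd[OF z this] have "Q (f - cst (z / ((-1) ^ n * kappa n)) * phi_ser n)" by simp
      then show ?thesis by blast
    qed
  qed
qed

text \<open>The first argument 2 of \<open>alphac\<close> is the eigenvalue of
  \<open>alpha(0)\<close> in charge 2.\<close>

definition Lam :: "nat \<Rightarrow> mser \<Rightarrow> complex" where
  "Lam N f = (\<Sum>i\<le>N. (-1) ^ i * of_nat (N choose i) * cf (alphac 2 i (alphac 2 (N - i) f)) {#})"

lemma Lam_linear [simp]:
  "Lam N (f + g) = Lam N f + Lam N g" "Lam N (cst z * f) = z * Lam N f" "Lam N 0 = 0"
  by (simp_all add: Lam_def distrib_left sum.distrib sum_distrib_left mult.left_commute)

lemma Lam_sum [simp]: "Lam N (sum f I) = (\<Sum>x\<in>I. Lam N (f x))"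
  by (induction I rule: infinite_finite_induct) auto

lemma alphac2_hh: "alphac 2 i (h 1 x * h 1 y) = h 1 (x - int i) * h 1 y + h 1 x * h 1 (y - int i)"
proof (cases "i = 0")
  case True
  have "cst 2 = 1 + 1" using cst_simps(3)[of 1 1] by simp
  then show ?thesis using True by (simp add: alphac_def distrib_right)
next
  case False
  then show ?thesis by (simp add: alphac_def alpha_mult alpha_h)
qed

lemma cf_hh_empty: "cf (h 1 x * h 1 y) {#} = (if x = 0 \<and> y = 0 then 1 else 0)"
  by (simp add: cf_times cf_h)

text \<open>There are four ways to let the two modes act on two factors. Both on one factor forces
  the other index to be 0, and the alternating binomial sum cancels unless \<open>N = 0\<close>; one
  on each forces \<open>i = k\<close> or \<open>i = N - k\<close>, with equal contributions as
  \<open>N\<close> is even.\<close>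

lemma Lam_hh:
  assumes x: "0 \<le> x" "0 \<le> y" and N: "even N"
  shows "Lam N (h 1 x * h 1 y) = (if x + y = int N then (if N = 0 then 4 else 2 * (-1) ^ nat x * of_nat (N choose nat x)) else 0)"
proof (cases "x + y = int N")
  case False
  have "cf (alphac 2 i (alphac 2 (N - i) (h 1 x * h 1 y))) {#} = 0" if "i \<le> N" for i
    using False that x by (auto simp: alphac2_hh cf_hh_empty of_nat_diff)
  then show ?thesis using False by (simp add: Lam_def)
next
  case True
  obtain k where kx: "x = int k" using x(1) nonneg_int_cases by blast
  have k: "y = int N - int k" "k \<le> N" using True x kx by linarith+
  define s :: "nat \<Rightarrow> complex" where "s i = (-1) ^ i * of_nat (N choose i)" for i
  have "Lam N (h 1 x * h 1 y) = (\<Sum>i\<le>N. s i * (of_bool (k = N) + of_bool (k = 0) + of_bool (i = k) + of_bool (i = N - k)))"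
    unfolding Lam_def s_def[symmetric]
  proof (rule sum.cong[OF refl])
    fix i assume i: "i \<in> {..N}"
    have "cf (alphac 2 i (alphac 2 (N - i) (h 1 x * h 1 y))) {#}
      = of_bool (k = N) + of_bool (k = 0) + of_bool (i = k) + of_bool (i = N - k)"
    proof -
      have e: "int (N - i) = int N - int i" using i by simp
      have c1: "int k - (int N - int i) - int i = 0 \<and> int N - int k = 0 \<longleftrightarrow> k = N" by linarith
      have c2: "int k - (int N - int i) = 0 \<and> int N - int k - int i = 0 \<longleftrightarrow> i = N - k" using k(2) by linarith
      have c3: "int k - int i = 0 \<and> int N - int k - (int N - int i) = 0 \<longleftrightarrow> i = k" by linarith
      have c4: "int k = 0 \<and> int N - int k - (int N - int i) - int i = 0 \<longleftrightarrow> k = 0" by linarith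
      show ?thesis
        unfolding kx k(1) alphac2_hh alphac_linear(1) cf_ring(2) cf_hh_empty e c1 c2 c3 c4
        by (simp only: of_bool_def[symmetric] ac_simps)
    qed
    then show "s i * cf (alphac 2 i (alphac 2 (N - i) (h 1 x * h 1 y))) {#}
      = s i * (of_bool (k = N) + of_bool (k = 0) + of_bool (i = k) + of_bool (i = N - k))"
      by simp
  qed
  also have "\<dots> = (\<Sum>i\<le>N. s i) * (of_bool (k = N) + of_bool (k = 0)) + s k + s (N - k)"
    using k(2) by (simp add: distrib_left sum.distrib sum_distrib_right of_bool_def if_distrib[of "\<lambda>x. _ * x"] cong: if_cong)
  also have "(\<Sum>i\<le>N. s i) = (if N = 0 then 1 else 0)"
    using choose_alternating_sum[of N, where 'a = complex] by (auto simp: s_def)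
  also have "s (N - k) = s k"
  proof -
    have "(-1 :: complex) ^ (N - k) = (-1) ^ k"
      using N k(2) by (auto simp: minus_one_power_iff)
    then show ?thesis using binomial_symmetric[OF k(2)] by (simp add: s_def)
  qed
  finally have L: "Lam N (h 1 x * h 1 y) = (if N = 0 then 1 else 0) * (of_bool (k = N) + of_bool (k = 0)) + s k + s k" .
  have "nat x = k" by (simp add: kx)
  then show ?thesis
    unfolding L using True k(2) by (cases "N = 0") (simp_all add: s_def)
qed

text \<open>The values of \<open>Lam N\<close> alternate in sign like the coefficients in the
  recursion, and \<open>(b + 1) * (N choose a) = (a + 1) * (N choose (a + 1))\<close> for
  \<open>N = a + b + 1\<close>, so the two terms cancel.\<close>

lemma Lam_vac:
  assumes "even N"
  shows "Lam N (vmode 2 0 (int a + int b + 1) (h 1 (int a) * h 1 (int b)) 1) = 0"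
proof (cases "N = a + b + 1")
  case True
  have "(of_nat b + 1) * of_nat (N choose a) = (of_nat a + 1) * (of_nat (N choose Suc a) :: complex)"
  proof -
    have "Suc a * (N choose Suc a) = (N - a) * (N choose a)"
      by (simp only: binomial_absorption binomial_absorb_comp)
    then have "(of_nat (Suc a) * of_nat (N choose Suc a) :: complex) = of_nat (N - a) * of_nat (N choose a)"
      by (simp only: of_nat_mult[symmetric])
    moreover have "N - a = Suc b" using True by simp
    ultimately show ?thesis by (simp add: add.commute)
  qed
  then have e: "of_nat (N choose a) * (of_nat b + 1) = (of_nat (N choose Suc a) * (of_nat a + 1) :: complex)"
    by (simp only: mult.commute)
  have n: "nat (int a + 1) = Suc a" "nat (int a) = a" by simp_all
  show ?thesis
    unfolding vmode_hh_vac Lam_linear using assms True e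
    by (simp add: Lam_hh n) (simp add: algebra_simps)?
next
  case False
  then show ?thesis
    unfolding vmode_hh_vac Lam_linear using assms by (simp add: Lam_hh)
qed

text \<open>The signs in \<open>binc\<close> and in \<open>Lam_hh\<close> compensate each other,
  leaving for \<open>n > 0\<close> the Vandermonde sum \<open>kappa n\<close>, which is
  nonzero.\<close>

lemma Lam_phi_ser: "Lam (2 * n) (phi_ser n) \<noteq> 0"
proof (cases "n = 0")
  case True
  then show ?thesis using Lam_hh[of 0 0 0] by (simp add: phi_ser_def)
next
  case False
  have "Lam (2 * n) (phi_ser n) = (\<Sum>p\<le>n. binc (1 / 2) p * (2 * (-1) ^ (n + p) * of_nat ((2 * n) choose (n + p))))"
    unfolding phi_ser_def Lam_sum Lam_linear
  proof (rule sum.cong[OF refl])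
    fix p assume "p \<in> {..n}"
    moreover have "nat (int n + int p) = n + p" by simp
    ultimately show "binc (1 / 2) p * Lam (2 * n) (h 1 (int n + int p) * h 1 (int n - int p))
      = binc (1 / 2) p * (2 * (-1) ^ (n + p) * of_nat ((2 * n) choose (n + p)))"
      using False by (subst Lam_hh) auto
  qed
  also have "\<dots> = (\<Sum>p\<le>n. (2 * (-1) ^ n) * (((1 / 2) gchoose p) * of_nat ((2 * n) choose (n - p))))"
  proof (rule sum.cong[OF refl])
    fix p assume "p \<in> {..n}"
    then have "(2 * n) choose (n + p) = (2 * n) choose (n - p)"
      using binomial_symmetric[of "n + p" "2 * n"] by simp
    then show "binc (1 / 2) p * (2 * (-1) ^ (n + p) * of_nat ((2 * n) choose (n + p)))
      = (2 * (-1) ^ n) * (((1 / 2) gchoose p) * of_nat ((2 * n) choose (n - p)))"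
      by (simp add: binc_def power_add)
  qed
  also have "\<dots> = 2 * (-1) ^ n * kappa n"
    unfolding sum_distrib_left[symmetric] kappa_sum ..
  finally show ?thesis using kappa_nonzero by simp
qed

lemma Lam_phi_ser_other: "N \<noteq> 2 * n \<Longrightarrow> even N \<Longrightarrow> Lam N (phi_ser n) = 0"
  unfolding phi_ser_def Lam_sum Lam_linear
  by (rule sum.neutral) (auto simp: Lam_hh)

section \<open>The commutant\<close>

lemma emb_linear:
  "emb c (f + g) = vadd (emb c f) (emb c g)" "emb c (cst z * f) = vscale z (emb c f)" "emb c 0 = vzero"
  by (auto simp: emb_def vadd_def vscale_def vzero_def fun_eq_iff)

definition fin_supp :: "vec \<Rightarrow> bool" where "fin_supp v \<longleftrightarrow> finite {k. v k \<noteq> 0}"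

lemma fin_supp_vzero [simp]: "fin_supp vzero"
  by (simp add: fin_supp_def vzero_def)

lemma fin_supp_vadd: "fin_supp u \<Longrightarrow> fin_supp v \<Longrightarrow> fin_supp (vadd u v)"
  unfolding fin_supp_def vadd_def by (rule finite_subset[of _ "{k. u k \<noteq> 0} \<union> {k. v k \<noteq> 0}"]) auto

lemma fin_supp_emb: "hom d f \<Longrightarrow> fin_supp (emb c f)"
  unfolding fin_supp_def
proof (rule finite_subset[of _ "Pair c ` parts_le (nat d)"])
  assume f: "hom d f"
  show "{k. emb c f k \<noteq> 0} \<subseteq> Pair c ` parts_le (nat d)"
  proof
    fix k assume "k \<in> {k. emb c f k \<noteq> 0}"
    then have "fst k = c" "cf f (snd k) \<noteq> 0" using emb_nonzero by auto
    moreover from this f have "snd k \<in> parts_le (nat d)"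
      using wt_nonneg[of "snd k"] by (auto simp: hom_def parts_le_def)
    ultimately show "k \<in> Pair c ` parts_le (nat d)" by (metis image_eqI prod.collapse)
  qed
qed simp

lemma mode_sum:
  assumes "finite S" "finite T" "{k. v k \<noteq> 0} \<subseteq> S" "{k. w k \<noteq> 0} \<subseteq> T"
  shows "mode v r w k = (\<Sum>(kv, kw)\<in>S \<times> T. v kv * w kw * Ybas kv r kw k)"
  unfolding mode_def
  by (subst vsum_eq[of "S \<times> T"]) (use assms in \<open>auto simp: vscale_def split_def\<close>)

text \<open>Finite supports matter because \<open>vsum\<close> defaults to 0 where its support is
  infinite, which could break additivity.\<close>

lemma imode_vadd_left:
  assumes "fin_supp u" "fin_supp u'" "fin_supp v"
  shows "imode (vadd u u') n v = vadd (imode u n v) (imode u' n v)"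
proof
  fix k
  let ?amin = "{k. u k \<noteq> 0} \<union> {k. u' k \<noteq> 0}" and ?B = "{k. v k \<noteq> 0}"
  have AB: "finite ?amin" "finite ?B" using assms by (auto simp: fin_supp_def)
  have "mode (vadd u u') (of_int n) v k = mode u (of_int n) v k + mode u' (of_int n) v k"
    by (subst (1 2 3) mode_sum[OF AB])
      (auto simp: vadd_def sum.distrib[symmetric] distrib_right intro!: sum.cong)
  then show "imode (vadd u u') n v k = vadd (imode u n v) (imode u' n v) k"
    by (simp add: imode_def vadd_def)
qed

lemma imode_vadd_right:
  assumes "fin_supp u" "fin_supp v" "fin_supp v'"
  shows "imode u n (vadd v v') = vadd (imode u n v) (imode u n v')"
proof
  fix k
  let ?amin = "{k. u k \<noteq> 0}" and ?B = "{k. v k \<noteq> 0} \<union> {k. v' k \<noteq> 0}"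
  have AB: "finite ?amin" "finite ?B" using assms by (auto simp: fin_supp_def)
  have "mode u (of_int n) (vadd v v') k = mode u (of_int n) v k + mode u (of_int n) v' k"
    by (subst (1 2 3) mode_sum[OF AB])
      (auto simp: vadd_def sum.distrib[symmetric] distrib_left distrib_right intro!: sum.cong)
  then show "imode u n (vadd v v') k = vadd (imode u n v) (imode u n v') k"
    by (simp add: imode_def vadd_def)
qed

lemma imode_vzero [simp]: "imode vzero n v = vzero" "imode v n vzero = vzero"
  by (auto simp: imode_def mode_def vsum_def vscale_def vzero_def fun_eq_iff split_def)

section \<open>Spans of homogeneous vectors of fixed charge\<close>

inductive_set espan :: "(int \<Rightarrow> int \<Rightarrow> mser \<Rightarrow> bool) \<Rightarrow> vec set" for P where
  espan_0: "vzero \<in> espan P"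
| espan_add: "P b d u \<Longrightarrow> v \<in> espan P \<Longrightarrow> vadd (emb b u) v \<in> espan P"

lemma vadd_simps [simp]: "vadd vzero v = v" "vadd v vzero = v"
  by (simp_all add: vadd_def vzero_def)

lemma vadd_assoc: "vadd (vadd u v) w = vadd u (vadd v w)"
  by (simp add: vadd_def add.assoc)

lemma espan_vadd: "u \<in> espan P \<Longrightarrow> v \<in> espan P \<Longrightarrow> vadd u v \<in> espan P"
  by (induction rule: espan.induct) (auto simp: vadd_assoc intro: espan.intros)

lemma espan_emb: "P b d u \<Longrightarrow> emb b u \<in> espan P"
  using espan_add[OF _ espan_0, of P b d u] by simp

lemma espan_mono: "v \<in> espan P \<Longrightarrow> (\<And>b d u. P b d u \<Longrightarrow> Q b d u) \<Longrightarrow> v \<in> espan Q"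
  by (induction rule: espan.induct) (auto intro: espan.intros)

lemma espan_vscale:
  "v \<in> espan P \<Longrightarrow> (\<And>b d u. P b d u \<Longrightarrow> P b d (cst z * u)) \<Longrightarrow> vscale z v \<in> espan P"
proof (induction rule: espan.induct)
  case espan_0
  have "vscale z vzero = vzero" by (simp add: vscale_def vzero_def)
  then show ?case by (simp add: espan.espan_0)
next
  case (espan_add b d u v)
  have "vscale z (vadd (emb b u) v) = vadd (emb b (cst z * u)) (vscale z v)"
    by (simp add: emb_linear vadd_def vscale_def distrib_left)
  then show ?case using espan_add by (auto intro: espan.espan_add)
qed

definition homV :: "int \<Rightarrow> int \<Rightarrow> mser \<Rightarrow> bool" where
  "homV b d u \<longleftrightarrow> even b \<and> hom d u"

definition homC :: "int \<Rightarrow> int \<Rightarrow> mser \<Rightarrow> bool" where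
  "homC b d u \<longleftrightarrow> even b \<and> 0 \<le> b \<and> hdeg (nat b) d u"

definition homW :: "int \<Rightarrow> int \<Rightarrow> mser \<Rightarrow> bool" where
  "homW b d u \<longleftrightarrow> even b \<and> 0 \<le> b \<and> wdeg (nat b) d u"

lemma homC_homV: "homC b d u \<Longrightarrow> homV b d u"
  by (auto simp: homC_def homV_def intro: hdeg_hom)

lemma homW_homC: "homW b d u \<Longrightarrow> homC b d u"
  by (auto simp: homC_def homW_def intro: wdeg_hdeg)

lemma espan_homC_homV: "v \<in> espan homC \<Longrightarrow> v \<in> espan homV"
  by (erule espan_mono) (rule homC_homV)

lemma espan_homW_homC: "v \<in> espan homW \<Longrightarrow> v \<in> espan homC"
  by (erule espan_mono) (rule homW_homC)

lemma espan_fin_supp: "v \<in> espan homV \<Longrightarrow> fin_supp v"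
  by (induction rule: espan.induct) (auto simp: homV_def intro: fin_supp_vadd fin_supp_emb)

text \<open>Modes are bilinear, so statements about them reduce to homogeneous vectors of a fixed charge.\<close>

lemma imode_espan_cases:
  assumes u: "u \<in> espan P" and v: "v \<in> espan Q"
    and PQ: "\<And>b d u. P b d u \<Longrightarrow> homV b d u" "\<And>b d u. Q b d u \<Longrightarrow> homV b d u"
    and Z: "Z vzero" "\<And>x y. Z x \<Longrightarrow> Z y \<Longrightarrow> Z (vadd x y)"
    and single: "\<And>b d u c e v. P b d u \<Longrightarrow> Q c e v \<Longrightarrow> Z (imode (emb b u) n (emb c v))"
  shows "Z (imode u n v)"
  using u
proof (induction rule: espan.induct)
  case (espan_add b d u u')
  have "u' \<in> espan homV" by (rule espan_mono[OF espan_add.hyps(2)]) (rule PQ(1))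
  then have u: "hom d u" "fin_supp u'" "fin_supp (emb b u)"
    using espan_add.hyps PQ(1) espan_fin_supp by (auto simp: homV_def intro: fin_supp_emb)
  have vV: "v \<in> espan homV" by (rule espan_mono[OF v]) (rule PQ(2))
  have "Z (imode (emb b u) n v)"
    using v
  proof (induction rule: espan.induct)
    case (espan_add c e x x')
    have "x' \<in> espan homV" by (rule espan_mono[OF espan_add.hyps(2)]) (rule PQ(2))
    then have "hom e x" "fin_supp x'"
      using espan_add.hyps PQ(2) espan_fin_supp by (auto simp: homV_def)
    then show ?case
      using espan_add.hyps espan_add.IH single[OF \<open>P b d u\<close>] imode_vadd_right[OF u(3) fin_supp_emb, of e x x'] Z(2) by auto
  qed (simp add: Z)
  then show ?case
    using imode_vadd_left[OF u(3) u(2) espan_fin_supp[OF vV]] espan_add.IH Z(2) by auto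
qed (simp add: Z)

lemma imode_emb:
  assumes "homV b d u" "homV c e X" "w = d + e - (b * c) div 2 - n - 1"
  shows "imode (emb b u) n (emb c X) = emb (b + c) (vmode b c w u X)"
  by (rule vmode_imode) (use assms in \<open>auto simp: homV_def\<close>)

lemma imode_homV: "u \<in> espan homV \<Longrightarrow> v \<in> espan homV \<Longrightarrow> imode u n v \<in> espan homV"
proof (erule imode_espan_cases)
  fix b d u c e v assume *: "homV b d u" "homV c e v"
  then have "homV (b + c) (d + e - (b * c) div 2 - n - 1) (vmode b c (d + e - (b * c) div 2 - n - 1) u v)"
    by (auto simp: homV_def intro: hom_vmode)
  then show "imode (emb b u) n (emb c v) \<in> espan homV"
    using imode_emb[OF * refl] by (auto intro: espan_emb)
qed (auto intro: espan_vadd espan_0)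

lemma imode_homW: "u \<in> espan homW \<Longrightarrow> v \<in> espan homW \<Longrightarrow> imode u n v \<in> espan homW"
proof (erule imode_espan_cases)
  fix b d u c e v assume *: "homW b d u" "homW c e v"
  let ?w = "d + e - (b * c) div 2 - n - 1"
  have "wdeg (nat b + nat c) ?w (vmode (int (nat b)) (int (nat c)) ?w u v)"
    using * by (intro wdeg_vmode) (auto simp: homW_def)
  then have "homW (b + c) ?w (vmode b c ?w u v)"
    using * by (auto simp: homW_def nat_add_distrib)
  then show "imode (emb b u) n (emb c v) \<in> espan homW"
    using imode_emb[OF homC_homV[OF homW_homC] homC_homV[OF homW_homC] refl, OF *] by (auto intro: espan_emb)
qed (auto intro: espan_vadd espan_0 homC_homV homW_homC)

lemma commute_emb:
  assumes u: "homW b d u" and v: "homC b' d' v" and X: "homV c e X"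
  shows "imode (emb b u) n (imode (emb b' v) m (emb c X)) = imode (emb b' v) m (imode (emb b u) n (emb c X))"
proof -
  obtain i j k where ev: "b = 2 * i" "b' = 2 * j" "c = 2 * k"
    using u v X by (auto simp: homW_def homC_def homV_def elim!: evenE)
  define w1 where "w1 = d' + e - (b' * c) div 2 - m - 1"
  define w2 where "w2 = d + w1 - (b * (b' + c)) div 2 - n - 1"
  define w1' where "w1' = d + e - (b * c) div 2 - n - 1"
  have w2': "w2 = d' + w1' - (b' * (b + c)) div 2 - m - 1"
    by (simp add: w1_def w2_def w1'_def ev algebra_simps)
  have uV: "homV b d u" and vV: "homV b' d' v" using u v homC_homV homW_homC by blast+
  have 1: "homV (b' + c) w1 (vmode b' c w1 v X)" "homV (b + c) w1' (vmode b c w1' u X)"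
    using uV vV X by (auto simp: homV_def intro: hom_vmode)
  have b: "int (nat b) = b" "int (nat b') = b'" using u v by (auto simp: homW_def homC_def)
  have "vmode (int (nat b)) (int (nat b') + c) w2 u (vmode (int (nat b')) c w1 v X)
    = vmode (int (nat b')) (int (nat b) + c) w2 v (vmode (int (nat b)) c w1' u X)"
  proof (rule vmode_commute)
    show "w1' = e + (w2 - w1) + int (nat b * nat b') div 2"
      unfolding of_nat_mult b by (simp add: w1_def w2_def w1'_def ev algebra_simps)
  qed (use u v X in \<open>auto simp: homW_def homC_def homV_def even_nat_iff\<close>)
  then have "vmode b (b' + c) w2 u (vmode b' c w1 v X) = vmode b' (b + c) w2 v (vmode b c w1' u X)"
    by (simp only: b)
  then show ?thesis
    using imode_emb[OF vV X w1_def] imode_emb[OF uV 1(1) w2_def] imode_emb[OF uV X w1'_def] imode_emb[OF vV 1(2) w2']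
    by (simp add: add.left_commute)
qed

lemma commute_espan:
  assumes u: "u \<in> espan homW" and v: "v \<in> espan homC" and x: "x \<in> espan homV"
  shows "imode u n (imode v m x) = imode v m (imode u n x)"
proof -
  have 1: "imode (emb b u) n (imode (emb c v) m x) = imode (emb c v) m (imode (emb b u) n x)"
    if uv: "homW b d u" "homC c e v" for b d u c e v
    using x
  proof (induction rule: espan.induct)
    case (espan_add a f y x)
    have V: "emb b u \<in> espan homV" "emb c v \<in> espan homV" "emb a y \<in> espan homV"
      using uv espan_add homC_homV homW_homC by (blast intro: espan_emb)+
    note I = imode_homV[OF V(1) V(3)] imode_homV[OF V(2) V(3)] imode_homV[OF V(1) espan_add(2)] imode_homV[OF V(2) espan_add(2)]
    show ?case
      using commute_emb[OF uv espan_add(1)] espan_add.IH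
      by (simp add: imode_vadd_right[OF espan_fin_supp espan_fin_supp espan_fin_supp] V espan_add(2) I)
  qed simp
  have 2: "imode (emb b u) n (imode v m x) = imode v m (imode (emb b u) n x)"
    if u: "homW b d u" for b d u
    using v
  proof (induction rule: espan.induct)
    case (espan_add c e y v)
    have V: "emb b u \<in> espan homV" "emb c y \<in> espan homV" "v \<in> espan homV"
      using u espan_add homC_homV homW_homC espan_homC_homV by (blast intro: espan_emb)+
    note I = imode_homV[OF V(1) x] imode_homV[OF V(2) x] imode_homV[OF V(3) x]
    show ?case
      using 1[OF u espan_add(1)] espan_add.IH
      by (simp add: imode_vadd_left[OF espan_fin_supp espan_fin_supp espan_fin_supp] imode_vadd_right[OF espan_fin_supp espan_fin_supp espan_fin_supp] V I x)
  qed simp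
  show ?thesis
    using u
  proof (induction rule: espan.induct)
    case (espan_add b d y u)
    have V: "emb b y \<in> espan homV" "u \<in> espan homV" "v \<in> espan homV"
      using v espan_add homC_homV homW_homC espan_homC_homV espan_homW_homC by (blast intro: espan_emb)+
    note I = imode_homV[OF V(1) x] imode_homV[OF V(2) x] imode_homV[OF V(3) x]
    show ?case
      using 2[OF espan_add(1)] espan_add.IH
      by (simp add: imode_vadd_left[OF espan_fin_supp espan_fin_supp espan_fin_supp] imode_vadd_right[OF espan_fin_supp espan_fin_supp espan_fin_supp] V I x)
  qed simp
qed

section \<open>Components by charge and weight, and the determination of the commutant\<close>

definition charge_part :: "int \<Rightarrow> vec \<Rightarrow> mser" where
  "charge_part c v = Mser (\<lambda>m. v (c, m))"

lemma charge_part_simps [simp]: "charge_part c vzero = 0" "charge_part c (vadd u v) = charge_part c u + charge_part c v"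
  "charge_part c (vscale z v) = cst z * charge_part c v" "charge_part c (emb b f) = (if b = c then f else 0)"
  by (auto intro!: mser_eqI simp: charge_part_def vzero_def vadd_def vscale_def emb_apply)

lemma espan_I:
  assumes fin_supp: "fin_supp v" and P: "\<And>c d. wt_part d (charge_part c v) \<noteq> 0 \<Longrightarrow> P c d (wt_part d (charge_part c v))"
  shows "v \<in> espan P"
proof -
  define J where "J = (\<lambda>(c, m). (c, wt m)) ` {k. v k \<noteq> 0}"
  have "finite J" using fin_supp by (simp add: J_def fin_supp_def)
  have "(\<lambda>(c, m). if (c, wt m) \<in> J' then v (c, m) else 0) \<in> espan P" if "finite J'" for J'
    using that
  proof (induction J')
    case empty
    then show ?case using espan_0[of P] by (simp add: vzero_def case_prod_unfold)
  next
    case (insert x F)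
    obtain c d where x: "x = (c, d)" by (cases x)
    have *: "(\<lambda>(c, m). if (c, wt m) \<in> insert x F then v (c, m) else 0)
      = vadd (emb c (wt_part d (charge_part c v))) (\<lambda>(c, m). if (c, wt m) \<in> F then v (c, m) else 0)"
      using insert.hyps by (auto simp: x fun_eq_iff vadd_def emb_apply cf_wt_part charge_part_def)
    show ?case
    proof (cases "wt_part d (charge_part c v) = 0")
      case True
      then show ?thesis unfolding * using insert.IH by (simp add: emb_linear)
    next
      case False
      then show ?thesis unfolding * using insert.IH P by (auto intro: espan_add)
    qed
  qed
  from this[OF \<open>finite J\<close>] have "(\<lambda>(c, m). if (c, wt m) \<in> J then v (c, m) else 0) \<in> espan P" .
  moreover have "(\<lambda>(c, m). if (c, wt m) \<in> J then v (c, m) else 0) = v"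
    by (auto simp: J_def fun_eq_iff image_iff)
  ultimately show ?thesis by simp
qed

lemma VA1_eq: "VA1 = espan homV"
proof (intro equalityI subsetI)
  fix v assume v: "v \<in> VA1"
  show "v \<in> espan homV"
  proof (rule espan_I)
    show "fin_supp v" using v by (simp add: VA1_def VA1dual_def fin_supp_def)
    fix c d assume "wt_part d (charge_part c v) \<noteq> 0"
    then obtain m where "cf (wt_part d (charge_part c v)) m \<noteq> 0" by (metis cf_ring(1) mser_eqI)
    then have "v (c, m) \<noteq> 0" by (auto simp: cf_wt_part charge_part_def split: if_splits)
    then have "even c" using v by (auto simp: VA1_def)
    moreover have "hom d (wt_part d (charge_part c v))"
      using v by (intro hom_wt_part) (auto simp: posm_def charge_part_def VA1_def VA1dual_def)
    ultimately show "homV c d (wt_part d (charge_part c v))" by (simp add: homV_def)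
  qed
next
  fix v assume v: "v \<in> espan homV"
  then have "0 \<notin># snd k \<and> even (fst k)" if "v k \<noteq> 0" for k
    using that
  proof (induction rule: espan.induct)
    case (espan_add b d u v)
    show ?case
    proof (cases "v k = 0")
      case True
      then have "emb b u k \<noteq> 0" using espan_add.prems by (simp add: vadd_def)
      then show ?thesis using emb_nonzero espan_add.hyps by (fastforce simp: homV_def hom_def)
    qed (use espan_add in auto)
  qed (simp add: vzero_def)
  then show "v \<in> VA1" using espan_fin_supp[OF v] by (auto simp: VA1_def VA1dual_def fin_supp_def)
qed

lemma vac_emb: "vac = emb 0 1" and ealpha_emb: "ealpha = emb 2 1"
  by (simp_all add: vac_def ealpha_def bas_emb)

lemma homW_vac: "homW 0 0 1" and PW_ealpha: "homW 2 0 1"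
proof -
  have 1: "wdeg 0 0 1" using wdeg_cst[of 1] by simp
  then show "homW 0 0 1" by (simp add: homW_def)
  have "emode 0 1 = 1"
    using emode_hom_eq[OF hom_1, of 0 0] by (simp add: emodeb_def)
  then show "homW 2 0 1" using wdeg_emode[OF 1, of 0] by (simp add: homW_def numeral_2_eq_2)
qed

lemma homV_vac: "homV 0 0 1" and PV_ealpha: "homV 2 0 1"
  using homW_vac PW_ealpha homW_homC homC_homV by blast+

lemma vac_espan: "vac \<in> espan homW" and ealpha_ES: "ealpha \<in> espan homW"
  unfolding vac_emb ealpha_emb using homW_vac PW_ealpha by (auto intro: espan_emb)

lemma W_espan: "W \<subseteq> espan homW"
proof
  fix u assume "u \<in> W"
  then show "u \<in> espan homW"
    unfolding W_def
  proof (induction rule: gen_sub.induct)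
    case (gscale u a)
    then show ?case by (intro espan_vscale) (auto simp: homW_def intro: wdeg_smult)
  qed (auto intro: vac_espan ealpha_ES espan_vadd imode_homW)
qed

text \<open>On charge \<open>c\<close> the field of e^alpha has the extra factor z^c, since (alpha,
  varpi) = 1; this is the shift by \<open>c\<close> in the index.\<close>

lemma ealpha_mode:
  assumes "homV c e X"
  shows "imode ealpha n (emb c X) = emb (c + 2) (emode (- n - 1 - c) X)"
proof -
  define w where "w = 0 + e - (2 * c) div 2 - n - 1"
  have X: "hom e X" using assms by (simp add: homV_def)
  have "hdeg 0 0 1" using hdeg_cst[of 1] by simp
  have "emode 0 1 = 1"
    using emode_hom_eq[OF hom_1, of 0 0] by (simp add: emodeb_def)
  then have "vmode 2 c w 1 X = (\<Sum>N\<in>{- (e + int 0)..w}\<union>{w - e}. cst ((of_int N + of_int c + of_nat 0) gchoose nat (0 + int 0)) * emode N (vmode (int 0) c (w - N) 1 X))"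
    using vmode_assoc[OF \<open>hdeg 0 0 1\<close> X, of 0 "{- (e + int 0)..w}\<union>{w - e}" w c] by (simp add: subset_insertI)
  also have "\<dots> = (\<Sum>N\<in>{- (e + int 0)..w}\<union>{w - e}. if N = w - e then emode (w - e) X else 0)"
    using vmode_one[OF X, of c _ 1] by (intro sum.cong refl) auto
  also have "\<dots> = emode (w - e) X" by simp
  finally have "vmode 2 c w 1 X = emode (- n - 1 - c) X" by (simp add: w_def)
  then show ?thesis
    unfolding ealpha_emb using imode_emb[OF PV_ealpha assms, of w n] by (simp add: w_def add.commute)
qed

lemma ealpha_charge_part: "v \<in> espan homV \<Longrightarrow> charge_part (c + 2) (imode ealpha n v) = emode (- n - 1 - c) (charge_part c v)"
proof (induction rule: espan.induct)
  case (espan_add b d u v)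
  have "fin_supp ealpha" "fin_supp (emb b u)" "fin_supp v"
    using espan_fin_supp[OF espan_homC_homV[OF espan_homW_homC[OF ealpha_ES]]] espan_fin_supp[OF espan_add(2)] espan_add(1)
    by (auto simp: homV_def intro: fin_supp_emb)
  then show ?case
    using espan_add.IH ealpha_mode[OF espan_add(1)] by (auto simp: imode_vadd_right)
qed simp

text \<open>On charge \<open>c\<close>, the modes with \<open>n >= 0\<close> are exactly the
  \<open>emode N\<close> with \<open>N < - c\<close>, so \<open>emode_low_imp_hdeg\<close> applies
  to each homogeneous component.\<close>

lemma espan_homC_I:
  assumes v: "v \<in> espan homV" and 0: "\<And>n. 0 \<le> n \<Longrightarrow> imode ealpha n v = vzero"
  shows "v \<in> espan homC"
proof (rule espan_I)
  show "fin_supp v" by (rule espan_fin_supp[OF v])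
  fix c d assume nz: "wt_part d (charge_part c v) \<noteq> 0"
  have vV: "v \<in> VA1" using v by (simp add: VA1_eq)
  have h: "hom d (wt_part d (charge_part c v))"
    using vV by (intro hom_wt_part) (auto simp: posm_def charge_part_def VA1_def VA1dual_def)
  obtain m where "cf (wt_part d (charge_part c v)) m \<noteq> 0" using nz by (metis cf_ring(1) mser_eqI)
  then have "v (c, m) \<noteq> 0" by (auto simp: cf_wt_part charge_part_def split: if_splits)
  then have ev: "even c" using vV by (auto simp: VA1_def)
  have "emode N (wt_part d (charge_part c v)) = 0" if "N < - c" for N
  proof -
    have "emode N (charge_part c v) = 0"
      using ealpha_charge_part[OF v, of c "- N - 1 - c"] 0[of "- N - 1 - c"] that by simp
    then have "wt_part (d + N) (emode N (charge_part c v)) = 0" by simp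
    then show ?thesis by (simp add: wt_part_emode)
  qed
  then have "if c < 0 then wt_part d (charge_part c v) = 0 else hdeg (nat c) d (wt_part d (charge_part c v))"
    by (rule emode_low_imp_hdeg[OF h])
  with nz ev show "homC c d (wt_part d (charge_part c v))"
    by (auto simp: homC_def split: if_splits)
qed

lemma creation:
  assumes "v \<in> espan homV"
  shows "imode v (-1) vac = v"
  using assms
proof (induction rule: espan.induct)
  case (espan_add b d u v)
  have "imode (emb b u) (-1) vac = emb b u"
    unfolding vac_emb using imode_emb[OF espan_add(1) homV_vac, of d "-1"] vmode_creation[of d u d b] espan_add(1)
    by (simp add: homV_def)
  moreover have "fin_supp (emb b u)" "fin_supp v" "fin_supp vac"
    using espan_fin_supp[OF espan_add(2)] espan_add(1) fin_supp_emb[OF hom_1, of 0] by (auto simp: homV_def vac_emb intro: fin_supp_emb)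
  ultimately show ?case using espan_add.IH by (simp add: imode_vadd_left)
qed simp

lemma vacuum:
  assumes "v \<in> espan homV"
  shows "imode vac (-1) v = v"
  using assms
proof (induction rule: espan.induct)
  case (espan_add b d u v)
  have "imode vac (-1) (emb b u) = emb b u"
    unfolding vac_emb using imode_emb[OF homV_vac espan_add(1), of d "-1"] vmode_one[of d u b d 1] espan_add(1)
    by (simp add: homV_def)
  moreover have "fin_supp (emb b u)" "fin_supp v" "fin_supp vac"
    using espan_fin_supp[OF espan_add(2)] espan_add(1) fin_supp_emb[OF hom_1, of 0] by (auto simp: homV_def vac_emb intro: fin_supp_emb)
  ultimately show ?case using espan_add.IH by (simp add: imode_vadd_right)
qed simp

text \<open>If \<open>v\<close> commutes with W, write v = v(-1)1; then e^alpha(n) v = v(-1)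
  e^alpha(n) 1 = 0 for \<open>n >= 0\<close>, and the degree bound follows. Conversely, the degree
  bound gives commutation with all of \<open>espan homW\<close>, which contains W.\<close>

lemma Cmt_eq: "Cmt = espan homC"
proof (intro equalityI subsetI)
  fix v assume v: "v \<in> Cmt"
  then have vV: "v \<in> espan homV" by (simp add: Cmt_def VA1_eq)
  show "v \<in> espan homC"
  proof (rule espan_homC_I[OF vV])
    fix n :: int assume n: "0 \<le> n"
    have "ealpha \<in> W" unfolding W_def by (rule ggen) simp
    moreover have "vac \<in> VA1" unfolding VA1_eq by (rule espan_homC_homV[OF espan_homW_homC[OF vac_espan]])
    ultimately have "imode ealpha n (imode v (-1) vac) = imode v (-1) (imode ealpha n vac)"
      using v unfolding Cmt_def by blast
    moreover have "imode ealpha n vac = vzero"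
    proof -
      have "emode (- n - 1) 1 = 0" using hom_neg[OF hom_emode[OF hom_1, of "- n - 1"]] n by simp
      then show ?thesis using ealpha_mode[OF homV_vac, of n] by (simp add: vac_emb emb_linear)
    qed
    ultimately show "imode ealpha n v = vzero" by (simp add: creation[OF vV])
  qed
next
  fix v assume v: "v \<in> espan homC"
  then show "v \<in> Cmt"
    using W_espan commute_espan espan_homC_homV unfolding Cmt_def VA1_eq by blast
qed

section \<open>Zhu's Poisson algebra\<close>

lemma lspan_vadd: "u \<in> lspan S \<Longrightarrow> v \<in> lspan S \<Longrightarrow> vadd u v \<in> lspan S"
  by (induction rule: lspan.induct) (auto simp: vadd_assoc intro: lspan.intros)

lemma lspan_vscale: "u \<in> lspan S \<Longrightarrow> vscale z u \<in> lspan S"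
proof (induction rule: lspan.induct)
  case lzero
  have "vscale z vzero = vzero" by (simp add: vscale_def vzero_def)
  then show ?case by (simp add: lspan.lzero)
next
  case (lstep x y a)
  have "vscale z (vadd (vscale a x) y) = vadd (vscale (z * a) x) (vscale z y)"
    by (simp add: vadd_def vscale_def distrib_left mult.assoc)
  then show ?case using lstep by (simp add: lspan.lstep)
qed

lemma lspan_base: "u \<in> S \<Longrightarrow> u \<in> lspan S"
  using lspan.lstep[OF _ lspan.lzero, of u S 1] by (simp add: vscale_def)

lemma C2_vadd: "u \<in> C2 \<Longrightarrow> v \<in> C2 \<Longrightarrow> vadd u v \<in> C2"
  and C2_vscale: "u \<in> C2 \<Longrightarrow> vscale z u \<in> C2"
  and C2_vzero: "vzero \<in> C2"
  unfolding C2_def by (rule lspan_vadd lspan_vscale lspan.lzero; assumption?)+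

lemma C2_gen: "u \<in> Cmt \<Longrightarrow> v \<in> Cmt \<Longrightarrow> imode u (-2) v \<in> C2"
  unfolding C2_def by (rule lspan_base) blast

lemma subsp_C2: "subsp (\<lambda>f. emb c f \<in> C2)"
  by (auto simp: subsp_def emb_linear intro: C2_vadd C2_vscale C2_vzero)

lemma homC_hh: "homC 2 (int a + int b) (h 1 (int a) * h 1 (int b))"
proof -
  have "hdeg (Suc (Suc 0)) (0 + int b + int a) (h 1 (int a) * (h 1 (int b) * cst 1))"
    by (intro hdeg_h hdeg_cst)
  then show ?thesis by (simp add: homC_def numeral_2_eq_2 add.commute)
qed

lemma emb_Cmt: "homC b d u \<Longrightarrow> emb b u \<in> Cmt"
  unfolding Cmt_eq by (rule espan_emb)

lemma C2_high:
  assumes "homC b d u" "4 \<le> b"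
  shows "emb b u \<in> C2"
proof -
  obtain k where "b = 2 * k" using assms by (auto simp: homC_def elim!: evenE)
  \<comment> \<open>Half the charge that remains for \<open>X\<close> after the factor of charge 2;
    \<open>4 <= b\<close> makes it positive, as \<open>hdeg_reduce_high\<close> demands.\<close>
  define g where "g = nat (k - 1)"
  have b: "b = int (2 * g + 2)" "0 < g" using \<open>b = 2 * k\<close> assms(2) by (auto simp: g_def)
  have "nat b = 2 * g + 2" unfolding b(1) by simp
  then have u: "hdeg (2 * g + 2) d u" using assms(1) by (simp add: homC_def)
  show ?thesis
  proof (rule hdeg_reduce_high[where Q = "\<lambda>f. emb b f \<in> C2", OF subsp_C2 b(2) _ u])
    fix a c e X assume X: "hdeg (2 * g) e X"
    then have PX: "homC (2 * int g) e X" by (simp add: homC_def nat_mult_distrib)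
    have "imode (emb 2 (h 1 (int a) * h 1 (int c))) (-2) (emb (2 * int g) X)
      = emb (2 + 2 * int g) (vmode 2 (2 * int g) (int a + int c + 1 + e - 2 * int g) (h 1 (int a) * h 1 (int c)) X)"
      by (rule imode_emb[OF homC_homV[OF homC_hh] homC_homV[OF PX]]) simp
    moreover have "imode (emb 2 (h 1 (int a) * h 1 (int c))) (-2) (emb (2 * int g) X) \<in> C2"
      by (intro C2_gen emb_Cmt[OF homC_hh] emb_Cmt[OF PX])
    moreover have "2 + 2 * int g = b" using b by simp
    ultimately show "emb b (vmode 2 (2 * int g) (int a + int c + 1 + e - 2 * int g) (h 1 (int a) * h 1 (int c)) X) \<in> C2"
      by simp
  qed
qed

text \<open>The commutant is closed under modes: a mode of e^alpha of low index passes through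
  \<open>u\<close> and kills \<open>X\<close>, and vanishing of the low modes gives back the degree
  bound.\<close>

lemma hdeg_vmode:
  assumes "homC b d u" "homC c e X"
  shows "homC (b + c) w (vmode b c w u X)"
proof -
  have u: "hdeg (nat b) d u" and X: "hdeg (nat c) e X" and b: "int (nat b) = b" "int (nat c) = c"
    using assms by (auto simp: homC_def)
  have "emode N (vmode b c w u X) = 0" if "N < - (b + c)" for N
  proof -
    have "emode (N + b) X = 0" by (rule hdeg_emode_low[OF X]) (use that b in simp)
    then show ?thesis using vmode_emode[OF u hdeg_hom[OF X], of N c w, unfolded b] by (simp add: b)
  qed
  then have "if b + c < 0 then vmode b c w u X = 0 else hdeg (nat (b + c)) w (vmode b c w u X)"
    by (rule emode_low_imp_hdeg[OF hom_vmode[OF hdeg_hom[OF u] hdeg_hom[OF X]]])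
  then show ?thesis using assms by (auto simp: homC_def)
qed

lemma hdeg_0_cst: "hdeg 0 d u \<Longrightarrow> \<exists>z. u = cst z \<and> (z \<noteq> 0 \<longrightarrow> d = 0)"
proof -
  assume "hdeg 0 d u"
  then obtain c where c: "u = (\<Sum>P\<in>msets 0 d. cst (c P) * hprod P)" using hdeg_rep by blast
  show ?thesis
  proof (cases "d = 0")
    case True
    then have "msets 0 d = {{#}}" by (auto simp: msets_def)
    then show ?thesis using c True by auto
  next
    case False
    then have "msets 0 d = {}" by (auto simp: msets_def)
    then show ?thesis using c by (intro exI[of _ 0]) simp
  qed
qed

lemma homC_cases:
  assumes "homC b d u"
  obtains "b = 0" | "b = 2" | "4 \<le> b"
proof -
  obtain k where "b = 2 * k" "0 \<le> b" using assms by (auto simp: homC_def elim!: evenE)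
  then have "b = 0 \<or> b = 2 \<or> 4 \<le> b" by presburger
  then show thesis using that by blast
qed

lemma homC_charge_add:
  assumes "homC b d u" "homC c e v" "b \<noteq> 0" "c \<noteq> 0"
  shows "4 \<le> b + c"
  using assms by (auto elim!: homC_cases)

lemma homC_vac: "homC 0 0 1"
  using homW_vac homW_homC by blast

lemma bvec_emb: "bvec 0 = emb 0 1" "bvec (Suc n) = emb 2 (phi_ser n)"
  by (simp_all add: vac_emb phi_eq)

lemma homC_phi_ser: "homC 2 (2 * int n) (phi_ser n)"
  using hdeg_phi_ser by (simp add: homC_def)

lemma bvec_Cmt: "bvec i \<in> Cmt"
  by (cases i) (auto simp: vac_emb phi_eq intro: emb_Cmt homC_vac homC_phi_ser)

lemma homogeneous_span:
  assumes "homC b d u"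
  shows "\<exists>i z. vdiff (emb b u) (vscale z (bvec i)) \<in> C2"
  using assms
proof (cases rule: homC_cases)
  case 1
  then obtain z where "u = cst z" using assms hdeg_0_cst by (auto simp: homC_def)
  moreover have "emb 0 (cst z) = vscale z (emb 0 1)" using emb_linear(2)[of 0 z 1] by simp
  ultimately have "vdiff (emb b u) (vscale z (bvec 0)) = vzero"
    using 1 unfolding bvec_emb by (simp add: vdiff_def vzero_def)
  then show ?thesis using C2_vzero by metis
next
  case 2
  have "emb 2 (vmode 2 0 (int a + int c + 1) (h 1 (int a) * h 1 (int c)) 1) \<in> C2" for a c
  proof -
    have "imode (emb 2 (h 1 (int a) * h 1 (int c))) (-2) (emb 0 1)
      = emb (2 + 0) (vmode 2 0 (int a + int c + 1) (h 1 (int a) * h 1 (int c)) 1)"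
      by (rule imode_emb[OF homC_homV[OF homC_hh] homV_vac]) simp
    then show ?thesis using C2_gen[OF emb_Cmt[OF homC_hh] emb_Cmt[OF homC_vac], of a c] by simp
  qed
  moreover have "hdeg 2 d u" using assms 2 by (simp add: homC_def)
  ultimately obtain z n where "emb 2 (u - cst z * phi_ser n) \<in> C2"
    using charge2_span[OF subsp_C2[of 2]] by blast
  moreover have "emb 2 (u - cst z * phi_ser n) = vdiff (emb b u) (vscale z (bvec (Suc n)))"
    unfolding bvec_emb 2 by (auto simp: fun_eq_iff emb_def vdiff_def vscale_def)
  ultimately show ?thesis by metis
next
  case 3
  then have "vdiff (emb b u) (vscale 0 (bvec 0)) \<in> C2"
    using C2_high[OF assms] by (simp add: vdiff_def vscale_def)
  then show ?thesis by blast
qed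

lemma lcomb_add: "\<exists>N' c'. vadd (lcomb c N) (vscale z (bvec i)) = lcomb c' N'"
proof -
  define M where "M = max N (Suc i)"
  define c' where "c' j = (if j < N then c j else 0) + (if j = i then z else 0)" for j
  have "lcomb c' M k = lcomb c N k + z * bvec i k" for k
  proof -
    have "lcomb c' M k = (\<Sum>j<M. (if j < N then c j * bvec j k else 0)) + (\<Sum>j<M. if j = i then z * bvec i k else 0)"
      unfolding lcomb_def sum.distrib[symmetric] by (rule sum.cong) (auto simp: c'_def distrib_right)
    also have "(\<Sum>j<M. (if j < N then c j * bvec j k else 0)) = (\<Sum>j<N. c j * bvec j k)"
      by (rule sum.mono_neutral_cong_right) (auto simp: M_def)
    finally show ?thesis by (simp add: lcomb_def M_def)
  qed
  then have "vadd (lcomb c N) (vscale z (bvec i)) = lcomb c' M"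
    by (auto simp: vadd_def vscale_def)
  then show ?thesis by blast
qed

lemma Cmt_span:
  assumes "v \<in> Cmt"
  shows "\<exists>N c. vdiff v (lcomb c N) \<in> C2"
  using assms unfolding Cmt_eq
proof (induction rule: espan.induct)
  case espan_0
  have "vdiff vzero (lcomb (\<lambda>_. 0) 0) = vzero" by (simp add: vdiff_def vzero_def lcomb_def)
  then show ?case using C2_vzero by metis
next
  case (espan_add b d u v)
  then obtain N c where 1: "vdiff v (lcomb c N) \<in> C2" by blast
  obtain i z where 2: "vdiff (emb b u) (vscale z (bvec i)) \<in> C2"
    using homogeneous_span[OF espan_add(1)] by blast
  obtain N' c' where "vadd (lcomb c N) (vscale z (bvec i)) = lcomb c' N'" using lcomb_add by blast
  then have *: "lcomb c' N' = vadd (lcomb c N) (vscale z (bvec i))" by simp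
  have "vdiff (vadd (emb b u) v) (lcomb c' N') = vadd (vdiff (emb b u) (vscale z (bvec i))) (vdiff v (lcomb c N))"
    unfolding * by (auto simp: vadd_def vdiff_def fun_eq_iff)
  then show ?case using C2_vadd[OF 2 1] by metis
qed

section \<open>Linear independence in the quotient\<close>

lemma Lam_vmode_vac:
  assumes N: "even N" and u: "hdeg 2 d u"
  shows "Lam N (vmode 2 0 (d + 1) u 1) = 0"
proof -
  \<comment> \<open>Homogeneity is included in the predicate because \<open>vmode_add\<close> asks
    for it.\<close>
  let ?Q = "\<lambda>f. hom d f \<and> Lam N (vmode 2 0 (d + 1) f 1) = 0"
  have Q: "subsp ?Q"
    unfolding subsp_def using vmode_add(1)[OF _ _ hom_1 hom_1] vmode_add(3)[OF _ _ hom_1 hom_1] by auto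
  obtain c where c: "u = (\<Sum>P\<in>msets 2 d. cst (c P) * hprod P)" using hdeg_rep[OF u] by blast
  have "?Q (\<Sum>P\<in>msets 2 d. cst (c P) * hprod P)"
  proof (rule subsp_sum[OF Q])
    fix P assume P: "P \<in> msets 2 d"
    have "size P = Suc 1" using P by (simp add: msets_def)
    then obtain i P' where P': "P = add_mset i P'" by (metis size_eq_Suc_imp_eq_union)
    with \<open>size P = Suc 1\<close> have "size P' = 1" by simp
    then obtain j where "P' = {#j#}" using size_1_singleton_mset by blast
    with P' have ij: "P = {#i, j#}" by simp
    then have d: "d = int i + int j" using P by (auto simp: msets_def)
    have "?Q (hprod P)"
      using Lam_vac[OF N, of i j] hom_mult[OF hom_h[of "int i" 1] hom_h[of "int j" 1]] by (simp add: ij d)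
    then show "?Q (cst (c P) * hprod P)" using Q unfolding subsp_def by blast
  qed
  then show ?thesis by (simp add: c)
qed

text \<open>Common kernel of functionals that are dual, up to nonzero scalars, to the proposed
  basis: the vacuum coefficient and, for each even \<open>N\<close>, \<open>Lam N\<close> in charge
  2.\<close>

definition coord0 :: "vec \<Rightarrow> bool" where
  "coord0 v \<longleftrightarrow> (\<forall>N. even N \<longrightarrow> Lam N (charge_part 2 v) = 0) \<and> v (0, {#}) = 0"

lemma coord0_closed: "coord0 vzero" "coord0 u \<Longrightarrow> coord0 v \<Longrightarrow> coord0 (vadd u v)" "coord0 u \<Longrightarrow> coord0 (vscale z u)"
proof -
  have "vzero k = 0" "vadd u v k = u k + v k" "vscale z u k = z * u k" for k
    by (simp_all add: vzero_def vadd_def vscale_def)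
  then show "coord0 vzero" "coord0 u \<Longrightarrow> coord0 v \<Longrightarrow> coord0 (vadd u v)" "coord0 u \<Longrightarrow> coord0 (vscale z u)"
    by (simp_all add: coord0_def)
qed

text \<open>Charge 0 contains only scalars. A scalar on the left gives 1(-2) = 0; one on the right
  gives u(-2)1, which \<open>Lam\<close> annihilates in charge 2; if neither charge is 0, the result
  has charge at least 4, where the functionals see nothing.\<close>

lemma coord0_gen:
  assumes "u \<in> espan homC" "v \<in> espan homC"
  shows "coord0 (imode u (-2) v)"
  using assms
proof (rule imode_espan_cases)
  fix b d u c e v assume u: "homC b d u" and v: "homC c e v"
  have hom: "hom d u" "hom e v" using homC_homV[OF u] homC_homV[OF v] by (simp_all add: homV_def)
  define w where "w = d + e - (b * c) div 2 + 1"
  have im: "imode (emb b u) (-2) (emb c v) = emb (b + c) (vmode b c w u v)"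
    by (rule imode_emb[OF homC_homV[OF u] homC_homV[OF v]]) (simp add: w_def)
  have bz: "coord0 (emb (b + c) 0)" by (simp add: emb_linear coord0_closed)
  show "coord0 (imode (emb b u) (-2) (emb c v))"
  proof (cases "b = 0")
    case True
    then obtain z where z: "u = cst z" "z \<noteq> 0 \<longrightarrow> d = 0" using u hdeg_0_cst by (auto simp: homC_def)
    have "vmode b c w u v = 0"
    proof (cases "z = 0")
      case False
      then have "w \<noteq> e" using z(2) True by (simp add: w_def)
      then show ?thesis using vmode_one[OF hom(2), of c w z] z(1) True by simp
    qed (simp add: z(1))
    then show ?thesis using im bz by simp
  next
    case b: False
    show ?thesis
    proof (cases "c = 0")
      case True
      then obtain z where z: "v = cst z" "z \<noteq> 0 \<longrightarrow> e = 0" using v hdeg_0_cst by (auto simp: homC_def)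
      show ?thesis
      proof (cases "z = 0")
        case True
        then have "vmode b c w u v = 0" by (simp add: z)
        then show ?thesis using im bz by simp
      next
        case False
        have "vmode b 0 w u (cst z * 1) = cst z * vmode b 0 w u 1"
          by (rule vmode_add(4)[OF hom(1) hom(1) hom_1 hom_1])
        then have V: "vmode b c w u v = cst z * vmode b 0 (d + 1) u 1"
          using z False \<open>c = 0\<close> by (simp add: w_def)
        from u show ?thesis
        proof (cases rule: homC_cases)
          case 2
          then have "hdeg 2 d u" using u by (simp add: homC_def)
          then show ?thesis
            unfolding im V using 2 \<open>c = 0\<close> by (auto simp: coord0_def Lam_vmode_vac emb_apply)
        next
          case 3
          then show ?thesis unfolding im using \<open>c = 0\<close> by (auto simp: coord0_def emb_apply)
        qed (use b in simp)
      qed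
    next
      case False
      then have "4 \<le> b + c" using b by (intro homC_charge_add[OF u v])
      then show ?thesis unfolding im by (auto simp: coord0_def emb_apply)
    qed
  qed
qed (auto intro: coord0_closed homC_homV)

lemma coord0_C2: "v \<in> C2 \<Longrightarrow> coord0 v"
  unfolding C2_def
proof (induction rule: lspan.induct)
  case (lstep x y a)
  then have "coord0 x" using coord0_gen by (auto simp: Cmt_eq)
  then show ?case using lstep coord0_closed by simp
qed (rule coord0_closed)

lemma bvec_independent:
  assumes "lcomb c N \<in> C2" "i < N"
  shows "c i = 0"
proof -
  have co: "coord0 (lcomb c N)" by (rule coord0_C2[OF assms(1)])
  show ?thesis
  proof (cases i)
    case 0
    have "0 = lcomb c N (0, {#})" using co by (simp add: coord0_def)
    also have "\<dots> = (\<Sum>j<N. if j = 0 then c 0 else 0)"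
      unfolding lcomb_def
    proof (rule sum.cong[OF refl])
      fix j
      show "c j * bvec j (0, {#}) = (if j = 0 then c 0 else 0)"
        by (cases j) (simp_all add: vac_emb phi_eq emb_apply cf_one)
    qed
    finally show ?thesis using 0 assms(2) by simp
  next
    case (Suc n)
    have "charge_part 2 (lcomb c N) = (\<Sum>j<N. cst (c j) * charge_part 2 (bvec j))"
      by (rule mser_eqI) (simp add: charge_part_def lcomb_def)
    then have "0 = (\<Sum>j<N. c j * Lam (2 * n) (charge_part 2 (bvec j)))"
      using co by (simp add: coord0_def)
    also have "\<dots> = (\<Sum>j<N. if j = i then c i * Lam (2 * n) (phi_ser n) else 0)"
    proof (rule sum.cong[OF refl])
      fix j
      show "c j * Lam (2 * n) (charge_part 2 (bvec j)) = (if j = i then c i * Lam (2 * n) (phi_ser n) else 0)"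
        by (cases j) (auto simp: Suc vac_emb phi_eq Lam_phi_ser_other)
    qed
    finally show ?thesis using assms(2) Lam_phi_ser[of n] by simp
  qed
qed

lemma imode_high_C2:
  assumes u: "homC b d u" and v: "homC c e v" and bc: "b \<noteq> 0" "c \<noteq> 0"
  shows "imode (emb b u) n (emb c v) \<in> C2"
proof -
  have "4 \<le> b + c" by (rule homC_charge_add[OF assms])
  then show ?thesis
    using imode_emb[OF homC_homV[OF u] homC_homV[OF v] refl, of n] C2_high[OF hdeg_vmode[OF u v]] by simp
qed

text \<open>Charge 0 consists of scalars, where 1(0) = 0 and u(0)1 = 0; all other brackets land in
  charge at least 4.\<close>

lemma bracket_C2:
  assumes "u \<in> espan homC" "v \<in> espan homC"
  shows "imode u 0 v \<in> C2"
  using assms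
proof (rule imode_espan_cases)
  fix b d u c e v assume u: "homC b d u" and v: "homC c e v"
  have hom: "hom d u" "hom e v" using homC_homV[OF u] homC_homV[OF v] by (simp_all add: homV_def)
  define w where "w = d + e - (b * c) div 2 - 1"
  have im: "imode (emb b u) 0 (emb c v) = emb (b + c) (vmode b c w u v)"
    by (rule imode_emb[OF homC_homV[OF u] homC_homV[OF v]]) (simp add: w_def)
  have bz: "emb (b + c) 0 \<in> C2" by (simp add: emb_linear C2_vzero)
  show "imode (emb b u) 0 (emb c v) \<in> C2"
  proof (cases "b = 0")
    case True
    then obtain z where z: "u = cst z" "z \<noteq> 0 \<longrightarrow> d = 0" using u hdeg_0_cst by (auto simp: homC_def)
    have "vmode b c w u v = 0"
    proof (cases "z = 0")
      case False
      then have "w \<noteq> e" using z(2) True by (simp add: w_def)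
      then show ?thesis using vmode_one[OF hom(2), of c w z] z(1) True by simp
    qed (simp add: z(1))
    then show ?thesis using im bz by simp
  next
    case b: False
    show ?thesis
    proof (cases "c = 0")
      case True
      then obtain z where z: "v = cst z" "z \<noteq> 0 \<longrightarrow> e = 0" using v hdeg_0_cst by (auto simp: homC_def)
      have "vmode b c w u v = 0"
      proof (cases "z = 0")
        case False
        have "vmode b 0 w u (cst z * 1) = cst z * vmode b 0 w u 1"
          by (rule vmode_add(4)[OF hom(1) hom(1) hom_1 hom_1])
        moreover have "vmode b 0 w u 1 = 0"
          using vmode_creation[of d u w b] homC_homV[OF u] z False True by (simp add: homV_def w_def)
        ultimately show ?thesis using z True by simp
      qed (simp add: z)
      then show ?thesis using im bz by simp
    next
      case False
      then show ?thesis by (rule imode_high_C2[OF u v b])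
    qed
  qed
qed (auto intro: C2_vadd C2_vzero homC_homV)

theorem theorem6p1:
  shows "(\<forall>i. bvec i \<in> Cmt)
    \<and> (\<forall>N c. lcomb c N \<in> C2 \<longrightarrow> (\<forall>i<N. c i = 0))
    \<and> (\<forall>v\<in>Cmt. \<exists>N c. vdiff v (lcomb c N) \<in> C2)
    \<and> (\<forall>v\<in>Cmt. vdiff (imode vac (-1) v) v \<in> C2 \<and> vdiff (imode v (-1) vac) v \<in> C2)
    \<and> (\<forall>n m. imode (phi n) (-1) (phi m) \<in> C2)
    \<and> (\<forall>u\<in>Cmt. \<forall>v\<in>Cmt. imode u 0 v \<in> C2)"
proof (intro conjI allI ballI impI)
  fix v assume "v \<in> Cmt"
  then have v: "v \<in> espan homV" using espan_homC_homV by (simp add: Cmt_eq)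
  have "vdiff v v = vzero" by (simp add: vdiff_def vzero_def)
  then show "vdiff (imode vac (-1) v) v \<in> C2" "vdiff (imode v (-1) vac) v \<in> C2"
    by (simp_all add: vacuum[OF v] creation[OF v] C2_vzero)
next
  fix n m
  show "imode (phi n) (-1) (phi m) \<in> C2"
    unfolding phi_eq by (rule imode_high_C2[OF homC_phi_ser homC_phi_ser]) simp_all
qed (auto simp: bvec_Cmt bvec_independent Cmt_span bracket_C2 Cmt_eq[symmetric] simp del: bvec.simps)

end
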